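(* Let $\Omega\subset\mathbb{C}$ be an $n$-connected quadrature domain of finite area such that no boundary component of $\Omega$ is a point. If $f$ is any proper holomorphic mapping of $\Omega$ onto the unit disc, then $f'$ extends to the double of $\Omega$ as a meromorphic function.
   Context: A domain $\Omega\subset\mathbb{C}$ that is $n$-connected with no boundary component a point is a quadrature domain if there exist finitely many points $w_1,\dots,w_N\in\Omega$, non-negative integers $n_j$ and complex numbers $c_{jk}$ such that $\int_\Omega f\,dA=\sum_{j=1}^N\sum_{k=0}^{n_j}c_{jk}f^{(k)}(w_j)$ for every square-integrable holomorphic $f$ on $\Omega$. Such $\Omega$ is conformally equivalent via a map $\Phi$ to a bounded domain $\widetilde\Omega$ whose boundary consists of $n$ disjoint simple closed real-analytic curves; $\widetilde\Omega$ is a bordered Riemann surface with a compact (Schottky) double. A meromorphic function $h$ on $\Omega$ is said to extend meromorphically to the double of $\Omega$ if $h\circ\Phi^{-1}$ extends to a meromorphic function on the double of $\widetilde\Omega$. *)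

theory Defs
  imports "HOL-Complex_Analysis.Complex_Analysis"
begin

definition quadrature_domain :: "complex set \<Rightarrow> bool" where
  "quadrature_domain \<Omega> \<longleftrightarrow> open \<Omega> \<and> connected \<Omega> \<and>
     (\<exists>(N::nat) (w::nat \<Rightarrow> complex) (m::nat \<Rightarrow> nat) (c::nat \<Rightarrow> nat \<Rightarrow> complex).
        (\<forall>j<N. w j \<in> \<Omega>) \<and>
        (\<forall>f. f holomorphic_on \<Omega> \<and> set_integrable lborel \<Omega> (\<lambda>z. (cmod (f z))\<^sup>2) \<longrightarrow>
             (LINT z:\<Omega>|lborel. f z) = (\<Sum>j<N. \<Sum>k\<le>m j. c j k * (deriv ^^ k) f (w j))))"

text \<open>n-connected with no complementary (equivalently boundary) component a point.\<close>
definition n_connected_nondegenerate :: "complex set \<Rightarrow> nat \<Rightarrow> bool" where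
  "n_connected_nondegenerate \<Omega> n \<longleftrightarrow>
     finite (components (- \<Omega>)) \<and> card (components (- \<Omega>)) = n \<and>
     (\<forall>C\<in>components (- \<Omega>). \<not> (\<exists>a. C = {a}))"

definition analytic_jordan_curve :: "(real \<Rightarrow> complex) \<Rightarrow> bool" where
  "analytic_jordan_curve g \<longleftrightarrow> (\<forall>t. g (t + 1) = g t) \<and> simple_path g \<and>
     (\<exists>U G. open U \<and> range complex_of_real \<subseteq> U \<and> G holomorphic_on U \<and>
        (\<forall>t. G (complex_of_real t) = g t) \<and> (\<forall>t. deriv G (complex_of_real t) \<noteq> 0))"

definition analytic_n_bordered :: "complex set \<Rightarrow> nat \<Rightarrow> bool" where
  "analytic_n_bordered U n \<longleftrightarrow> open U \<and> connected U \<and> bounded U \<and>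
     (\<exists>\<gamma>::nat \<Rightarrow> real \<Rightarrow> complex.
        (\<forall>i<n. analytic_jordan_curve (\<gamma> i)) \<and>
        (\<forall>i<n. \<forall>j<n. i \<noteq> j \<longrightarrow> path_image (\<gamma> i) \<inter> path_image (\<gamma> j) = {}) \<and>
        frontier U = (\<Union>i<n. path_image (\<gamma> i)))"

text \<open>A holomorphic chart of the (Schottky) double of U centred at a boundary point p:
  a conformal map G of a disc onto a neighbourhood of p, sending the upper half-disc
  into U, the lower half-disc outside the closure of U and the real diameter into the
  boundary.  The second copy of U carries the conjugate structure, so the chart
  w \<mapsto> G (cnj w) on the lower half-disc parametrises the reflected copy.\<close>
definition double_chart :: "complex set \<Rightarrow> (complex \<Rightarrow> complex) \<Rightarrow> real \<Rightarrow> complex \<Rightarrow> bool" where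
  "double_chart U G r p \<longleftrightarrow> r > 0 \<and> G holomorphic_on ball 0 r \<and> inj_on G (ball 0 r) \<and>
     G 0 = p \<and>
     (\<forall>w\<in>ball 0 r. Im w > 0 \<longrightarrow> G w \<in> U) \<and>
     (\<forall>w\<in>ball 0 r. Im w < 0 \<longrightarrow> G w \<notin> closure U) \<and>
     (\<forall>w\<in>ball 0 r. Im w = 0 \<longrightarrow> G w \<in> frontier U)"

text \<open>g (on U) extends to a meromorphic function on the double of U: there is a function
  H2 on the second (reflected) copy, meromorphic in the conjugate coordinate, such that
  g and H2 glue to a meromorphic function in a double chart around every boundary point.\<close>
definition extends_meromorphically_to_double :: "complex set \<Rightarrow> (complex \<Rightarrow> complex) \<Rightarrow> bool" where
  "extends_meromorphically_to_double U g \<longleftrightarrow> g meromorphic_on U \<and>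
     (\<exists>H2. (\<lambda>w. H2 (cnj w)) meromorphic_on (cnj ` U) \<and>
        (\<forall>p\<in>frontier U. \<exists>G r. double_chart U G r p \<and>
           (\<lambda>w. if Im w > 0 then g (G w) else H2 (G (cnj w))) meromorphic_on ball 0 r))"

definition proper_holo_onto_disc :: "complex set \<Rightarrow> (complex \<Rightarrow> complex) \<Rightarrow> bool" where
  "proper_holo_onto_disc \<Omega> f \<longleftrightarrow> f holomorphic_on \<Omega> \<and> f ` \<Omega> = ball 0 1 \<and>
     (\<forall>K. compact K \<and> K \<subseteq> ball 0 1 \<longrightarrow> compact (\<Omega> \<inter> f -` K))"

end

theory Submission
  imports Defs
begin

text \<open>
  Let \<open>\<phi> : U \<rightarrow> \<Omega>\<close> be the inverse of \<open>\<Phi>\<close> and \<open>F = f \<circ> \<phi>\<close>. Since \<open>f' \<circ> \<phi> = F' / \<phi>'\<close>, it is enough to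
  extend \<open>F\<close> and \<open>\<phi>\<close> meromorphically to the double. As \<open>f\<close> is proper, \<open>|F| \<rightarrow> 1\<close> at the boundary, and \<open>F\<close>
  is continued to the second copy by \<open>1 / cnj F\<close>. For \<open>\<phi>\<close> one needs a meromorphic \<open>M\<close> on \<open>U\<close> with
  \<open>cnj \<phi> - M \<rightarrow> 0\<close> at the boundary; then \<open>cnj M\<close> continues \<open>\<phi>\<close>.

  To find \<open>M\<close>, pull the quadrature identity back to \<open>U\<close>: it says that \<open>H \<mapsto> \<integral>\<^sub>U H cnj(\<phi>')\<close> is a finite combination of
  derivatives of \<open>H\<close> at points of \<open>U\<close>. Testing with \<open>H(z) = 1 / (z - \<zeta>)\<close> shows that the Cauchy transform \<open>C\<close> of
  \<open>cnj(\<phi>') 1\<^sub>U\<close> is a rational function \<open>R\<close> of \<open>\<zeta>\<close> outside \<open>U\<close>, while inside \<open>U\<close> the function \<open>C + \<pi> cnj \<phi>\<close> is holomorphic.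
  So \<open>M = (C + \<pi> cnj \<phi> - R) / \<pi>\<close> is meromorphic with \<open>cnj \<phi> - M = (R - C) / \<pi>\<close>. In a boundary chart
  \<open>C(\<zeta>) - C(\<zeta>\<^sup>*) \<rightarrow> 0\<close> as \<open>\<zeta>\<close> and its mirror point \<open>\<zeta>\<^sup>*\<close> approach the boundary, because \<open>\<phi>'\<close> is square
  integrable (\<open>\<Omega>\<close> has finite area) and the difference of the two kernels is dominated by the
  kernel \<open>y / (y\<^sup>2 + |z - \<zeta>|\<^sup>2)\<close>, whose \<open>L\<^sup>2\<close> norm is bounded uniformly in \<open>y\<close>.
\<close>

subsection \<open>Change of variables for injective holomorphic maps\<close>

unbundle no fps_syntax

text \<open>Nothing is known about the boundary of \<open>\<Omega>\<close>, so neither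
  \<open>\<phi>\<close> nor \<open>cnj \<phi>\<close> need have boundary values; only the difference
  \<open>cnj \<phi> - M\<close> is controlled. Reflection in its usual form asks for continuity up
  to the line, so in each chart it is applied to primitives, and the glued primitive is
  differentiated. This needs a growth bound on \<open>\<phi>\<close>, and finite area supplies it:
  the mean value property of the square of \<open>\<phi>'\<close> gives
  \<open>|\<phi>'| = O(1 / dist)\<close>.

  Finite area enters a second time for \<open>C\<close>. The kernel
  \<open>y / (y^2 + |z - \<zeta>|^2)\<close> has critical scaling: its L2 norm stays bounded as
  \<open>y\<close> tends to 0 but does not become small, so Cauchy-Schwarz alone yields only
  boundedness. Smallness comes from the other factor, since the integral of
  \<open>|\<phi>'|^2\<close> over a small disc about a boundary point is small.

  The mirror point serves to leave the closure of \<open>U\<close>: there the test function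
  \<open>1 / (z - \<zeta>)\<close> is bounded on \<open>U\<close>, the quadrature identity applies
  and \<open>C\<close> is literally \<open>R\<close>. Both are then compared across the boundary
  without a limit of \<open>C\<close> being taken.\<close>

lemma lborel_complex_eq_distr:
  "(lborel :: complex measure) = distr (lborel :: (real^2) measure) borel (\<lambda>v. Complex (v$1) (v$2))"
proof (rule lborel_eqI)
  let ?T = "\<lambda>v::real^2. Complex (v$1) (v$2)"
  have cont: "continuous_on UNIV ?T"
    unfolding Complex_eq by (intro continuous_intros)
  hence meas: "?T \<in> borel_measurable lborel"
    by (simp add: borel_measurable_continuous_onI)
  fix l u :: complex
  assume lu: "\<And>b. b \<in> Basis \<Longrightarrow> l \<bullet> b \<le> u \<bullet> b"
  have le: "Re l \<le> Re u" "Im l \<le> Im u"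
    using lu[of 1] lu[of \<i>] by (auto simp: Basis_complex_def)
  let ?l = "vector [Re l, Im l] :: real^2" and ?u = "vector [Re u, Im u] :: real^2"
  have pre: "?T -` box l u = box ?l ?u"
    by (auto simp: in_box_complex_iff mem_box_cart forall_2)
  have b2: "\<And>b::real^2. b \<in> Basis \<Longrightarrow> ?l \<bullet> b \<le> ?u \<bullet> b"
  proof -
    fix b :: "real^2" assume "b \<in> Basis"
    then obtain i where "b = axis i 1" by (auto simp: Basis_vec_def)
    thus "?l \<bullet> b \<le> ?u \<bullet> b" using le exhaust_2[of i] by (auto simp: inner_axis)
  qed
  have "emeasure (distr lborel borel ?T) (box l u) = emeasure lborel (box ?l ?u)"
    using meas by (simp add: emeasure_distr pre)
  also have "\<dots> = (\<Prod>b\<in>Basis. (?u - ?l) \<bullet> b)"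
    using b2 by simp
  also have "(\<Prod>b\<in>Basis. (?u - ?l) \<bullet> b) = (\<Prod>i\<in>UNIV. (?u - ?l) $ i)"
  proof -
    have *: "(Basis :: (real^2) set) = (\<lambda>i. axis i 1) ` UNIV"
      by (auto simp: Basis_vec_def)
    have "inj (\<lambda>i::2. axis i (1::real))"
      by (auto simp: inj_on_def axis_eq_axis)
    thus ?thesis
      unfolding * by (subst prod.reindex) (simp_all add: inner_axis)
  qed
  also have "\<dots> = (\<Prod>b\<in>Basis. (u - l) \<bullet> b)"
    by (simp add: UNIV_2 Basis_complex_def)
  finally show "emeasure (distr lborel borel ?T) (box l u) = (\<Prod>b\<in>Basis. (u - l) \<bullet> b)" .
qed simp

text \<open>The Jacobian formula \<open>has_measure_differentiable_image\<close> lives on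
  \<open>real^2\<close>, so sets and maps are carried there by \<open>?V\<close> and back by
  \<open>?T\<close>. Multiplication by \<open>a + i b\<close> has the real determinant
  \<open>a^2 + b^2\<close>, which is how \<open>|f'|^2\<close> arises. The image of a Borel set is
  Borel because it is a preimage under the continuous inverse.\<close>

lemma emeasure_holomorphic_image:
  fixes f :: "complex \<Rightarrow> complex"
  assumes hol: "f holomorphic_on S" and "open S" and inj: "inj_on f S"
    and A: "A \<in> sets borel" "A \<subseteq> S"
  shows "f ` A \<in> sets borel"
    and "emeasure lborel (f ` A) = (\<integral>\<^sup>+z\<in>A. ennreal ((cmod (deriv f z))\<^sup>2) \<partial>lborel)"
proof -
  let ?T = "\<lambda>v::real^2. Complex (v$1) (v$2)"
  let ?V = "\<lambda>z. vector [Re z, Im z] :: real^2"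
  have TV[simp]: "?T (?V z) = z" for z by (simp)
  have VT[simp]: "?V (?T v) = v" for v by (simp add: vec_eq_iff forall_2)
  have blT: "bounded_linear ?T" unfolding Complex_eq
    by (intro bounded_linear_add bounded_linear_const_mult bounded_linear_compose[OF bounded_linear_of_real] bounded_linear_vec_nth)
  have V_alt: "?V = (\<lambda>z. \<chi> i. if i = 1 then Re z else Im z)"
    by (auto simp: vec_eq_iff forall_2)
  have linV: "linear ?V" unfolding V_alt
    by (auto simp: linear_iff vec_eq_iff)
  have blV: "bounded_linear ?V"
    using linV by (simp add: linear_conv_bounded_linear)
  have "continuous_on UNIV ?T"
    using blT by (rule linear_continuous_on)
  hence Tm: "?T \<in> borel_measurable borel"
    by (rule borel_measurable_continuous_onI)
  have T_img: "?T -` B = ?V ` B" for B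
  proof (intro equalityI subsetI)
    fix v assume "v \<in> ?T -` B"
    hence "?T v \<in> B" by simp
    moreover have "v = ?V (?T v)" by (rule VT[symmetric])
    ultimately show "v \<in> ?V ` B" by (rule image_eqI[rotated])
  next
    fix v assume "v \<in> ?V ` B"
    thus "v \<in> ?T -` B" by auto
  qed
  have em: "emeasure lborel B = emeasure lborel (?V ` B)" if "B \<in> sets borel" for B :: "complex set"
    using that Tm by (subst lborel_complex_eq_distr) (simp add: emeasure_distr T_img)
  have mapV: "?V ` B \<in> sets borel" if "B \<in> sets borel" for B
    using measurable_sets_borel[OF Tm that] by (simp add: T_img)
  show fA: "f ` A \<in> sets borel"
  proof -
    let ?h = "inv_into S f"
    have "open (f ` S)"
      by (rule open_mapping_thm3[OF hol \<open>open S\<close> inj])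
    obtain h where h: "h holomorphic_on f ` S" "\<And>z. z \<in> S \<Longrightarrow> h (f z) = z"
      using holomorphic_has_inverse[OF hol \<open>open S\<close> inj] by metis
    have "continuous_on (f ` S) h"
      by (rule holomorphic_on_imp_continuous_on[OF h(1)])
    hence "continuous_on (f ` S) ?h"
      by (rule continuous_on_eq) (use h(2) inj in \<open>auto simp: inv_into_f_f\<close>)
    hence "?h \<in> borel_measurable (restrict_space borel (f ` S))"
      by (rule borel_measurable_continuous_on_restrict)
    from measurable_sets[OF this A(1)] have "?h -` A \<inter> f ` S \<in> sets (restrict_space borel (f ` S))"
      by (simp add: space_restrict_space)
    hence "?h -` A \<inter> f ` S \<in> sets borel"
      using \<open>open (f ` S)\<close> by (simp add: sets_restrict_space_iff)
    moreover have "?h -` A \<inter> f ` S = f ` A"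
      using A(2) inj by (auto simp: inv_into_f_f subset_iff)
    ultimately show ?thesis by simp
  qed
  let ?g = "?V \<circ> f \<circ> ?T"
  let ?g' = "\<lambda>v h. ?V (deriv f (?T v) * ?T h)"
  let ?B = "?V ` A"
  have Bl: "?B \<in> sets lebesgue"
    using mapV[OF A(1)] by simp
  have der: "(?g has_derivative ?g' v) (at v within ?B)" if "v \<in> ?B" for v
  proof -
    have "?T v \<in> S" using that A(2) by auto
    hence "(f has_derivative (*) (deriv f (?T v))) (at (?T v))"
      using hol \<open>open S\<close> holomorphic_derivI has_field_derivative_def by blast
    hence "((f \<circ> ?T) has_derivative (\<lambda>h. deriv f (?T v) * ?T h)) (at v)"
      using diff_chain_at[OF bounded_linear_imp_has_derivative[OF blT]] by (auto simp: o_def)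
    hence "((?V \<circ> (f \<circ> ?T)) has_derivative ?g' v) (at v)"
      unfolding o_def by (rule bounded_linear.has_derivative[OF blV])
    thus ?thesis by (simp add: comp_assoc has_derivative_at_withinI)
  qed
  have injg: "inj_on ?g ?B"
  proof (rule inj_onI)
    fix v w assume vw: "v \<in> ?B" "w \<in> ?B" "?g v = ?g w"
    then obtain a b where ab: "a \<in> A" "b \<in> A" "v = ?V a" "w = ?V b" by blast
    have "f a = f b" using arg_cong[OF vw(3), of ?T] ab by (simp add: TV del: complex_eq_iff)
    thus "v = w" using ab inj A(2) by (auto dest: inj_onD)
  qed
  have img: "?g ` ?B = ?V ` (f ` A)" by (auto simp: image_iff)
  have det: "\<bar>det (matrix (?g' v))\<bar> = (cmod (deriv f (?T v)))\<^sup>2" for v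
    by (simp add: det_2 matrix_def axis_def cmod_power2) (simp add: power2_eq_square)
  have iff: "?g ` ?B \<in> lmeasurable \<and> measure lebesgue (?g ` ?B) = m
     \<longleftrightarrow> ((\<lambda>v. (cmod (deriv f (?T v)))\<^sup>2) has_integral m) ?B" for m
    using has_measure_differentiable_image[OF Bl der injg, of m] unfolding det by simp
  have imgb: "?g ` ?B \<in> sets borel"
    unfolding img by (rule mapV[OF fA])
  have dm: "(\<lambda>z. (cmod (deriv f z))\<^sup>2 * indicator A z) \<in> borel_measurable borel"
  proof -
    have "(\<lambda>z. indicator S z *\<^sub>R deriv f z) \<in> borel_measurable borel"
      using \<open>open S\<close> hol holomorphic_deriv holomorphic_on_imp_continuous_on
      by (intro borel_measurable_continuous_on_indicator) auto
    hence "(\<lambda>z. (cmod (indicator S z *\<^sub>R deriv f z))\<^sup>2 * indicator A z) \<in> borel_measurable borel"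
      using A(1) by measurable
    moreover have "(\<lambda>z. (cmod (indicator S z *\<^sub>R deriv f z))\<^sup>2 * indicator A z) = (\<lambda>z. (cmod (deriv f z))\<^sup>2 * indicator A z)"
      using A(2) by (auto simp: fun_eq_iff indicator_def)
    ultimately show ?thesis by simp
  qed
  have dm': "(\<lambda>v. (cmod (deriv f (?T v)))\<^sup>2 * indicator ?B v) \<in> borel_measurable borel"
  proof -
    have "indicator ?B v = (indicator A (?T v) :: real)" for v :: "real^2"
      by (simp add: indicator_def flip: T_img)
    thus ?thesis using measurable_compose[OF Tm dm] by simp
  qed
  have nn: "(\<integral>\<^sup>+z\<in>A. ennreal ((cmod (deriv f z))\<^sup>2) \<partial>lborel)
      = (\<integral>\<^sup>+v. ennreal ((cmod (deriv f (?T v)))\<^sup>2 * indicator ?B v) \<partial>lborel)"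
  proof -
    have "(\<integral>\<^sup>+z\<in>A. ennreal ((cmod (deriv f z))\<^sup>2) \<partial>lborel)
      = (\<integral>\<^sup>+z. ennreal ((cmod (deriv f z))\<^sup>2 * indicator A z) \<partial>lborel)"
      by (intro nn_integral_cong) (auto simp: indicator_def)
    also have "\<dots> = (\<integral>\<^sup>+v. ennreal ((cmod (deriv f (?T v)))\<^sup>2 * indicator A (?T v)) \<partial>lborel)"
      using dm Tm by (subst lborel_complex_eq_distr) (simp add: nn_integral_distr)
    also have "\<dots> = (\<integral>\<^sup>+v. ennreal ((cmod (deriv f (?T v)))\<^sup>2 * indicator ?B v) \<partial>lborel)"
      by (intro nn_integral_cong) (auto simp: indicator_def simp flip: T_img)
    finally show ?thesis .
  qed
  have ri: "(F has_integral m) ?B \<longleftrightarrow> ((\<lambda>v. F v * indicator ?B v) has_integral m) UNIV" for F :: "real^2 \<Rightarrow> real" and m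
  proof -
    have "(\<lambda>v. F v * indicator ?B v) = (\<lambda>v. if v \<in> ?B then F v else 0)"
      by (auto simp: fun_eq_iff)
    thus ?thesis by (simp only: has_integral_restrict_UNIV)
  qed
  show "emeasure lborel (f ` A) = (\<integral>\<^sup>+z\<in>A. ennreal ((cmod (deriv f z))\<^sup>2) \<partial>lborel)"
  \<comment> \<open>The Jacobian formula is an equivalence about finite measures. When the image has
    infinite measure it is used backwards: a finite integral would make the image measurable with
    finite measure.\<close>
  proof (cases "emeasure lborel (?g ` ?B) < \<infinity>")
    case True
    hence "?g ` ?B \<in> lmeasurable"
      using imgb by (intro fmeasurableI) auto
    with iff have hi: "((\<lambda>v. (cmod (deriv f (?T v)))\<^sup>2) has_integral (measure lebesgue (?g ` ?B))) ?B"
      by blast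
    hence "((\<lambda>v. (cmod (deriv f (?T v)))\<^sup>2 * indicator ?B v) has_integral (measure lebesgue (?g ` ?B))) UNIV"
      by (simp only: ri)
    hence "(\<integral>\<^sup>+v. ennreal ((cmod (deriv f (?T v)))\<^sup>2 * indicator ?B v) \<partial>lborel) = ennreal (measure lebesgue (?g ` ?B))"
      using dm' by (intro nn_integral_has_integral_lborel) auto
    also have "\<dots> = emeasure lborel (?g ` ?B)"
      using True imgb by (simp add: emeasure_eq_ennreal_measure less_top)
    finally show ?thesis
      unfolding nn img using em[OF fA] by simp
  next
    case False
    have "(\<integral>\<^sup>+v. ennreal ((cmod (deriv f (?T v)))\<^sup>2 * indicator ?B v) \<partial>lborel) = \<infinity>"
    proof (rule ccontr)
      assume "\<not> ?thesis"
      hence "integrable lborel (\<lambda>v. (cmod (deriv f (?T v)))\<^sup>2 * indicator ?B v)"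
        using dm' by (intro integrableI_nonneg) (auto simp: less_top)
      hence "((\<lambda>v. (cmod (deriv f (?T v)))\<^sup>2 * indicator ?B v) has_integral
           (LINT v|lborel. (cmod (deriv f (?T v)))\<^sup>2 * indicator ?B v)) UNIV"
        by (rule has_integral_integral_lborel)
      hence "((\<lambda>v. (cmod (deriv f (?T v)))\<^sup>2) has_integral
           (LINT v|lborel. (cmod (deriv f (?T v)))\<^sup>2 * indicator ?B v)) ?B"
        by (simp only: ri)
      with iff have "?g ` ?B \<in> lmeasurable" by blast
      with False imgb show False by (auto simp: fmeasurable_def)
    qed
    thus ?thesis
      unfolding nn using False em[OF fA] img by (simp add: less_top[symmetric])
  qed
qed

lemma borel_measurable_if_holomorphic:
  assumes "f holomorphic_on S" "open S"
  shows "(\<lambda>z. if z \<in> S then f z else 0) \<in> borel_measurable borel"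
  using borel_measurable_continuous_on_if[OF _ holomorphic_on_imp_continuous_on[OF assms(1)] continuous_on_const] assms(2)
  by simp

text \<open>The area formula for all Borel sets at once, as an equality of measures, so that
  integrals transform by the general rules for \<open>distr\<close> and \<open>density\<close>.
  Setting the map to 0 off \<open>S\<close> makes it Borel on the whole plane; the density vanishes
  there, so the value is immaterial.\<close>

lemma distr_density_holomorphic:
  assumes hol: "f holomorphic_on S" and "open S" and inj: "inj_on f S"
  shows "density lborel (indicator (f ` S)) =
    distr (density lborel (\<lambda>z. ennreal ((cmod (deriv f z))\<^sup>2) * indicator S z)) borel
      (\<lambda>z. if z \<in> S then f z else 0)" (is "?L = distr ?D borel ?f")
proof (rule measure_eqI)
  show "sets ?L = sets (distr ?D borel ?f)" by simp
  fix B assume "B \<in> sets ?L"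
  hence B: "B \<in> sets borel" by simp
  have fm: "?f \<in> borel_measurable borel"
    by (rule borel_measurable_if_holomorphic[OF hol \<open>open S\<close>])
  have dm: "(\<lambda>z. ennreal ((cmod (deriv f z))\<^sup>2) * indicator S z) \<in> borel_measurable borel"
  proof -
    have "(\<lambda>z. if z \<in> S then deriv f z else 0) \<in> borel_measurable borel"
      using hol \<open>open S\<close> by (intro borel_measurable_if_holomorphic holomorphic_deriv) auto
    hence "(\<lambda>z. ennreal ((cmod (if z \<in> S then deriv f z else 0))\<^sup>2)) \<in> borel_measurable borel"
      by measurable
    also have "(\<lambda>z. ennreal ((cmod (if z \<in> S then deriv f z else 0))\<^sup>2)) =
       (\<lambda>z. ennreal ((cmod (deriv f z))\<^sup>2) * indicator S z)"
      by (auto simp: fun_eq_iff indicator_def)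
    finally show ?thesis .
  qed
  let ?A = "S \<inter> ?f -` B"
  have A: "?A \<in> sets borel" "?A \<subseteq> S"
    using measurable_sets_borel[OF fm B] \<open>open S\<close> by auto
  have img: "f ` ?A = f ` S \<inter> B" by auto
  have S: "open (f ` S)" by (rule open_mapping_thm3[OF hol \<open>open S\<close> inj])
  have "emeasure ?L B = emeasure lborel (f ` ?A)"
    unfolding img using B S
    by (subst emeasure_density) (auto simp: mult.commute Int_commute simp flip: indicator_inter_arith)
  also have "\<dots> = (\<integral>\<^sup>+z\<in>?A. ennreal ((cmod (deriv f z))\<^sup>2) \<partial>lborel)"
    by (rule emeasure_holomorphic_image[OF hol \<open>open S\<close> inj A])
  also have "\<dots> = emeasure ?D (?f -` B)"
    using dm measurable_sets_borel[OF fm B]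
    by (subst emeasure_density) (auto intro!: nn_integral_cong simp: indicator_def)
  also have "\<dots> = emeasure (distr ?D borel ?f) B"
    using fm B by (simp add: emeasure_distr)
  finally show "emeasure ?L B = emeasure (distr ?D borel ?f) B" .
qed

lemma
  fixes h :: "complex \<Rightarrow> 'a :: {banach, second_countable_topology}"
  assumes hol: "f holomorphic_on S" and "open S" and inj: "inj_on f S"
    and h: "(\<lambda>z. indicator (f ` S) z *\<^sub>R h z) \<in> borel_measurable borel"
  shows set_integrable_holomorphic_image_iff:
      "set_integrable lborel (f ` S) h \<longleftrightarrow>
       set_integrable lborel S (\<lambda>z. (cmod (deriv f z))\<^sup>2 *\<^sub>R h (f z))"
    and set_integral_holomorphic_image:
      "(LINT w:f ` S|lborel. h w) = (LINT z:S|lborel. (cmod (deriv f z))\<^sup>2 *\<^sub>R h (f z))"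
proof -
  let ?f = "\<lambda>z. if z \<in> S then f z else 0"
  let ?d = "\<lambda>z. (cmod (if z \<in> S then deriv f z else 0))\<^sup>2"
  let ?h = "\<lambda>z. indicator (f ` S) z *\<^sub>R h z"
  have S: "f ` S \<in> sets borel"
    by (rule borel_open[OF open_mapping_thm3[OF hol \<open>open S\<close> inj]])
  have fm: "?f \<in> borel_measurable borel"
    by (rule borel_measurable_if_holomorphic[OF hol \<open>open S\<close>])
  have "(\<lambda>z. if z \<in> S then deriv f z else 0) \<in> borel_measurable borel"
    using hol \<open>open S\<close> by (intro borel_measurable_if_holomorphic holomorphic_deriv) auto
  hence dm: "?d \<in> borel_measurable borel" by measurable
  have eqD: "(\<lambda>z. ennreal ((cmod (deriv f z))\<^sup>2) * indicator S z) = (\<lambda>z. ennreal (?d z))"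
    by (auto simp: fun_eq_iff indicator_def)
  have indr: "(indicator (f ` S) :: complex \<Rightarrow> ennreal) = (\<lambda>z. ennreal (indicator (f ` S) z))"
    by (auto simp: fun_eq_iff indicator_def)
  note D = distr_density_holomorphic[OF hol \<open>open S\<close> inj, unfolded eqD]
  have hf: "(\<lambda>z. ?h (?f z)) \<in> borel_measurable borel"
    by (rule measurable_compose[OF fm h])
  have pt: "?d z *\<^sub>R ?h (?f z) = indicator S z *\<^sub>R ((cmod (deriv f z))\<^sup>2 *\<^sub>R h (f z))" for z
    by (auto simp: indicator_def)
  have pt': "indicator (f ` S) w *\<^sub>R ?h w = ?h w" and
    ind: "indicator (f ` S) w * indicator (f ` S) w = (indicator (f ` S) w :: real)" for w
    by (auto simp: indicator_def)
  have "set_integrable lborel (f ` S) h \<longleftrightarrow> integrable (density lborel (\<lambda>z. ennreal (indicator (f ` S) z))) ?h"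
    using h S by (subst integrable_density) (auto simp: set_integrable_def ind simp del: indicator_scaleR_eq_if)
  also have "\<dots> \<longleftrightarrow> integrable lborel (\<lambda>z. ?d z *\<^sub>R ?h (?f z))"
    unfolding D[unfolded indr] using h fm dm hf
    by (subst integrable_distr_eq) (auto simp: integrable_density simp del: indicator_scaleR_eq_if)
  finally show "set_integrable lborel (f ` S) h \<longleftrightarrow>
       set_integrable lborel S (\<lambda>z. (cmod (deriv f z))\<^sup>2 *\<^sub>R h (f z))"
    unfolding pt set_integrable_def .
  have "(LINT w:f ` S|lborel. h w) = integral\<^sup>L (density lborel (\<lambda>z. ennreal (indicator (f ` S) z))) ?h"
    using h S by (subst integral_density) (auto simp: set_lebesgue_integral_def ind simp del: indicator_scaleR_eq_if)
  also have "\<dots> = integral\<^sup>L lborel (\<lambda>z. ?d z *\<^sub>R ?h (?f z))"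
    unfolding D[unfolded indr] using h fm dm hf
    by (subst integral_distr) (auto simp: integral_density simp del: indicator_scaleR_eq_if)
  finally show "(LINT w:f ` S|lborel. h w) = (LINT z:S|lborel. (cmod (deriv f z))\<^sup>2 *\<^sub>R h (f z))"
    unfolding pt set_lebesgue_integral_def .
qed

subsection \<open>Area mean values of holomorphic functions\<close>

lemma integral_rotate:
  fixes h :: "complex \<Rightarrow> complex"
  assumes h: "h \<in> borel_measurable borel" and c: "cmod c = 1"
  shows "(LINT z|lborel. h (a + c * (z - a))) = (LINT z|lborel. h z)"
proof -
  let ?f = "\<lambda>z. a + c * (z - a)"
  have c0: "c \<noteq> 0" using c by auto
  have inj: "inj_on ?f UNIV" using c0 by (auto simp: inj_on_def)
  have "w = ?f (a + (w - a) / c)" for w using c0 by simp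
  hence surj: "range ?f = UNIV" by (metis UNIV_eq_I rangeI)
  have d: "deriv ?f z = c" for z
    by (rule DERIV_imp_deriv) (auto intro!: derivative_eq_intros)
  have "(LINT w:range ?f|lborel. h w) = (LINT z:UNIV|lborel. (cmod (deriv ?f z))\<^sup>2 *\<^sub>R h (?f z))"
    by (rule set_integral_holomorphic_image) (use inj h in \<open>auto simp: surj intro!: holomorphic_intros\<close>)
  thus ?thesis by (simp add: surj d c set_lebesgue_integral_def)
qed

lemma integrable_bounded_support:
  fixes h :: "complex \<Rightarrow> complex"
  assumes "h \<in> borel_measurable borel" "\<And>z. cmod (h z) \<le> C" "\<And>z. z \<notin> ball a s \<Longrightarrow> h z = 0"
  shows "integrable lborel h"
proof (rule integrableI_bounded_set[of "ball a s" _ _ C])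
  show "emeasure lborel (ball a s) < \<infinity>" by (rule emeasure_lborel_ball_finite)
qed (use assms in \<open>auto simp: dist_commute\<close>)

text \<open>The rotation about \<open>a\<close> by the angle \<open>pi / k\<close> preserves area
  and \<open>dist a z\<close> but changes the sign of \<open>(z - a) ^ k\<close>, so the integral
  equals its own negative. Integrability is not at issue, since a non-integrable function has
  integral 0 by convention.\<close>

lemma radial_monomial_integral:
  fixes \<rho> :: "real \<Rightarrow> complex"
  assumes [measurable]: "\<rho> \<in> borel_measurable borel" and k: "k > 0"
  shows "(LINT z|lborel. (z - a) ^ k * \<rho> (dist a z)) = 0"
proof -
  define c where "c = cis (pi / real k)"
  have ck: "c ^ k = -1" using k by (simp add: c_def Complex.DeMoivre)
  have c1: "cmod c = 1" by (simp add: c_def)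
  let ?h = "\<lambda>z. (z - a) ^ k * \<rho> (dist a z)"
  have "?h \<in> borel_measurable borel" by measurable
  from integral_rotate[OF this c1, of a] have "(LINT z|lborel. ?h z) = (LINT z|lborel. ?h (a + c * (z - a)))"
    by simp
  also have "\<dots> = (LINT z|lborel. - ?h z)"
    by (intro arg_cong[of _ _ "integral\<^sup>L lborel"] ext)
      (simp add: power_mult_distrib ck dist_norm norm_mult c1 norm_minus_commute)
  also have "\<dots> = - (LINT z|lborel. ?h z)" by simp
  finally show ?thesis by (simp add: eq_neg_iff_add_eq_0)
qed

text \<open>In the power series of \<open>g\<close> at \<open>a\<close> every term but the constant
  one integrates to 0 against a radial weight. The weight vanishes beyond \<open>s < R\<close>,
  where the series converges absolutely and uniformly, so sum and integral may be exchanged.\<close>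

lemma radial_mean_value:
  fixes g :: "complex \<Rightarrow> complex" and \<rho> :: "real \<Rightarrow> complex"
  assumes g: "g holomorphic_on ball a R" and s: "0 < s" "s < R"
    and [measurable]: "\<rho> \<in> borel_measurable borel" and B: "\<And>t. cmod (\<rho> t) \<le> B"
    and supp: "\<And>t. t \<ge> s \<Longrightarrow> \<rho> t = 0"
  shows "(LINT z|lborel. g z * \<rho> (dist a z)) = g a * (LINT z|lborel. \<rho> (dist a z))"
proof -
  define c where "c n = (deriv ^^ n) g a / fact n" for n
  have sums: "(\<lambda>n. c n * (z - a) ^ n) sums g z" if "z \<in> ball a R" for z
    using holomorphic_power_series[OF g that] by (simp add: c_def)
  let ?f = "\<lambda>n z. c n * (z - a) ^ n * \<rho> (dist a z)"
  have summ: "summable (\<lambda>n. cmod (c n) * s ^ n)"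
  proof -
    \<comment> \<open>Convergence at a radius strictly beyond \<open>s\<close> turns into absolute
      convergence at \<open>s\<close>.\<close>
    obtain s' where s': "s < s'" "s' < R" using s dense by blast
    have "summable (\<lambda>n. c n * (of_real s') ^ n)"
      using sums[of "a + of_real s'"] s s' by (auto simp: dist_norm sums_iff)
    from powser_insidea[OF this, of "of_real s"] show ?thesis
      using s s' by (simp add: norm_mult norm_power)
  qed
  have B0: "B \<ge> 0" using B[of 0] norm_ge_zero order_trans by blast
  have bd: "cmod (?f n z) \<le> cmod (c n) * s ^ n * B * indicator (ball a s) z" for n z
  proof (cases "dist a z < s")
    case True
    have "cmod (?f n z) = cmod (c n) * dist a z ^ n * cmod (\<rho> (dist a z))"
      by (simp add: norm_mult norm_power dist_norm norm_minus_commute)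
    also have "\<dots> \<le> cmod (c n) * s ^ n * B"
      using True B[of "dist a z"] s by (intro mult_mono power_mono) auto
    finally show ?thesis using True by simp
  qed (use supp in simp)
  have int: "integrable lborel (?f n)" for n
  proof (rule integrable_bounded_support)
    show "cmod (?f n z) \<le> cmod (c n) * s ^ n * B" for z
      using bd[of n z] s B0 by (auto simp: indicator_def split: if_splits intro: order_trans)
    show "?f n z = 0" if "z \<notin> ball a s" for z
      using that supp[of "dist a z"] by auto
  qed measurable
  have ind: "integrable lborel (indicat_real (ball a s))"
    using emeasure_lborel_ball_finite[of a s] by simp
  have "(LINT z|lborel. (\<Sum>n. ?f n z)) = (\<Sum>n. LINT z|lborel. ?f n z)"
  proof (rule integral_suminf[OF int])
    show "AE z in lborel. summable (\<lambda>n. cmod (?f n z))"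
      by (intro AE_I2 summable_comparison_test'[OF summable_mult2[OF summable_mult2[OF summ]]]) (use bd in auto)
    show "summable (\<lambda>n. LINT z|lborel. cmod (?f n z))"
    proof (rule summable_comparison_test'[OF summable_mult2[OF summable_mult2[OF summ]]])
      fix n
      have "(LINT z|lborel. cmod (?f n z)) \<le> (LINT z|lborel. cmod (c n) * s ^ n * B * indicator (ball a s) z)"
        using int ind bd by (intro integral_mono) auto
      also have "\<dots> = cmod (c n) * s ^ n * B * measure lborel (ball a s)"
        by simp
      finally show "norm (LINT z|lborel. cmod (?f n z)) \<le> cmod (c n) * s ^ n * B * measure lborel (ball a s)"
        by simp
    qed
  qed
  also have "(\<lambda>n. LINT z|lborel. ?f n z) = (\<lambda>n. if n = 0 then g a * (LINT z|lborel. \<rho> (dist a z)) else 0)"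
  proof
    fix n
    have "(LINT z|lborel. ?f n z) = c n * (LINT z|lborel. (z - a) ^ n * \<rho> (dist a z))"
      by (simp add: mult.assoc)
    thus "(LINT z|lborel. ?f n z) = (if n = 0 then g a * (LINT z|lborel. \<rho> (dist a z)) else 0)"
      by (auto simp: radial_monomial_integral) (simp add: c_def)
  qed
  also have "suminf \<dots> = g a * (LINT z|lborel. \<rho> (dist a z))"
    by (subst suminf_finite[of "{0}"]) auto
  also have "(\<lambda>z. \<Sum>n. ?f n z) = (\<lambda>z. g z * \<rho> (dist a z))"
  proof
    fix z
    show "(\<Sum>n. ?f n z) = g z * \<rho> (dist a z)"
    proof (cases "dist a z < s")
      case True
      hence "(\<lambda>n. ?f n z) sums (g z * \<rho> (dist a z))"
        using s by (intro sums_mult2 sums) auto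
      thus ?thesis by (simp add: sums_iff)
    qed (use supp in simp)
  qed
  finally show ?thesis .
qed

lemma measure_ball_complex: "r \<ge> 0 \<Longrightarrow> measure lborel (ball (a::complex) r) = pi * r\<^sup>2"
  using content_ball[of r a] by (simp add: unit_ball_vol_2)

lemma ball_mean_value:
  fixes g :: "complex \<Rightarrow> complex"
  assumes g: "g holomorphic_on ball a R" and r: "0 < r" "r < R"
  shows "(LINT z|lborel. g z * indicator (ball a r) z) = pi * r\<^sup>2 * g a"
proof -
  have "(LINT z|lborel. g z * (if dist a z < r then 1 else 0)) = g a * (LINT z|lborel. (if dist a z < r then 1 else 0))"
    by (rule radial_mean_value[where R=R and s=r and B=1 and \<rho>="\<lambda>t. if t < r then 1 else 0"]) (use assms in auto)
  also have ind: "(\<lambda>z. if dist a z < r then 1 else (0::complex)) = indicator (ball a r)"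
    by (auto simp: indicator_def)
  also have "(LINT z|lborel. indicator (ball a r) z) = complex_of_real (LINT z|lborel. indicator (ball a r) z)"
    by (subst integral_complex_of_real[symmetric], rule arg_cong[of _ _ "integral\<^sup>L lborel"])
      (auto simp: fun_eq_iff indicator_def)
  finally show ?thesis using r emeasure_lborel_ball_finite[of a r]
    by (simp add: measure_ball_complex ind fun_cong[OF ind] mult.commute)
qed

text \<open>The mean value property is applied to the square of \<open>g\<close>, which is again
  holomorphic. The radius is halved because \<open>ball_mean_value\<close> requires holomorphy on a
  strictly larger disc. Integrating over the whole plane on the right suits a \<open>g\<close>
  extended by 0.\<close>

lemma cmod_le_L2_ball:
  fixes g :: "complex \<Rightarrow> complex"
  assumes g: "g holomorphic_on ball a r" and r: "0 < r"
    and int: "integrable lborel (\<lambda>z. (cmod (g z))\<^sup>2)"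
  shows "(cmod (g a))\<^sup>2 * (pi * (r / 2)\<^sup>2) \<le> (LINT z|lborel. (cmod (g z))\<^sup>2)"
proof -
  have "(\<lambda>z. (g z)\<^sup>2) holomorphic_on ball a r" using g by (intro holomorphic_intros)
  from ball_mean_value[OF this, of "r/2"]
  have eq: "(LINT z|lborel. (g z)\<^sup>2 * indicator (ball a (r/2)) z) = pi * (r/2)\<^sup>2 * (g a)\<^sup>2"
    using r by simp
  have "(cmod (g a))\<^sup>2 * (pi * (r / 2)\<^sup>2) = cmod (LINT z|lborel. (g z)\<^sup>2 * indicator (ball a (r/2)) z)"
    unfolding eq using r by (simp add: norm_mult norm_power norm_divide)
  also have "\<dots> \<le> (LINT z|lborel. (cmod (g z))\<^sup>2)"
    by (intro order_trans[OF integral_norm_bound] integral_mono'[OF int])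
      (auto simp: indicator_def norm_mult norm_power)
  finally show ?thesis .
qed

subsection \<open>Cauchy transforms of antiholomorphic densities\<close>

text \<open>The cutoff kernel is \<open>1 / w\<close> for \<open>|w| \<ge> r\<close> and \<open>cnj w / r\<^sup>2\<close> inside, hence Lipschitz. On a disc where \<open>g\<close> is
  holomorphic the choice of a radial cutoff does not matter, by the mean value property, so for small \<open>r\<close>
  the cutoff transform is the Cauchy transform of \<open>cnj g\<close>, and no singular integral is needed.\<close>

definition cutoff_kernel :: "real \<Rightarrow> complex \<Rightarrow> complex" where
  "cutoff_kernel r w = cnj w / of_real ((max r (cmod w))\<^sup>2)"

definition cutoff_transform :: "(complex \<Rightarrow> complex) \<Rightarrow> real \<Rightarrow> complex \<Rightarrow> complex" where
  "cutoff_transform g r \<zeta> = (LINT z|lborel. cnj (g z) * cutoff_kernel r (z - \<zeta>))"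

lemma cutoff_kernel_outside: "r > 0 \<Longrightarrow> r \<le> cmod w \<Longrightarrow> cutoff_kernel r w = 1 / w"
  using complex_div_cnj[of 1 w] by (simp add: cutoff_kernel_def max_def) 

lemma cutoff_kernel_inside: "cmod w \<le> r \<Longrightarrow> cutoff_kernel r w = cnj w / of_real (r\<^sup>2)"
  by (simp add: cutoff_kernel_def max_def)

lemma cutoff_kernel_measurable [measurable]: "cutoff_kernel r \<in> borel_measurable borel"
proof -
  have "cnj \<in> borel_measurable borel" by (intro borel_measurable_continuous_onI continuous_intros)
  thus ?thesis unfolding cutoff_kernel_def[abs_def] by measurable
qed

lemma cmod_cutoff_kernel_le: "r > 0 \<Longrightarrow> cmod (cutoff_kernel r w) \<le> 1 / r"
proof -
  assume r: "r > 0"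
  have "cmod (cutoff_kernel r w) = cmod w / (max r (cmod w))\<^sup>2"
    using r by (simp add: cutoff_kernel_def norm_divide norm_power)
  also have "\<dots> \<le> max r (cmod w) / (max r (cmod w))\<^sup>2"
    by (intro divide_right_mono) auto
  also have "\<dots> = 1 / max r (cmod w)" using r by (simp add: power2_eq_square)
  also have "\<dots> \<le> 1 / r" using r by (intro divide_left_mono) auto
  finally show ?thesis .
qed

text \<open>Changing the numerator costs a factor 1 and changing the denominator a factor 2, hence
  the 3. By symmetry \<open>w\<close> may be taken as the point of smaller modulus.\<close>

lemma cutoff_kernel_Lipschitz:
  assumes r: "r > 0"
  shows "cmod (cutoff_kernel r w - cutoff_kernel r w') \<le> 3 * cmod (w - w') / r\<^sup>2"
proof -
  have *: "cmod (cutoff_kernel r w - cutoff_kernel r w') \<le> 3 * cmod (w - w') / r\<^sup>2" if le: "cmod w \<le> cmod w'" for w w'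
  proof -
    define m m' where "m = max r (cmod w)" and "m' = max r (cmod w')"
    have m: "0 < r" "r \<le> m" "m \<le> m'" "cmod w \<le> m" "m' - m \<le> cmod (w - w')"
      using r le norm_triangle_ineq2[of w' w] by (auto simp: m_def m'_def norm_minus_commute)
    have mp: "m > 0" "m' > 0" using m by auto
    \<comment> \<open>The change of numerator is paired with the larger denominator, and the change
      of denominator with the smaller numerator \<open>w\<close>, so that
      \<open>cmod w \<le> m\<close> can absorb one factor.\<close>
    have eq: "cutoff_kernel r w - cutoff_kernel r w' = cnj (w - w') / of_real (m'\<^sup>2) + cnj w * of_real (1 / m\<^sup>2 - 1 / m'\<^sup>2)"
      unfolding cutoff_kernel_def m_def[symmetric] m'_def[symmetric]
      by (simp add: diff_divide_distrib ring_distribs)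
    have "1 / m\<^sup>2 - 1 / m'\<^sup>2 \<ge> 0" using m mp by (simp add: divide_left_mono power_mono)
    hence "cmod (cutoff_kernel r w - cutoff_kernel r w') \<le> cmod (w - w') / m'\<^sup>2 + cmod w * (1 / m\<^sup>2 - 1 / m'\<^sup>2)"
      unfolding eq by (intro order_trans[OF norm_triangle_ineq])
        (simp add: norm_divide norm_mult norm_power del: of_real_diff of_real_divide flip: complex_cnj_diff)
    also have "cmod w * (1 / m\<^sup>2 - 1 / m'\<^sup>2) \<le> m * (1 / m\<^sup>2 - 1 / m'\<^sup>2)"
      using m \<open>1 / m\<^sup>2 - 1 / m'\<^sup>2 \<ge> 0\<close> by (intro mult_right_mono)
    also have "\<dots> = (m' - m) * (m + m') / (m * m'\<^sup>2)"
      using mp by (simp add: field_simps power2_eq_square)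
    also have "\<dots> \<le> (m' - m) * (2 * m') / (m * m'\<^sup>2)"
      using m mp by (intro divide_right_mono mult_left_mono) auto
    also have "\<dots> = 2 * (m' - m) / (m * m')"
      using mp by (simp add: field_simps power2_eq_square)
    also have "\<dots> \<le> 2 * cmod (w - w') / (r * r)"
      using m r by (intro frac_le mult_mono) auto
    also have "cmod (w - w') / m'\<^sup>2 \<le> cmod (w - w') / r\<^sup>2"
      using m r by (intro divide_left_mono power_mono) auto
    finally show ?thesis by (simp add: power2_eq_square)
  qed
  show ?thesis
    using *[of w w'] *[of w' w] by (cases "cmod w \<le> cmod w'") (auto simp: norm_minus_commute)
qed

lemma integrable_mult_bounded:
  fixes f h :: "complex \<Rightarrow> complex"
  assumes "integrable lborel f" "h \<in> borel_measurable borel" "\<And>z. cmod (h z) \<le> C"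
  shows "integrable lborel (\<lambda>z. f z * h z)"
proof (rule Bochner_Integration.integrable_bound)
  show "integrable lborel (\<lambda>z. C * cmod (f z))" using assms(1) by simp
  show "AE z in lborel. cmod (f z * h z) \<le> norm (C * cmod (f z))"
  proof (rule AE_I2)
    fix z
    have "cmod (f z * h z) \<le> cmod (f z) * C"
      using assms(3)[of z] by (simp add: norm_mult mult_left_mono)
    also have "\<dots> \<le> norm (C * cmod (f z))" by (simp add: mult.commute)
    finally show "cmod (f z * h z) \<le> norm (C * cmod (f z))" .
  qed
qed (use assms(1,2) in measurable)

lemma integrable_cutoff_transform:
  assumes "integrable lborel g" "r > 0"
  shows "integrable lborel (\<lambda>z. cnj (g z) * cutoff_kernel r (z - \<zeta>))"
  using cmod_cutoff_kernel_le[OF assms(2)] assms(1)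
  by (intro integrable_mult_bounded[where C="1/r"] integrable_cnj) auto

text \<open>The two kernels differ by \<open>cnj (z - \<zeta>)\<close> times a radial function
  vanishing beyond \<open>max r s\<close>. Up to conjugation the integral is a radial mean of
  \<open>g z * (z - \<zeta>)\<close>, a holomorphic function that vanishes at the centre.\<close>

lemma cutoff_transform_independent_radius:
  assumes hol: "g holomorphic_on ball \<zeta> R" and int: "integrable lborel g"
    and r: "0 < r" "r < R" and s: "0 < s" "s < R"
  shows "cutoff_transform g r \<zeta> = cutoff_transform g s \<zeta>"
proof -
  define \<rho> where "\<rho> t = complex_of_real (if t \<le> 0 then 0 else 1 / (max r t)\<^sup>2 - 1 / (max s t)\<^sup>2)" for t
  let ?m = "max r s"
  have m: "0 < ?m" "?m < R" using r s by auto
  have [measurable]: "\<rho> \<in> borel_measurable borel" unfolding \<rho>_def[abs_def] by measurable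
  have B: "cmod (\<rho> t) \<le> 1 / r\<^sup>2 + 1 / s\<^sup>2" for t
  proof -
    have "0 \<le> 1 / (max r t)\<^sup>2" "1 / (max r t)\<^sup>2 \<le> 1 / r\<^sup>2" "0 \<le> 1 / (max s t)\<^sup>2" "1 / (max s t)\<^sup>2 \<le> 1 / s\<^sup>2"
      using r s by (auto intro!: divide_left_mono power_mono mult_pos_pos simp: less_max_iff_disj)
    hence "\<bar>1 / (max r t)\<^sup>2 - 1 / (max s t)\<^sup>2\<bar> \<le> 1 / r\<^sup>2 + 1 / s\<^sup>2"
      by linarith
    thus ?thesis unfolding \<rho>_def norm_of_real by (cases "t \<le> 0") (simp_all del: abs_le_iff)
  qed
  have supp: "\<rho> t = 0" if "t \<ge> ?m" for t
    using that by (simp add: \<rho>_def max_absorb2)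
  have eq: "cnj (g z) * cutoff_kernel r (z - \<zeta>) - cnj (g z) * cutoff_kernel s (z - \<zeta>) = cnj (g z * (z - \<zeta>) * \<rho> (dist \<zeta> z))" for z
    by (cases "z = \<zeta>") (auto simp: cutoff_kernel_def \<rho>_def dist_norm norm_minus_commute algebra_simps diff_divide_distrib)
  have "cutoff_transform g r \<zeta> - cutoff_transform g s \<zeta> = (LINT z|lborel. cnj (g z * (z - \<zeta>) * \<rho> (dist \<zeta> z)))"
    unfolding cutoff_transform_def using integrable_cutoff_transform[OF int] r s
    by (subst Bochner_Integration.integral_diff[symmetric]) (simp_all only: eq)
  also have "\<dots> = cnj (LINT z|lborel. g z * (z - \<zeta>) * \<rho> (dist \<zeta> z))"
    by (rule Bochner_Integration.integral_cnj)
  also have "(LINT z|lborel. g z * (z - \<zeta>) * \<rho> (dist \<zeta> z)) = g \<zeta> * (\<zeta> - \<zeta>) * (LINT z|lborel. \<rho> (dist \<zeta> z))"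
    by (rule radial_mean_value[where R=R and s="?m" and B="1 / r\<^sup>2 + 1 / s\<^sup>2"])
      (use m B supp in \<open>auto intro!: holomorphic_intros hol\<close>)
  finally show ?thesis by simp
qed

text \<open>Moving \<open>\<zeta>\<close> by \<open>h\<close> changes the kernel to first order by
  \<open>h / (z - \<zeta>)^2\<close> outside the disc, which is complex linear in \<open>h\<close>,
  and by \<open>- cnj h / r^2\<close> inside it. By the mean value property the inner part
  integrates to \<open>- pi * cnj (g \<zeta>) * cnj h\<close>, and this is exactly what
  \<open>pi * cnj \<phi>\<close> cancels. The remainder passes to the limit by dominated
  convergence; pointwise it is controlled off the circle \<open>|z - \<zeta>| = r\<close>, which is
  a null set.\<close>

lemma cutoff_transform_plus_primitive_differentiable:
  assumes hol: "g holomorphic_on ball \<zeta> R" and int: "integrable lborel g"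
    and r: "0 < r" "r < R"
    and \<phi>: "(\<phi> has_field_derivative g \<zeta>) (at \<zeta>)"
  shows "(\<lambda>u. cutoff_transform g r u + pi * cnj (\<phi> u)) field_differentiable at \<zeta>"
proof -
  let ?D = "\<lambda>w. if cmod w > r then 1 / w\<^sup>2 else 0"
  have "(\<lambda>w::complex. 1 / w\<^sup>2) \<in> borel_measurable borel" by measurable
  hence Dm: "?D \<in> borel_measurable borel" by measurable
  have Db: "cmod (?D w) \<le> 1 / r\<^sup>2" for w
    using r by (auto simp: norm_divide norm_power intro!: divide_left_mono power_mono mult_pos_pos)
  define A where "A = (LINT z|lborel. cnj (g z) * ?D (z - \<zeta>))"
  let ?I = "\<lambda>z. indicator (ball \<zeta> r) z :: complex"
  have Am: "integrable lborel (\<lambda>z. cnj (g z) * ?D (z - \<zeta>))"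
    using Db Dm int by (intro integrable_mult_bounded[where C="1/r^2"] integrable_cnj) (auto)
  have Im: "integrable lborel (\<lambda>z. cnj (g z) * ?I z)"
    using int by (intro integrable_mult_bounded[where C=1] integrable_cnj) (auto simp: indicator_def)
  have I: "(LINT z|lborel. cnj (g z) * ?I z) = pi * r\<^sup>2 * cnj (g \<zeta>)"
  proof -
    have "(\<lambda>z. cnj (g z) * ?I z) = (\<lambda>z. cnj (g z * ?I z))"
      by (auto simp: indicator_def)
    hence "(LINT z|lborel. cnj (g z) * ?I z) = (LINT z|lborel. cnj (g z * ?I z))"
      by (simp only:)
    also have "\<dots> = cnj (LINT z|lborel. g z * ?I z)"
      by (rule Bochner_Integration.integral_cnj)
    also have "\<dots> = cnj (pi * r\<^sup>2 * g \<zeta>)"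
      by (subst ball_mean_value[OF hol r]) simp
    finally show ?thesis by simp
  qed
  \<comment> \<open>\<open>E\<close> is the remainder after the first-order terms. The bound
    \<open>5 / r^2\<close> below adds 3 from the Lipschitz estimate and 1 from each of the two
    linear terms.\<close>
  define E where "E h z = cutoff_kernel r (z - (\<zeta> + h)) - cutoff_kernel r (z - \<zeta>) - (?D (z - \<zeta>) * h - ?I z * cnj h / r\<^sup>2)" for h z
  have Ebound: "cmod (E h z) \<le> 5 / r\<^sup>2 * cmod h" for h z
  proof -
    have "cmod (E h z) \<le> cmod (cutoff_kernel r (z - (\<zeta> + h)) - cutoff_kernel r (z - \<zeta>)) + (cmod (?D (z - \<zeta>) * h) + cmod (?I z * cnj h / r\<^sup>2))"
      unfolding E_def by (rule order_trans[OF norm_triangle_ineq4 add_left_mono[OF norm_triangle_ineq4]])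
    also have "\<dots> \<le> 3 * cmod h / r\<^sup>2 + (1 / r\<^sup>2 * cmod h + cmod h / r\<^sup>2)"
    proof (intro add_mono)
      show "cmod (cutoff_kernel r (z - (\<zeta> + h)) - cutoff_kernel r (z - \<zeta>)) \<le> 3 * cmod h / r\<^sup>2"
        using cutoff_kernel_Lipschitz[OF r(1), of "z - (\<zeta> + h)" "z - \<zeta>"] by simp
      show "cmod (?D (z - \<zeta>) * h) \<le> 1 / r\<^sup>2 * cmod h"
        unfolding norm_mult by (intro mult_right_mono Db) auto
      show "cmod (?I z * cnj h / r\<^sup>2) \<le> cmod h / r\<^sup>2"
        using r by (auto simp: indicator_def norm_divide norm_power)
    qed
    finally show ?thesis by (simp add: field_simps)
  qed
  have Elim: "((\<lambda>h. cmod (E h z) / cmod h) \<longlongrightarrow> 0) (at 0)" if z: "cmod (z - \<zeta>) \<noteq> r" for z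
  proof (cases "cmod (z - \<zeta>) < r")
    case True
    hence "\<forall>\<^sub>F h in at 0. h \<in> ball 0 (r - cmod (z - \<zeta>))"
      by (intro eventually_at_in_open') auto
    hence "\<forall>\<^sub>F h in at 0. cmod (E h z) / cmod h = 0"
    proof eventually_elim
      case (elim h)
      have "cmod (z - (\<zeta> + h)) < r"
        using elim norm_triangle_ineq4[of "z - \<zeta>" h] by (simp add: algebra_simps)
      hence "E h z = 0" using True
        by (simp add: E_def cutoff_kernel_inside dist_norm norm_minus_commute diff_divide_distrib add_divide_distrib)
      thus ?case by simp
    qed
    thus ?thesis by (rule tendsto_eventually)
  next
    case False
    with z have gt: "cmod (z - \<zeta>) > r" by simp
    hence z0: "z - \<zeta> \<noteq> 0" using r by auto
    have "((\<lambda>h. 1 / (z - (\<zeta> + h))) has_field_derivative 1 / (z - \<zeta>)\<^sup>2) (at 0)"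
      using z0 by (auto intro!: derivative_eq_intros simp: power2_eq_square)
    hence lim: "((\<lambda>h. (1 / (z - (\<zeta> + h)) - 1 / (z - \<zeta>)) / h - 1 / (z - \<zeta>)\<^sup>2) \<longlongrightarrow> 0) (at 0)"
      by (subst (asm) has_field_derivative_iff) (auto intro: tendsto_eq_intros)
    have "\<forall>\<^sub>F h in at 0. h \<in> ball 0 (cmod (z - \<zeta>) - r)"
      using gt by (intro eventually_at_in_open') auto
    moreover have "\<forall>\<^sub>F h in at (0::complex). h \<noteq> 0" by (simp add: eventually_at_filter)
    ultimately have "\<forall>\<^sub>F h in at 0. cmod ((1 / (z - (\<zeta> + h)) - 1 / (z - \<zeta>)) / h - 1 / (z - \<zeta>)\<^sup>2) = cmod (E h z) / cmod h"
    proof eventually_elim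
      case (elim h)
      have "cmod (z - (\<zeta> + h)) > r"
        using elim norm_triangle_ineq2[of "z - \<zeta>" h] by (simp add: algebra_simps)
      hence "E h z = 1 / (z - (\<zeta> + h)) - 1 / (z - \<zeta>) - 1 / (z - \<zeta>)\<^sup>2 * h" using gt r
        by (simp add: E_def cutoff_kernel_outside dist_norm norm_minus_commute)
      hence "E h z / h = (1 / (z - (\<zeta> + h)) - 1 / (z - \<zeta>)) / h - 1 / (z - \<zeta>)\<^sup>2"
        using elim by (simp add: diff_divide_distrib)
      thus ?case by (metis norm_divide)
    qed
    with tendsto_norm_zero[OF lim] show ?thesis by (rule Lim_transform_eventually)
  qed
  have Em: "E h \<in> borel_measurable borel" for h
  proof -
    have "(\<lambda>z. ?D (z - \<zeta>)) \<in> borel_measurable borel"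
      by (rule measurable_compose[OF _ Dm]) simp
    moreover have "?I \<in> borel_measurable borel" by (rule borel_measurable_indicator) simp
    moreover have "(\<lambda>z. cutoff_kernel r (z - (\<zeta> + h))) \<in> borel_measurable borel" "(\<lambda>z. cutoff_kernel r (z - \<zeta>)) \<in> borel_measurable borel"
      by measurable
    ultimately show ?thesis
      unfolding E_def[abs_def]
      by (intro borel_measurable_diff borel_measurable_times borel_measurable_divide borel_measurable_const)
  qed
  have intE: "integrable lborel (\<lambda>z. cnj (g z) * E h z)" for h
    using Ebound Em int by (intro integrable_mult_bounded[where C="5 / r\<^sup>2 * cmod h"] integrable_cnj) auto
  have cutoff_transform_eq: "cutoff_transform g r (\<zeta> + h) - cutoff_transform g r \<zeta> - (A * h - pi * cnj (g \<zeta>) * cnj h) = (LINT z|lborel. cnj (g z) * E h z)" for h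
  proof -
    have "(LINT z|lborel. cnj (g z) * E h z) = (LINT z|lborel. (cnj (g z) * cutoff_kernel r (z - (\<zeta> + h)) - cnj (g z) * cutoff_kernel r (z - \<zeta>))
        - (cnj (g z) * ?D (z - \<zeta>) * h - cnj (g z) * ?I z * (cnj h / r\<^sup>2)))"
      by (intro Bochner_Integration.integral_cong refl) (simp add: E_def algebra_simps)
    also have "\<dots> = (cutoff_transform g r (\<zeta> + h) - cutoff_transform g r \<zeta>) - (A * h - (pi * r\<^sup>2 * cnj (g \<zeta>)) * (cnj h / r\<^sup>2))"
      unfolding cutoff_transform_def A_def I[symmetric]
      by (subst Bochner_Integration.integral_diff;
          (intro Bochner_Integration.integrable_diff integrable_cutoff_transform integrable_mult_left Am Im int r)?)+ simp
    finally show ?thesis using r by simp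
  qed
  have lim: "((\<lambda>h. (LINT z|lborel. cnj (g z) * E h z) / h) \<longlongrightarrow> 0) (at 0)"
    unfolding tendsto_at_iff_sequentially o_def
  proof (intro allI impI)
    fix X :: "nat \<Rightarrow> complex"
    assume X: "\<forall>i. X i \<in> UNIV - {0}" "X \<longlonglongrightarrow> 0"
    have "(\<lambda>i. LINT z|lborel. cnj (g z) * E (X i) z / X i) \<longlonglongrightarrow> (LINT z|(lborel :: complex measure). 0)"
    proof (rule integral_dominated_convergence[where w="\<lambda>z. 5 / r\<^sup>2 * cmod (g z)"])
      show "AE z in lborel. (\<lambda>i. cnj (g z) * E (X i) z / X i) \<longlonglongrightarrow> 0"
      proof (rule AE_I')
        have "negligible (sphere \<zeta> r)" by (rule negligible_sphere)
        thus "sphere \<zeta> r \<in> null_sets lborel"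
          by (simp add: negligible_iff_null_sets null_sets_completion_iff)
        show "{z \<in> space lborel. \<not> (\<lambda>i. cnj (g z) * E (X i) z / X i) \<longlonglongrightarrow> 0} \<subseteq> sphere \<zeta> r"
        proof safe
          fix z assume z: "\<not> (\<lambda>i. cnj (g z) * E (X i) z / X i) \<longlonglongrightarrow> 0"
          show "z \<in> sphere \<zeta> r"
          proof (rule ccontr)
            assume "z \<notin> sphere \<zeta> r"
            hence "cmod (z - \<zeta>) \<noteq> r" by (auto simp: dist_norm norm_minus_commute)
            from Elim[OF this] have "(\<lambda>i. cmod (E (X i) z) / cmod (X i)) \<longlonglongrightarrow> 0"
              using X unfolding tendsto_at_iff_sequentially o_def by auto
            hence "(\<lambda>i. cmod (cnj (g z)) * (cmod (E (X i) z) / cmod (X i))) \<longlonglongrightarrow> 0"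
              by (rule tendsto_mult_right_zero)
            hence "(\<lambda>i. cmod (cnj (g z) * E (X i) z / X i)) \<longlonglongrightarrow> 0"
              by (simp add: norm_mult norm_divide)
            with z show False by (simp add: tendsto_norm_zero_iff)
          qed
        qed
      qed
      show "AE z in lborel. cmod (cnj (g z) * E (X i) z / X i) \<le> 5 / r\<^sup>2 * cmod (g z)" for i
      proof (rule AE_I2)
        fix z
        have "cmod (E (X i) z / X i) \<le> 5 / r\<^sup>2"
          using Ebound[of "X i" z] X(1) by (simp add: norm_divide field_simps)
        hence "cmod (g z) * cmod (E (X i) z / X i) \<le> cmod (g z) * (5 / r\<^sup>2)"
          by (intro mult_left_mono) auto
        thus "cmod (cnj (g z) * E (X i) z / X i) \<le> 5 / r\<^sup>2 * cmod (g z)"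
          by (simp add: norm_mult norm_divide mult.commute)
      qed
    qed (use int intE in auto)
    thus "(\<lambda>i. (LINT z|lborel. cnj (g z) * E (X i) z) / X i) \<longlonglongrightarrow> 0"
      by simp
  qed
  have "((\<lambda>h. (\<phi> (\<zeta> + h) - \<phi> \<zeta>) / h - g \<zeta>) \<longlongrightarrow> 0) (at 0)"
    using \<phi> unfolding DERIV_def by (rule LIM_zero)
  from tendsto_norm_zero[OF this]
  have "((\<lambda>h. pi * cmod ((\<phi> (\<zeta> + h) - \<phi> \<zeta>) / h - g \<zeta>)) \<longlongrightarrow> 0) (at 0)"
    by (rule tendsto_mult_right_zero)
  moreover have "\<forall>\<^sub>F h in at 0. pi * cmod ((\<phi> (\<zeta> + h) - \<phi> \<zeta>) / h - g \<zeta>) =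
      cmod (pi * cnj (\<phi> (\<zeta> + h) - \<phi> \<zeta> - g \<zeta> * h) / h)"
  proof -
    have "\<forall>\<^sub>F h in at (0::complex). h \<noteq> 0" by (simp add: eventually_at_filter)
    thus ?thesis
    proof eventually_elim
      case (elim h)
      have "(\<phi> (\<zeta> + h) - \<phi> \<zeta>) / h - g \<zeta> = (\<phi> (\<zeta> + h) - \<phi> \<zeta> - g \<zeta> * h) / h"
        using elim by (simp add: field_simps)
      thus ?case by (simp add: norm_mult norm_divide del: complex_cnj_diff complex_cnj_mult)
    qed
  qed
  ultimately have "((\<lambda>h. cmod (pi * cnj (\<phi> (\<zeta> + h) - \<phi> \<zeta> - g \<zeta> * h) / h)) \<longlongrightarrow> 0) (at 0)"
    by (rule Lim_transform_eventually)
  hence lim2: "((\<lambda>h. pi * cnj (\<phi> (\<zeta> + h) - \<phi> \<zeta> - g \<zeta> * h) / h) \<longlongrightarrow> 0) (at 0)"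
    by (simp only: tendsto_norm_zero_iff)
  let ?F = "\<lambda>u. cutoff_transform g r u + pi * cnj (\<phi> u)"
  have "((\<lambda>h. (?F (\<zeta> + h) - ?F \<zeta>) / h) \<longlongrightarrow> A) (at 0)"
  proof -
    have "((\<lambda>h. (LINT z|lborel. cnj (g z) * E h z) / h + pi * cnj (\<phi> (\<zeta> + h) - \<phi> \<zeta> - g \<zeta> * h) / h + A) \<longlongrightarrow> 0 + 0 + A) (at 0)"
      by (intro tendsto_intros lim lim2)
    moreover have "\<forall>\<^sub>F h in at 0. (LINT z|lborel. cnj (g z) * E h z) / h + pi * cnj (\<phi> (\<zeta> + h) - \<phi> \<zeta> - g \<zeta> * h) / h + A = (?F (\<zeta> + h) - ?F \<zeta>) / h"
    proof -
      have "\<forall>\<^sub>F h in at (0::complex). h \<noteq> 0" by (simp add: eventually_at_filter)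
      thus ?thesis
      proof eventually_elim
        case (elim h)
        show ?case unfolding cutoff_transform_eq[symmetric] using elim by (simp add: field_simps)
      qed
    qed
    ultimately show ?thesis by (auto intro: Lim_transform_eventually)
  qed
  thus ?thesis unfolding field_differentiable_def DERIV_def by blast
qed

section \<open>Uniform L2 bounds and decay for the kernel
  \<open>y / (y^2 + |z - \<zeta>|^2)\<close>\<close>

lemma nn_integral_Cauchy_density_le:
  fixes a y :: real
  assumes y: "y > 0"
  shows "(\<integral>\<^sup>+x. ennreal (y / (y\<^sup>2 + (x - a)\<^sup>2)) \<partial>lborel) \<le> ennreal pi"
proof -
  let ?f = "\<lambda>x. y / (y\<^sup>2 + (x - a)\<^sup>2)"
  have pos: "y\<^sup>2 + t\<^sup>2 > 0" for t using y by (simp add: add_pos_nonneg)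
  have m[measurable]: "?f \<in> borel_measurable borel" by measurable
  have half: "(\<integral>\<^sup>+x. ennreal (?f x) * indicator {a..} x \<partial>lborel) = ennreal (pi / 2 - arctan ((a - a) / y))"
  proof (rule nn_integral_FTC_atLeast[where F="\<lambda>x. arctan ((x - a) / y)", OF m])
    show "((\<lambda>x. arctan ((x - a) / y)) has_real_derivative ?f x) (at x)" for x
      using y pos[of "x - a"] by (auto intro!: derivative_eq_intros simp: field_simps power2_eq_square)
    show "((\<lambda>x. arctan ((x - a) / y)) \<longlongrightarrow> pi / 2) at_top"
      using y by real_asymp
  qed (use pos y in \<open>auto intro!: divide_nonneg_pos\<close>)
  have "(\<integral>\<^sup>+x. ennreal (?f x) \<partial>lborel) \<le> (\<integral>\<^sup>+x. ennreal (?f x) * indicator {a..} x + ennreal (?f x) * indicator {..a} x \<partial>lborel)"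
    by (intro nn_integral_mono) (auto simp: indicator_def)
  also have "\<dots> = (\<integral>\<^sup>+x. ennreal (?f x) * indicator {a..} x \<partial>lborel) + (\<integral>\<^sup>+x. ennreal (?f x) * indicator {..a} x \<partial>lborel)"
    by (intro nn_integral_add) auto
  also have "(\<integral>\<^sup>+x. ennreal (?f x) * indicator {..a} x \<partial>lborel) = (\<integral>\<^sup>+x. ennreal (?f x) * indicator {a..} x \<partial>lborel)"
    by (subst nn_integral_real_affine[where c="-1" and t="2 * a"])
      (auto intro!: nn_integral_cong simp: indicator_def power2_commute)
  also have "(\<integral>\<^sup>+x. ennreal (?f x) * indicator {a..} x \<partial>lborel) + (\<integral>\<^sup>+x. ennreal (?f x) * indicator {a..} x \<partial>lborel) = ennreal pi"
    unfolding half by (simp flip: ennreal_plus)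
  finally show ?thesis .
qed

text \<open>Since \<open>(y^2 + a^2) * (y^2 + b^2) \<le> (y^2 + a^2 + b^2)^2\<close>, the squared
  kernel lies below a product of two one-dimensional Cauchy densities, each of integral at most
  \<open>pi\<close>. The bound is therefore independent of \<open>y\<close> and
  \<open>\<zeta>\<close>.\<close>

lemma Cauchy_kernel_L2:
  fixes \<zeta> :: complex
  assumes y: "y > 0"
  shows "integrable lborel (\<lambda>z. (y / (y\<^sup>2 + (cmod (z - \<zeta>))\<^sup>2))\<^sup>2)" (is "integrable _ ?k")
    and "(LINT z|lborel. (y / (y\<^sup>2 + (cmod (z - \<zeta>))\<^sup>2))\<^sup>2) \<le> pi\<^sup>2"
proof -
  let ?f = "\<lambda>b x. y / (y\<^sup>2 + (x - \<zeta> \<bullet> b)\<^sup>2)"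
  have "(\<integral>\<^sup>+z. ennreal (?k z) \<partial>lborel) \<le> (\<integral>\<^sup>+z. (\<Prod>b\<in>Basis. ennreal (?f b (z \<bullet> b))) \<partial>lborel)"
  proof (rule nn_integral_mono)
    fix z :: complex
    define a b where "a = Re z - Re \<zeta>" and "b = Im z - Im \<zeta>"
    have p: "y\<^sup>2 + a\<^sup>2 > 0" "y\<^sup>2 + b\<^sup>2 > 0" using y by (simp_all add: add_pos_nonneg)
    have c: "(cmod (z - \<zeta>))\<^sup>2 = a\<^sup>2 + b\<^sup>2" by (simp add: cmod_power2 a_def b_def)
    have "?k z = y\<^sup>2 / (y\<^sup>2 + (a\<^sup>2 + b\<^sup>2))\<^sup>2"
      by (simp add: c power_divide)
    also have "\<dots> \<le> y\<^sup>2 / ((y\<^sup>2 + a\<^sup>2) * (y\<^sup>2 + b\<^sup>2))"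
    proof (rule divide_left_mono)
      show "(y\<^sup>2 + a\<^sup>2) * (y\<^sup>2 + b\<^sup>2) \<le> (y\<^sup>2 + (a\<^sup>2 + b\<^sup>2))\<^sup>2"
        unfolding power2_eq_square[of "y\<^sup>2 + (a\<^sup>2 + b\<^sup>2)"] using p by (intro mult_mono) auto
      show "0 < (y\<^sup>2 + (a\<^sup>2 + b\<^sup>2))\<^sup>2 * ((y\<^sup>2 + a\<^sup>2) * (y\<^sup>2 + b\<^sup>2))"
        using p y by (intro mult_pos_pos zero_less_power) (simp_all add: add_pos_nonneg)
    qed simp
    also have "\<dots> = (y / (y\<^sup>2 + a\<^sup>2)) * (y / (y\<^sup>2 + b\<^sup>2))"
      by (simp add: power2_eq_square)
    finally show "ennreal (?k z) \<le> (\<Prod>b\<in>Basis. ennreal (?f b (z \<bullet> b)))"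
      using p y by (simp add: Basis_complex_def a_def b_def ennreal_mult[symmetric])
  qed
  also have "\<dots> = (\<Prod>b\<in>(Basis::complex set). (\<integral>\<^sup>+x. ennreal (?f b x) \<partial>lborel))"
    by (subst nn_integral_lborel_prod) auto
  also have "\<dots> \<le> (\<Prod>b\<in>(Basis::complex set). ennreal pi)"
    using y by (simp add: Basis_complex_def) (intro mult_mono nn_integral_Cauchy_density_le; simp)
  also have "\<dots> = ennreal (pi\<^sup>2)"
    by (simp add: power2_eq_square ennreal_mult)
  finally have le: "(\<integral>\<^sup>+z. ennreal (?k z) \<partial>lborel) \<le> ennreal (pi\<^sup>2)" .
  thus int: "integrable lborel ?k"
    by (intro integrableI_nonneg) (auto simp: le_less_trans)
  have "ennreal (LINT z|lborel. ?k z) \<le> ennreal (pi\<^sup>2)"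
    using le by (subst (asm) nn_integral_eq_integral[OF int]) auto
  thus "(LINT z|lborel. ?k z) \<le> pi\<^sup>2"
    by simp
qed

lemma integral_small_ball:
  fixes f :: "complex \<Rightarrow> real"
  assumes f: "integrable lborel f" and \<epsilon>: "\<epsilon> > 0"
  shows "\<exists>\<rho>>0. (LINT z|lborel. indicator (ball p \<rho>) z * f z) < \<epsilon>"
proof -
  have "(\<lambda>n. LINT z|lborel. indicator (ball p (1 / Suc n)) z * f z) \<longlonglongrightarrow> (LINT z|(lborel :: complex measure). (0::real))"
  proof (rule integral_dominated_convergence[where w="\<lambda>z. \<bar>f z\<bar>"])
    show "AE z in lborel. (\<lambda>n. indicator (ball p (1 / Suc n)) z * f z) \<longlonglongrightarrow> 0"
      using AE_lborel_singleton[of p]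
    proof eventually_elim
      case (elim z)
      hence "dist p z > 0" by simp
      then obtain N where N: "1 / Suc N < dist p z" using nat_approx_posE by blast
      have "\<forall>\<^sub>F n in sequentially. indicator (ball p (1 / Suc n)) z * f z = 0"
        using eventually_ge_at_top[of N]
      proof eventually_elim
        case (elim n)
        have "1 / real (Suc n) \<le> 1 / real (Suc N)" using elim by (intro divide_left_mono) auto
        thus ?case using N by (simp add: indicator_def)
      qed
      thus ?case by (rule tendsto_eventually)
    qed
  qed (use f in \<open>auto simp: indicator_def\<close>)
  hence "\<forall>\<^sub>F n in sequentially. (LINT z|lborel. indicator (ball p (1 / Suc n)) z * f z) < \<epsilon>"
    using \<epsilon> by (intro order_tendstoD(2)[of _ 0]) auto
  then obtain n where "(LINT z|lborel. indicator (ball p (1 / Suc n)) z * f z) < \<epsilon>"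
    by (auto simp: eventually_sequentially)
  thus ?thesis by (intro exI[of _ "1 / Suc n"]) auto
qed

text \<open>Near \<open>p\<close> the product is split by
  \<open>u * v \<le> A / 2 * u^2 + v^2 / (2 * A)\<close>: a large \<open>A\<close> makes the kernel
  term small in spite of its merely bounded norm, and then a small disc makes the \<open>g\<close>
  term small. Away from \<open>p\<close> the kernel itself is at most
  \<open>4 * y / \<rho>^2\<close>.\<close>

lemma Cauchy_kernel_integral_decay:
  fixes g :: "complex \<Rightarrow> complex"
  assumes g1: "integrable lborel g" and g2: "integrable lborel (\<lambda>z. (cmod (g z))\<^sup>2)" and \<epsilon>: "\<epsilon> > 0"
  shows "\<exists>\<delta>>0. \<forall>\<zeta> y. cmod (\<zeta> - p) < \<delta> \<longrightarrow> 0 < y \<longrightarrow> y < \<delta> \<longrightarrow>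
     integrable lborel (\<lambda>z. cmod (g z) * (y / (y\<^sup>2 + (cmod (z - \<zeta>))\<^sup>2))) \<and>
     (LINT z|lborel. cmod (g z) * (y / (y\<^sup>2 + (cmod (z - \<zeta>))\<^sup>2))) < \<epsilon>"
proof -
  \<comment> \<open>With this \<open>A\<close> the kernel term \<open>pi^2 / (2 * A)\<close> is
    \<open>\<epsilon> / 4\<close>; the choice of \<open>\<rho>\<close> below makes the local term
    another \<open>\<epsilon> / 4\<close>.\<close>
  define A where "A = 2 * pi\<^sup>2 / \<epsilon>"
  have A: "A > 0" using \<epsilon> by (simp add: A_def)
  obtain \<rho> where \<rho>: "\<rho> > 0" "(LINT z|lborel. indicator (ball p \<rho>) z * (cmod (g z))\<^sup>2) < \<epsilon> / (2 * A)"
    using integral_small_ball[OF g2, of "\<epsilon> / (2 * A)" p] A \<epsilon> by auto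
  define N where "N = (LINT z|lborel. cmod (g z))"
  have N: "N \<ge> 0" by (simp add: N_def)
  \<comment> \<open>The first bound keeps \<open>\<zeta>\<close> at distance at least
    \<open>\<rho> / 2\<close> from every \<open>z\<close> outside the disc, the second makes the far
    term at most \<open>\<epsilon> / 4\<close>. \<open>N + 1\<close> avoids a division by 0.\<close>
  define \<delta> where "\<delta> = min (\<rho> / 2) (\<epsilon> * \<rho>\<^sup>2 / (16 * (N + 1)))"
  have \<delta>: "\<delta> > 0" "\<delta> \<le> \<rho> / 2" "\<delta> \<le> \<epsilon> * \<rho>\<^sup>2 / (16 * (N + 1))"
    unfolding \<delta>_def using \<rho> \<epsilon> N by (simp_all only: min.cobounded1 min.cobounded2) auto
  have "integrable lborel (\<lambda>z. cmod (g z) * (y / (y\<^sup>2 + (cmod (z - \<zeta>))\<^sup>2))) \<and>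
     (LINT z|lborel. cmod (g z) * (y / (y\<^sup>2 + (cmod (z - \<zeta>))\<^sup>2))) < \<epsilon>"
    if \<zeta>: "cmod (\<zeta> - p) < \<delta>" and y: "0 < y" "y < \<delta>" for \<zeta> y
  proof -
    let ?k = "\<lambda>z. y / (y\<^sup>2 + (cmod (z - \<zeta>))\<^sup>2)"
    let ?b = "\<lambda>z. A / 2 * (indicator (ball p \<rho>) z * (cmod (g z))\<^sup>2) + 1 / (2 * A) * (?k z)\<^sup>2 + 4 * y / \<rho>\<^sup>2 * cmod (g z)"
    have kpos: "?k z \<ge> 0" for z using y by (simp)
    have bd: "cmod (g z) * ?k z \<le> ?b z" for z
    proof (cases "z \<in> ball p \<rho>")
      case True
      have "0 \<le> (A * cmod (g z) - ?k z)\<^sup>2 / (2 * A)" using A by simp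
      also have "\<dots> = A / 2 * (cmod (g z))\<^sup>2 + 1 / (2 * A) * (?k z)\<^sup>2 - cmod (g z) * ?k z"
        using A by (simp add: power2_diff power_mult_distrib add_divide_distrib diff_divide_distrib power2_eq_square[of A])
      finally have "cmod (g z) * ?k z \<le> A / 2 * (cmod (g z))\<^sup>2 + 1 / (2 * A) * (?k z)\<^sup>2" by simp
      moreover have "0 \<le> 4 * y / \<rho>\<^sup>2 * cmod (g z)" using y by simp
      ultimately show ?thesis using True by simp
    next
      case False
      hence "\<rho> \<le> cmod (z - p)" by (simp add: dist_norm norm_minus_commute)
      also have "\<dots> \<le> cmod (z - \<zeta>) + cmod (\<zeta> - p)" using norm_triangle_ineq[of "z - \<zeta>" "\<zeta> - p"] by simp
      finally have "\<rho> / 2 \<le> cmod (z - \<zeta>)" using \<zeta> \<delta> by simp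
      hence "(\<rho> / 2)\<^sup>2 \<le> y\<^sup>2 + (cmod (z - \<zeta>))\<^sup>2" using \<rho> by (intro add_increasing power_mono) auto
      hence "?k z \<le> y / (\<rho> / 2)\<^sup>2" using y \<rho> by (intro divide_left_mono mult_pos_pos add_pos_nonneg) auto
      hence "?k z * cmod (g z) \<le> y / (\<rho> / 2)\<^sup>2 * cmod (g z)" by (intro mult_right_mono) auto
      moreover have "0 \<le> 1 / (2 * A) * (?k z)\<^sup>2" using A by simp
      ultimately show ?thesis using False by (simp add: power_divide mult.commute)
    qed
    note [measurable] = borel_measurable_integrable[OF g1]
    have int_i: "integrable lborel (\<lambda>z. indicator (ball p \<rho>) z * (cmod (g z))\<^sup>2)"
      by (rule Bochner_Integration.integrable_bound[OF g2]) (auto simp: indicator_def)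
    have k2: "integrable lborel (\<lambda>z. (?k z)\<^sup>2)" "(LINT z|lborel. (?k z)\<^sup>2) \<le> pi\<^sup>2"
      using Cauchy_kernel_L2[OF y(1)] by auto
    have intb: "integrable lborel ?b"
      using int_i k2(1) g1 by (intro Bochner_Integration.integrable_add integrable_mult_right integrable_norm)
    have int: "integrable lborel (\<lambda>z. cmod (g z) * ?k z)"
    proof (rule Bochner_Integration.integrable_bound[OF intb])
      have "norm (cmod (g z) * ?k z) \<le> norm (?b z)" for z
        using bd[of z] mult_nonneg_nonneg[OF norm_ge_zero kpos, of "g z" z]
        unfolding real_norm_def by linarith
      thus "AE z in lborel. norm (cmod (g z) * ?k z) \<le> norm (?b z)" by (intro AE_I2)
    qed measurable
    have "(LINT z|lborel. cmod (g z) * ?k z) \<le> (LINT z|lborel. ?b z)"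
      using bd by (intro integral_mono[OF int intb]) auto
    also have "\<dots> = A / 2 * (LINT z|lborel. indicator (ball p \<rho>) z * (cmod (g z))\<^sup>2) + 1 / (2 * A) * (LINT z|lborel. (?k z)\<^sup>2) + 4 * y / \<rho>\<^sup>2 * N"
    proof -
      have i: "integrable lborel (\<lambda>z. A / 2 * (indicator (ball p \<rho>) z * (cmod (g z))\<^sup>2))"
        "integrable lborel (\<lambda>z. 1 / (2 * A) * (?k z)\<^sup>2)"
        "integrable lborel (\<lambda>z. 4 * y / \<rho>\<^sup>2 * cmod (g z))"
        by (intro integrable_mult_right integrable_norm int_i k2(1) g1)+
      show ?thesis
        unfolding Bochner_Integration.integral_add[OF Bochner_Integration.integrable_add[OF i(1,2)] i(3)]
          Bochner_Integration.integral_add[OF i(1,2)] N_def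
        by (simp only: Bochner_Integration.integral_mult_right_zero)
    qed
    also have "\<dots> < A / 2 * (\<epsilon> / (2 * A)) + 1 / (2 * A) * pi\<^sup>2 + 4 * y / \<rho>\<^sup>2 * N"
      using A \<rho>(2) k2(2) by (intro add_strict_right_mono add_less_le_mono mult_strict_left_mono mult_left_mono) auto
    also have "A / 2 * (\<epsilon> / (2 * A)) = \<epsilon> / 4" using A by simp
    also have "1 / (2 * A) * pi\<^sup>2 = \<epsilon> / 4" using \<epsilon> by (simp add: A_def)
    also have "4 * y / \<rho>\<^sup>2 * N \<le> 4 * (\<epsilon> * \<rho>\<^sup>2 / (16 * (N + 1))) / \<rho>\<^sup>2 * N"
      using y \<delta> N by (intro mult_right_mono divide_right_mono) auto
    also have "\<dots> = \<epsilon> / 4 * (N / (N + 1))"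
    proof -
      have "4 * (\<epsilon> * \<rho>\<^sup>2 / (16 * M)) / \<rho>\<^sup>2 * N = \<epsilon> / 4 * (N / M)" if "M > 0" for M
        using that \<rho>(1) by (simp add: field_simps)
      from this[of "N + 1"] show ?thesis using N by linarith
    qed
    also have "\<dots> \<le> \<epsilon> / 4 * 1" using N \<epsilon> by (intro mult_left_mono) auto
    finally show ?thesis using int \<epsilon> by simp
  qed
  thus ?thesis using \<delta>(1) by blast
qed

subsection \<open>Reflection across the real line\<close>

text \<open>The singularity \<open>1 / sqrt (Im w)\<close> is integrable along vertical segments.
  Hence the primitives shifted upwards by \<open>c n\<close> form a uniformly Cauchy sequence on the
  closed half-disc, and their limit is the continuous extension.\<close>

lemma primitive_extends_to_real_line:
  fixes F :: "complex \<Rightarrow> complex"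
  assumes r: "r > 0" and hol: "F holomorphic_on ball 0 r \<inter> {w. Im w > 0}"
    and K: "\<And>w. w \<in> ball 0 r \<Longrightarrow> Im w > 0 \<Longrightarrow> cmod (F w) \<le> K / sqrt (Im w)"
  shows "\<exists>P. continuous_on (ball 0 (r / 2) \<inter> {w. Im w \<ge> 0}) P \<and>
    (\<forall>w. w \<in> ball 0 r \<longrightarrow> Im w > 0 \<longrightarrow> (P has_field_derivative F w) (at w))"
proof -
  let ?D = "ball 0 r \<inter> {w. Im w > 0}"
  let ?A = "ball 0 (r / 2) \<inter> {w. Im w \<ge> 0}"
  have D: "convex ?D" "open ?D"
    by (auto intro!: convex_Int convex_halfspace_Im_gt open_Int open_halfspace_Im_gt)
  obtain P0 where "\<And>w. w \<in> ?D \<Longrightarrow> (P0 has_field_derivative F w) (at w within ?D)"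
    using holomorphic_convex_primitive'[OF D hol] by blast
  hence P0: "(P0 has_field_derivative F w) (at w)" if "w \<in> ?D" for w
    using that D(2) by (metis at_within_open)
  have K0: "K \<ge> 0"
  proof -
    have "0 \<le> K / sqrt (r / 2)"
      using order_trans[OF norm_ge_zero K[of "\<i> * of_real (r / 2)"]] r by (simp add: norm_mult)
    thus ?thesis using r by (simp add: zero_le_divide_iff)
  qed
  define c where "c n = r / (4 * real (Suc n))" for n
  have c: "0 < c n" "c n \<le> r / 4" for n
    using r by (auto simp: c_def field_simps)
  define p where "p n w = w + \<i> * of_real (c n)" for n w
  have inD: "w + \<i> * of_real t \<in> ?D" if "w \<in> ?A" "0 < t" "t \<le> r / 4" for w t
  proof -
    have "cmod (w + \<i> * of_real t) \<le> cmod w + t"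
      using that norm_triangle_ineq[of w "\<i> * of_real t"] by (simp add: norm_mult)
    also have "\<dots> < r" using that r by simp
    finally show ?thesis using that by simp
  qed
  have vert: "cmod (P0 (w + \<i> * of_real b) - P0 (w + \<i> * of_real a)) \<le> 2 * K * sqrt (b - a)"
    if w: "w \<in> ?A" and ab: "0 < a" "a < b" "b \<le> r / 4" for w a b
  proof -
    have der: "((\<lambda>t. P0 (w + \<i> * of_real t)) has_vector_derivative \<i> * F (w + \<i> * of_real t)) (at t)"
      if "a \<le> t" "t \<le> b" for t
    proof -
      have "((\<lambda>t. w + \<i> * of_real t) has_vector_derivative \<i>) (at t)"
        by (auto intro!: derivative_eq_intros)
      from field_vector_diff_chain_at[OF this P0[OF inD[OF w, of t]]] show ?thesis
        using that ab by (auto simp: o_def)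
    qed
    have "cmod (P0 (w + \<i> * of_real b) - P0 (w + \<i> * of_real a)) \<le> 2 * K * sqrt (Im w + b) - 2 * K * sqrt (Im w + a)"
    proof (rule differentiable_bound_general[OF ab(2), where f'="\<lambda>t. \<i> * F (w + \<i> * of_real t)" and \<phi>'="\<lambda>t. K / sqrt (Im w + t)"])
      show "continuous_on {a..b} (\<lambda>t. P0 (w + \<i> * of_real t))"
        by (rule continuous_on_vector_derivative, rule has_vector_derivative_at_within, rule der) auto
      show "continuous_on {a..b} (\<lambda>t. 2 * K * sqrt (Im w + t))"
        by (intro continuous_intros)
      fix t assume t: "a < t" "t < b"
      show "((\<lambda>t. P0 (w + \<i> * of_real t)) has_vector_derivative \<i> * F (w + \<i> * of_real t)) (at t)"
        using der t by simp
      have "Im w + t > 0" using w t ab by auto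
      thus "((\<lambda>t. 2 * K * sqrt (Im w + t)) has_vector_derivative K / sqrt (Im w + t)) (at t)"
        by (auto intro!: derivative_eq_intros simp flip: has_real_derivative_iff_has_vector_derivative simp: field_simps)
      show "cmod (\<i> * F (w + \<i> * of_real t)) \<le> K / sqrt (Im w + t)"
        using K[of "w + \<i> * of_real t"] inD[OF w, of t] t ab by (simp add: norm_mult)
    qed
    also have "\<dots> = 2 * K * (sqrt (Im w + b) - sqrt (Im w + a))"
      by (simp add: algebra_simps)
    \<comment> \<open>Subadditivity of the root removes \<open>Im w\<close> from the bound, which
      makes it uniform down to the real line.\<close>
    also have "sqrt (Im w + b) \<le> sqrt (Im w + a) + sqrt (b - a)"
      using sqrt_add_le_add_sqrt[of "Im w + a" "b - a"] w ab by simp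
    finally show ?thesis using K0 by (simp add: mult_left_mono)
  qed
  define e where "e n = 2 * K * sqrt (c n)" for n
  have c0: "c \<longlonglongrightarrow> 0"
    unfolding c_def by real_asymp
  have e0: "e \<longlonglongrightarrow> 0"
    unfolding e_def using tendsto_real_sqrt[OF c0] by (intro tendsto_mult_right_zero) simp
  have cmono: "c m \<le> c n" if "n \<le> m" for n m
    using that r by (auto simp: c_def intro!: divide_left_mono)
  have Pn: "cmod (P0 (p m w) - P0 (p n w)) \<le> e n" if "w \<in> ?A" "n \<le> m" for w n m
  proof (cases "c m = c n")
    case True
    thus ?thesis using K0 c(1)[of n] by (simp add: p_def e_def)
  next
    case False
    hence lt: "c m < c n" using cmono[OF that(2)] by simp
    have "cmod (P0 (p m w) - P0 (p n w)) \<le> 2 * K * sqrt (c n - c m)"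
      using vert[OF that(1) c(1) lt c(2)] by (simp add: p_def norm_minus_commute)
    also have "\<dots> \<le> e n"
      unfolding e_def using c(1)[of m] K0 by (intro mult_left_mono) auto
    finally show ?thesis .
  qed
  define Q where "Q w = lim (\<lambda>n. P0 (p n w))" for w
  have Qlim: "(\<lambda>n. P0 (p n w)) \<longlonglongrightarrow> Q w" if "w \<in> ?A" for w
  proof -
    have "Cauchy (\<lambda>n. P0 (p n w))"
    proof (rule metric_CauchyI)
      fix \<epsilon> :: real assume "\<epsilon> > 0"
      then obtain N where N: "e N < \<epsilon> / 2"
        using order_tendstoD(2)[OF e0, of "\<epsilon> / 2"] by (auto simp: eventually_sequentially)
      show "\<exists>M. \<forall>m\<ge>M. \<forall>n\<ge>M. dist (P0 (p m w)) (P0 (p n w)) < \<epsilon>"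
      proof (intro exI[of _ N] allI impI)
        fix m n assume "N \<le> m" "N \<le> n"
        hence "dist (P0 (p m w)) (P0 (p N w)) < \<epsilon> / 2" "dist (P0 (p n w)) (P0 (p N w)) < \<epsilon> / 2"
          unfolding dist_norm by (blast intro: le_less_trans[OF Pn[OF that] N])+
        thus "dist (P0 (p m w)) (P0 (p n w)) < \<epsilon>" by (rule dist_triangle_half_l)
      qed
    qed
    thus ?thesis by (simp add: Q_def Cauchy_convergent_iff convergent_LIMSEQ_iff)
  qed
  have unif: "uniform_limit ?A (\<lambda>n w. P0 (p n w)) Q sequentially"
  proof (rule uniform_limitI)
    fix \<epsilon> :: real assume "\<epsilon> > 0"
    have "\<forall>\<^sub>F n in sequentially. e n < \<epsilon>"
      using order_tendstoD(2)[OF e0] \<open>\<epsilon> > 0\<close> by auto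
    thus "\<forall>\<^sub>F n in sequentially. \<forall>w\<in>?A. dist (P0 (p n w)) (Q w) < \<epsilon>"
    proof eventually_elim
      case (elim n)
      show ?case
      proof
        fix w assume w: "w \<in> ?A"
        have "(\<lambda>m. cmod (P0 (p m w) - P0 (p n w))) \<longlonglongrightarrow> cmod (Q w - P0 (p n w))"
          by (intro tendsto_intros Qlim w)
        hence "cmod (Q w - P0 (p n w)) \<le> e n"
          by (rule tendsto_upperbound) (auto intro!: eventually_sequentiallyI[of n] Pn w)
        thus "dist (P0 (p n w)) (Q w) < \<epsilon>" using elim by (simp add: dist_norm norm_minus_commute)
      qed
    qed
  qed
  have contP0: "continuous_on ?D P0"
    by (intro continuous_at_imp_continuous_on ballI DERIV_isCont[OF P0])
  have contQ: "continuous_on ?A Q"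
  proof (rule uniform_limit_theorem[OF _ unif])
    have "continuous_on ?A (\<lambda>w. P0 (p n w))" for n
      unfolding p_def
    proof (rule continuous_on_compose2[OF contP0])
      show "(\<lambda>w. w + \<i> * of_real (c n)) ` ?A \<subseteq> ?D"
        by (rule image_subsetI) (rule inD[OF _ c])
    qed (intro continuous_intros)
    thus "\<forall>\<^sub>F n in sequentially. continuous_on ?A (\<lambda>w. P0 (p n w))" by simp
  qed auto
  have eq: "Q w = P0 w" if w: "w \<in> ?A" "Im w > 0" for w
  proof (rule LIMSEQ_unique[OF Qlim[OF w(1)]])
    from c0 have "(\<lambda>n. p n w) \<longlonglongrightarrow> w + \<i> * of_real 0"
      unfolding p_def by (intro tendsto_intros)
    moreover have "w \<in> ?D" using w r by auto
    hence "isCont P0 w" using P0 DERIV_isCont by blast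
    ultimately show "(\<lambda>n. P0 (p n w)) \<longlonglongrightarrow> P0 w"
      by (intro isCont_tendsto_compose[of w P0]) auto
  qed
  \<comment> \<open>\<open>Q\<close> is controlled only on the disc of half the radius, whereas the
    derivative is claimed on the full upper half-disc; there \<open>P0\<close> is used.\<close>
  let ?P = "\<lambda>w. if Im w > 0 then P0 w else Q w"
  have "continuous_on ?A ?P"
    by (rule continuous_on_eq[OF contQ]) (use eq in auto)
  moreover have "(?P has_field_derivative F w) (at w)" if "w \<in> ball 0 r" "Im w > 0" for w
    using that by (intro has_field_derivative_transform_within_open[OF P0 D(2)]) auto
  ultimately show ?thesis by blast
qed

text \<open>Neither function is assumed to have boundary values; only their difference at mirror
  points tends to 0. Their primitives are continuous up to the diameter, and there they differ by a
  constant because the difference of the derivatives vanishes in the limit. After correction by that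
  constant they form a continuous function, holomorphic off the line and hence across it, and its
  derivative is the required gluing.\<close>

lemma holomorphic_glue_across_real_line:
  fixes F1 F2 :: "complex \<Rightarrow> complex"
  assumes r: "r > 0"
    and F1: "F1 holomorphic_on ball 0 r \<inter> {w. Im w > 0}"
    and F2: "F2 holomorphic_on ball 0 r \<inter> {w. Im w < 0}"
    and K: "\<And>w. w \<in> ball 0 r \<Longrightarrow> Im w > 0 \<Longrightarrow> cmod (F1 w) \<le> K / sqrt (Im w)"
    and lim: "\<And>t. t \<in> ball 0 r \<Longrightarrow> Im t = 0 \<Longrightarrow>
      ((\<lambda>w. F1 w - F2 (cnj w)) \<longlongrightarrow> 0) (at t within {w. Im w > 0})"
  shows "\<exists>F s. 0 < s \<and> s \<le> r \<and> F holomorphic_on ball 0 s \<and>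
    (\<forall>w\<in>ball 0 s. Im w > 0 \<longrightarrow> F w = F1 w) \<and> (\<forall>w\<in>ball 0 s. Im w < 0 \<longrightarrow> F w = F2 w)"
proof -
  let ?C = "cball 0 (r / 2) \<inter> {w. Im w \<ge> 0}"
  let ?D = "\<lambda>w. if Im w > 0 then F1 w - F2 (cnj w) else 0"
  have F2': "(\<lambda>w. cnj (F2 (cnj w))) holomorphic_on ball 0 r \<inter> {w. Im w > 0}"
  proof -
    have "F2 holomorphic_on cnj ` (ball 0 r \<inter> {w. Im w > 0})"
      by (rule holomorphic_on_subset[OF F2]) auto
    from holomorphic_on_compose_cnj_cnj[OF this] show ?thesis
      by (simp add: o_def open_Int open_halfspace_Im_gt)
  qed
  \<comment> \<open>The pointwise limits say that the difference, set to 0 on the diameter, is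
    continuous on a compact half-disc. Uniform continuity, comparing \<open>w\<close> with its real
    part, makes it small on a whole strip.\<close>
  have unifsmall: "\<exists>\<delta>>0. \<forall>w\<in>?C. 0 < Im w \<longrightarrow> Im w < \<delta> \<longrightarrow> cmod (F1 w - F2 (cnj w)) < \<epsilon>" if eps: "\<epsilon> > 0" for \<epsilon>
  proof -
    have "continuous_on ?C ?D"
      unfolding continuous_on_def
    proof
      fix t assume t: "t \<in> ?C"
      show "(?D \<longlongrightarrow> ?D t) (at t within ?C)"
      proof (cases "Im t = 0")
        case True
        have tb: "t \<in> ball 0 r" using t r by auto
        have *: "\<forall>\<^sub>F w in at t within {w. Im w > 0}. cmod (F1 w - F2 (cnj w)) < e" if "e > 0" for e
          using lim[OF tb True] that by (auto simp: tendsto_iff)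
        have "\<forall>\<^sub>F w in at t within ?C. cmod (?D w) < e" if e: "e > 0" for e
        proof -
          obtain S where "open S" "t \<in> S" "\<And>w. w \<in> S \<Longrightarrow> w \<noteq> t \<Longrightarrow> Im w > 0 \<Longrightarrow> cmod (F1 w - F2 (cnj w)) < e"
            using * [OF e] unfolding eventually_at_topological by blast
          thus ?thesis using e unfolding eventually_at_topological
            by (intro exI[of _ S]) auto
        qed
        thus ?thesis using True by (auto simp: tendsto_iff)
      next
        case False
        let ?O = "ball 0 r \<inter> {w. Im w > 0}"
        have o: "open ?O" by (auto intro!: open_Int open_halfspace_Im_gt)
        have tO: "t \<in> ?O" using False t r by auto
        have "continuous_on ?O (\<lambda>w. F1 w - cnj (cnj (F2 (cnj w))))"
          by (intro continuous_intros holomorphic_on_imp_continuous_on F1 F2')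
        hence "continuous_on ?O ?D" by (rule continuous_on_eq) auto
        hence "isCont ?D t" using o tO continuous_on_eq_continuous_at by blast
        thus ?thesis unfolding isCont_def by (rule tendsto_within_subset) simp
      qed
    qed
    moreover have "compact ?C" by (intro compact_Int_closed closed_halfspace_Im_ge) auto
    ultimately have uc: "uniformly_continuous_on ?C ?D" by (rule compact_uniformly_continuous)
    obtain \<delta> where \<delta>: "\<delta> > 0" "\<And>w w'. w \<in> ?C \<Longrightarrow> w' \<in> ?C \<Longrightarrow> dist w' w < \<delta> \<Longrightarrow> dist (?D w') (?D w) < \<epsilon>"
      using uc[unfolded uniformly_continuous_on_def, rule_format, OF eps] by blast
    have "cmod (F1 w - F2 (cnj w)) < \<epsilon>" if "w \<in> ?C" "0 < Im w" "Im w < \<delta>" for w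
    proof -
      have "of_real (Re w) \<in> ?C" using that abs_Re_le_cmod[of w] by auto
      moreover have "w - of_real (Re w) = \<i> * of_real (Im w)" by (simp add: complex_eq_iff)
      hence "dist w (of_real (Re w)) < \<delta>" using that by (simp add: dist_norm norm_mult)
      ultimately show ?thesis using \<delta>(2)[of "of_real (Re w)" w] that by simp
    qed
    thus ?thesis using \<delta>(1) by blast
  qed
  obtain \<delta>1 where \<delta>1: "\<delta>1 > 0" "\<And>w. w \<in> ?C \<Longrightarrow> 0 < Im w \<Longrightarrow> Im w < \<delta>1 \<Longrightarrow> cmod (F1 w - F2 (cnj w)) < 1"
    using unifsmall[of 1] by auto
  \<comment> \<open>\<open>r / 2\<close> stays in the compact half-disc, \<open>\<delta>1\<close>
    makes the difference less than 1, and the bound 1 gives \<open>1 \<le> 1 / sqrt (Im w)\<close>.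
    Thus the reflected \<open>F2\<close> inherits the growth bound of \<open>F1\<close> with
    \<open>K + 1\<close>.\<close>
  define r1 where "r1 = Min {r / 2, \<delta>1, 1}"
  have r1: "r1 > 0" "r1 \<le> r / 2" "r1 \<le> \<delta>1" "r1 \<le> 1" using r \<delta>1 by (auto simp: r1_def)
  have sub: "ball 0 r1 \<subseteq> ball (0::complex) r" using r1 r by auto
  have "cmod (cnj (F2 (cnj w))) \<le> (K + 1) / sqrt (Im w)" if "w \<in> ball 0 r1" "Im w > 0" for w
  proof -
    have Im: "Im w < r1" using that abs_Im_le_cmod[of w] by auto
    have "cmod (cnj (F2 (cnj w))) \<le> cmod (F1 w) + cmod (F1 w - F2 (cnj w))"
      using norm_triangle_ineq4[of "F1 w" "F1 w - F2 (cnj w)"] by simp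
    also have "\<dots> \<le> K / sqrt (Im w) + 1"
      using K[of w] \<delta>1(2)[of w] that r1 Im by (intro add_mono) auto
    also have "1 \<le> 1 / sqrt (Im w)"
      using that Im r1 by (simp)
    finally show ?thesis by (simp add: add_divide_distrib)
  qed
  then obtain Q where Q: "continuous_on (ball 0 (r1 / 2) \<inter> {w. Im w \<ge> 0}) Q"
    "\<And>w. w \<in> ball 0 r1 \<Longrightarrow> Im w > 0 \<Longrightarrow> (Q has_field_derivative cnj (F2 (cnj w))) (at w)"
    using primitive_extends_to_real_line[OF r1(1), of "\<lambda>w. cnj (F2 (cnj w))"] F2' sub
    by (blast intro: holomorphic_on_subset)
  obtain P where P: "continuous_on (ball 0 (r1 / 2) \<inter> {w. Im w \<ge> 0}) P"
    "\<And>w. w \<in> ball 0 r1 \<Longrightarrow> Im w > 0 \<Longrightarrow> (P has_field_derivative F1 w) (at w)"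
    using primitive_extends_to_real_line[OF r1(1), of F1 K] F1 K sub
    by (blast intro: holomorphic_on_subset)
  define s where "s = r1 / 2"
  have s: "s > 0" "s < r1" using r1 by (auto simp: s_def)
  \<comment> \<open>For real \<open>z\<close> this compares the upper primitive at height
    \<open>y\<close> with the lower one at height \<open>-y\<close>. Its derivative along the
    diameter is the difference of \<open>F1\<close> and \<open>F2\<close> at mirror points, hence
    uniformly small; letting \<open>y\<close> tend to 0 shows that the boundary difference is
    constant.\<close>
  define h where "h y z = P (z + \<i> * of_real y) - cnj (Q (cnj (z - \<i> * of_real y)))" for y z
  have hlim: "((\<lambda>y. h y t) \<longlongrightarrow> P t - cnj (Q t)) (at_right 0)" if t: "t \<in> ball 0 s" "Im t = 0" for t
  proof -
    let ?A = "ball 0 s \<inter> {w. Im w \<ge> 0}"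
    have tr: "cnj t = t" using t by (simp add: complex_eq_iff)
    have "((\<lambda>y::real. t + \<i> * of_real y) \<longlongrightarrow> t + \<i> * of_real 0) (at_right 0)"
      by (intro tendsto_intros)
    moreover have "\<forall>\<^sub>F y in at_right (0::real). t + \<i> * of_real y \<in> ?A \<and> t + \<i> * of_real y \<noteq> t"
    proof -
      have "\<forall>\<^sub>F y in at_right (0::real). y \<in> {0<..<s - cmod t}"
        using t by (intro eventually_at_right_real) auto
      thus ?thesis
      proof eventually_elim
        case (elim y)
        have "cmod (t + \<i> * of_real y) \<le> cmod t + y" using norm_triangle_ineq[of t "\<i> * of_real y"] elim
          by (simp add: norm_mult)
        thus ?case using elim t by auto
      qed
    qed
    ultimately have fl: "filterlim (\<lambda>y::real. t + \<i> * of_real y) (at t within ?A) (at_right 0)"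
      by (auto simp: filterlim_at eventually_conj_iff)
    have "(P \<longlongrightarrow> P t) (at t within ?A)" "(Q \<longlongrightarrow> Q t) (at t within ?A)"
      using P(1) Q(1) t unfolding continuous_on_def s_def by auto
    from this[THEN filterlim_compose, OF fl]
    have "((\<lambda>y. P (t + \<i> * of_real y) - cnj (Q (t + \<i> * of_real y))) \<longlongrightarrow> P t - cnj (Q t)) (at_right 0)"
      by (intro tendsto_intros) auto
    thus ?thesis by (simp add: h_def tr)
  qed
  have const: "P t - cnj (Q t) = P 0 - cnj (Q 0)" if t: "t \<in> ball 0 s" "Im t = 0" for t
  proof -
    have "cmod ((P t - cnj (Q t)) - (P 0 - cnj (Q 0))) \<le> \<epsilon> * cmod t" if \<epsilon>: "\<epsilon> > 0" for \<epsilon>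
    proof -
      obtain \<delta> where \<delta>: "\<delta> > 0" "\<And>w. w \<in> ?C \<Longrightarrow> 0 < Im w \<Longrightarrow> Im w < \<delta> \<Longrightarrow> cmod (F1 w - F2 (cnj w)) < \<epsilon>"
        using unifsmall[OF \<epsilon>] by auto
      have "((\<lambda>y. cmod (h y t - h y 0)) \<longlongrightarrow> cmod ((P t - cnj (Q t)) - (P 0 - cnj (Q 0)))) (at_right 0)"
        using s t by (intro tendsto_intros hlim) auto
      moreover have "\<forall>\<^sub>F y in at_right (0::real). y \<in> {0<..<min \<delta> (r1 - s)}"
        using \<delta> s by (intro eventually_at_right_real) auto
      hence "\<forall>\<^sub>F y in at_right (0::real). cmod (h y t - h y 0) \<le> \<epsilon> * cmod t"
      proof eventually_elim
        case (elim y)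
        have "cmod (h y t - h y 0) \<le> \<epsilon> * cmod (t - 0)"
        proof (rule field_differentiable_bound[where f'="\<lambda>z. F1 (z + \<i> * of_real y) - F2 (cnj (z + \<i> * of_real y))"])
          show "convex (closed_segment 0 t)" "t \<in> closed_segment 0 t" "0 \<in> closed_segment 0 t" by auto
          fix z assume "z \<in> closed_segment 0 t"
          then obtain u where "0 \<le> u" "u \<le> 1" and z: "z = of_real u * t"
            by (auto simp: in_segment scaleR_conv_of_real)
          hence zt: "cmod z \<le> cmod t" "Im z = 0" using t by (auto simp: norm_mult mult_left_le_one_le)
          have zr: "cnj z = z" using zt by (simp add: complex_eq_iff)
          have "cmod (z + \<i> * of_real y) \<le> cmod z + y" using norm_triangle_ineq[of z "\<i> * of_real y"] elim
            by (simp add: norm_mult)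
          hence b: "z + \<i> * of_real y \<in> ball 0 r1" "Im (z + \<i> * of_real y) = y" using zt t elim by auto
          hence "z + \<i> * of_real y \<in> ?C" using r1 elim by auto
          from \<delta>(2)[OF this] show "cmod (F1 (z + \<i> * of_real y) - F2 (cnj (z + \<i> * of_real y))) \<le> \<epsilon>"
            using b elim by auto
          have 1: "((\<lambda>z. P (z + \<i> * of_real y)) has_field_derivative F1 (z + \<i> * of_real y)) (at z)"
          proof -
            have "((\<lambda>z. z + \<i> * of_real y) has_field_derivative 1) (at z)"
              by (auto intro!: derivative_eq_intros)
            from DERIV_chain2[OF P(2) this] show ?thesis using b elim by simp
          qed
          have 2: "(Q has_field_derivative cnj (F2 (cnj (z + \<i> * of_real y)))) (at (z + \<i> * of_real y))"
            using b elim by (intro Q(2)) auto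
          have "cnj (cnj (z + \<i> * of_real y)) = z + \<i> * of_real y" by simp
          from has_field_derivative_cnj_cnj[of Q "cnj (F2 (cnj (z + \<i> * of_real y)))" "cnj (z + \<i> * of_real y)"] 2
          have "((cnj \<circ> Q \<circ> cnj) has_field_derivative F2 (cnj (z + \<i> * of_real y))) (at (cnj (z + \<i> * of_real y)))"
            by simp
          hence "((cnj \<circ> Q \<circ> cnj) has_field_derivative F2 (cnj (z + \<i> * of_real y))) (at (z - \<i> * of_real y))"
            by (simp add: zr)
          hence "((\<lambda>z. (cnj \<circ> Q \<circ> cnj) (z - \<i> * of_real y)) has_field_derivative F2 (cnj (z + \<i> * of_real y))) (at z)"
          proof -
            assume d: "((cnj \<circ> Q \<circ> cnj) has_field_derivative F2 (cnj (z + \<i> * of_real y))) (at (z - \<i> * of_real y))"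
            have "((\<lambda>z. z - \<i> * of_real y) has_field_derivative 1) (at z)"
              by (auto intro!: derivative_eq_intros)
            from DERIV_chain2[OF d this] show ?thesis by simp
          qed
          with 1 have "((\<lambda>z. P (z + \<i> * of_real y) - (cnj \<circ> Q \<circ> cnj) (z - \<i> * of_real y)) has_field_derivative F1 (z + \<i> * of_real y) - F2 (cnj (z + \<i> * of_real y))) (at z)"
            by (rule DERIV_diff)
          thus "(h y has_field_derivative F1 (z + \<i> * of_real y) - F2 (cnj (z + \<i> * of_real y))) (at z within closed_segment 0 t)"
            unfolding h_def[abs_def] o_def by (rule has_field_derivative_at_within)
        qed
        thus ?case by simp
      qed
      ultimately show ?thesis by (rule tendsto_upperbound) auto
    qed
    note * = this
    show ?thesis
    proof (cases "t = 0")
      case False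
      have "cmod ((P t - cnj (Q t)) - (P 0 - cnj (Q 0))) \<le> 0"
      proof (rule field_le_epsilon)
        fix e :: real assume "e > 0"
        from *[of "e / cmod t"] this False
        show "cmod ((P t - cnj (Q t)) - (P 0 - cnj (Q 0))) \<le> 0 + e" by simp
      qed
      thus ?thesis by simp
    qed simp
  qed
  define J where "J w = (if 0 \<le> Im w then P w - (P 0 - cnj (Q 0)) else cnj (Q (cnj w)))" for w
  have contJ: "continuous_on ((ball 0 s \<inter> {w. 0 \<le> Im w}) \<union> (ball 0 s \<inter> {w. Im w \<le> 0})) J"
    unfolding J_def
  proof (rule continuous_on_cases_local)
    show "closedin (top_of_set (ball 0 s \<inter> {w. 0 \<le> Im w} \<union> ball 0 s \<inter> {w. Im w \<le> 0})) (ball 0 s \<inter> {w. 0 \<le> Im w})"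
      "closedin (top_of_set (ball 0 s \<inter> {w. 0 \<le> Im w} \<union> ball 0 s \<inter> {w. Im w \<le> 0})) (ball 0 s \<inter> {w. Im w \<le> 0})"
      using closed_halfspace_Im_ge[of 0] closed_halfspace_Im_le[of 0]
      by (auto simp: closedin_closed)
    show "continuous_on (ball 0 s \<inter> {w. 0 \<le> Im w}) (\<lambda>w. P w - (P 0 - cnj (Q 0)))"
      using P(1) by (intro continuous_intros) (simp add: s_def)
    show "continuous_on (ball 0 s \<inter> {w. Im w \<le> 0}) (\<lambda>w. cnj (Q (cnj w)))"
      by (intro continuous_intros continuous_on_compose2[OF Q(1)]) (auto simp: s_def)
    show "P w - (P 0 - cnj (Q 0)) = cnj (Q (cnj w))"
      if "w \<in> ball 0 s \<inter> {w. 0 \<le> Im w} \<and> \<not> 0 \<le> Im w \<or> w \<in> ball 0 s \<inter> {w. Im w \<le> 0} \<and> 0 \<le> Im w" for w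
    proof -
      have w: "w \<in> ball 0 s" "Im w = 0" using that by auto
      have "cnj w = w" using w by (simp add: complex_eq_iff)
      thus ?thesis using const[OF w] by (simp add: algebra_simps)
    qed
  qed
  have un: "(ball 0 s \<inter> {w. 0 \<le> Im w}) \<union> (ball 0 s \<inter> {w. Im w \<le> 0}) = ball 0 s" by force
  have J1: "(J has_field_derivative F1 w) (at w)" if "w \<in> ball 0 s" "Im w > 0" for w
  proof -
    have "((\<lambda>w. P w - (P 0 - cnj (Q 0))) has_field_derivative F1 w - 0) (at w)"
      using that s by (intro DERIV_diff P(2) DERIV_const) auto
    hence "((\<lambda>w. P w - (P 0 - cnj (Q 0))) has_field_derivative F1 w) (at w)"
      by simp
    thus ?thesis
      by (rule has_field_derivative_transform_within_open[where S="{w. Im w > 0}"])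
        (use that in \<open>auto simp: J_def open_halfspace_Im_gt\<close>)
  qed
  have J2: "(J has_field_derivative F2 w) (at w)" if "w \<in> ball 0 s" "Im w < 0" for w
  proof -
    have "(Q has_field_derivative cnj (F2 (cnj (cnj w)))) (at (cnj w))"
      using that s by (intro Q(2)) auto
    hence "((cnj \<circ> Q \<circ> cnj) has_field_derivative F2 w) (at w)"
      using has_field_derivative_cnj_cnj[of Q "cnj (F2 w)" w] by simp
    thus ?thesis
      by (rule has_field_derivative_transform_within_open[where S="{w. Im w < 0}"])
        (use that in \<open>auto simp: J_def open_halfspace_Im_lt\<close>)
  qed
  have "J holomorphic_on ball 0 s"
  proof (rule holomorphic_on_paste_across_line[where d="\<i>" and k=0])
    show "J holomorphic_on ball 0 s \<inter> {z. \<i> \<bullet> z < 0}"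
      by (rule holomorphic_onI) (use J2 in \<open>auto simp: field_differentiable_def intro: has_field_derivative_at_within\<close>)
    show "J holomorphic_on ball 0 s \<inter> {z. 0 < \<i> \<bullet> z}"
      by (rule holomorphic_onI) (use J1 in \<open>auto simp: field_differentiable_def intro: has_field_derivative_at_within\<close>)
  qed (use contJ un in auto)
  hence "deriv J holomorphic_on ball 0 s" by (intro holomorphic_deriv) auto
  moreover have "\<forall>w\<in>ball 0 s. Im w > 0 \<longrightarrow> deriv J w = F1 w" "\<forall>w\<in>ball 0 s. Im w < 0 \<longrightarrow> deriv J w = F2 w"
    using J1 J2 by (auto intro: DERIV_imp_deriv)
  moreover have "s \<le> r" using s r1 r by simp
  ultimately show ?thesis using s(1) by blast
qed

subsection \<open>Boundary charts of the double\<close>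

lemma double_chart_shrink:
  "double_chart U G r p \<Longrightarrow> 0 < s \<Longrightarrow> s \<le> r \<Longrightarrow> double_chart U G s p"
  unfolding double_chart_def
  by (auto intro: holomorphic_on_subset inj_on_subset simp: subset_ball)

lemma double_chart_frontier_iff:
  assumes "open U" "double_chart U G r p" "w \<in> ball 0 r"
  shows "G w \<in> frontier U \<longleftrightarrow> Im w = 0" "G w \<in> U \<longleftrightarrow> Im w > 0"
proof -
  have fr: "frontier U = closure U - U" using assms(1) by (simp add: frontier_def interior_open)
  consider "Im w > 0" | "Im w < 0" | "Im w = 0" by linarith
  hence "(G w \<in> frontier U \<longleftrightarrow> Im w = 0) \<and> (G w \<in> U \<longleftrightarrow> Im w > 0)"
    using assms(2,3) closure_subset[of U] by cases (auto simp: double_chart_def fr)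
  thus "G w \<in> frontier U \<longleftrightarrow> Im w = 0" "G w \<in> U \<longleftrightarrow> Im w > 0" by auto
qed

lemma connected_disjoint_frontier:
  assumes "connected S" "S \<inter> frontier U = {}" "z \<in> S" "z \<in> U" shows "S \<subseteq> U"
  using connected_Int_frontier[OF assms(1), of U] assms by blast

text \<open>Close to 0 the chart differs from its linear part by a map with Lipschitz constant
  \<open>c\<close>, half of \<open>cmod (deriv G 0)\<close>, so it distorts distances by factors
  between \<open>c\<close> and \<open>3 * c\<close>. As the frontier near \<open>p\<close> is the
  image of the diameter, \<open>G w\<close> has distance at least
  \<open>c * \<bar>Im w\<bar>\<close> from it. The witness \<open>6 * c\<close> for \<open>L\<close>
  is \<open>3 * c\<close> times \<open>cmod (w - cnj w) = 2 * Im w\<close>.\<close>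

lemma double_chart_geometry:
  assumes U: "open U" and ch: "double_chart U G r p"
  shows "\<exists>s c L. 0 < s \<and> s \<le> r \<and> 0 < c \<and> 0 < L \<and>
    (\<forall>w\<in>ball 0 s. Im w > 0 \<longrightarrow> ball (G w) (c * Im w) \<subseteq> U \<and>
       ball (G (cnj w)) (c * Im w) \<inter> U = {} \<and> cmod (G w - G (cnj w)) \<le> L * Im w)"
proof -
  have r: "r > 0" and hol: "G holomorphic_on ball 0 r" and inj: "inj_on G (ball 0 r)" and G0: "G 0 = p"
    using ch by (auto simp: double_chart_def)
  define d where "d = deriv G 0"
  have d: "d \<noteq> 0"
    unfolding d_def using holomorphic_injective_imp_regular[OF hol _ inj, of 0] r by auto
  define c where "c = cmod d / 2"
  have c: "c > 0" using d by (simp add: c_def)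
  have "deriv G holomorphic_on ball 0 r" using hol by (intro holomorphic_deriv) auto
  hence "isCont (deriv G) 0"
    using r holomorphic_on_imp_continuous_on continuous_on_eq_continuous_at[of "ball 0 r" "deriv G"] by auto
  hence "\<exists>s0>0. \<forall>w. cmod (w - 0) < s0 \<longrightarrow> cmod (deriv G w - deriv G 0) < c"
    using c by (simp only: continuous_at_eps_delta dist_norm)
  then obtain s0 where s0: "s0 > 0" "\<And>w. cmod w < s0 \<Longrightarrow> cmod (deriv G w - d) < c"
    by (auto simp: d_def)
  define s1 where "s1 = min s0 r"
  have s1: "s1 > 0" "s1 \<le> r" "s1 \<le> s0" using s0 r by (auto simp: s1_def)
  have err: "cmod ((G w - d * w) - (G w' - d * w')) \<le> c * cmod (w - w')" if "w \<in> ball 0 s1" "w' \<in> ball 0 s1" for w w'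
  proof (rule field_differentiable_bound[where f'="\<lambda>z. deriv G z - d"])
    fix z :: complex assume z: "z \<in> ball 0 s1"
    hence "(G has_field_derivative deriv G z) (at z)"
      using s1 hol by (intro holomorphic_derivI[of G "ball 0 r"]) auto
    hence "((\<lambda>w. G w - d * w) has_field_derivative deriv G z - d * 1) (at z)"
      by (intro DERIV_diff DERIV_cmult DERIV_ident)
    thus "((\<lambda>w. G w - d * w) has_field_derivative deriv G z - d) (at z within ball 0 s1)"
      by (simp add: has_field_derivative_at_within)
    have "cmod z < s0" using z s1 by simp
    thus "cmod (deriv G z - d) \<le> c" by (intro less_imp_le s0(2))
  qed (fact convex_ball that)+
  have lower: "c * cmod (w - w') \<le> cmod (G w - G w')" and upper: "cmod (G w - G w') \<le> 3 * c * cmod (w - w')"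
    if "w \<in> ball 0 s1" "w' \<in> ball 0 s1" for w w'
  proof -
    have eq: "(G w - d * w) - (G w' - d * w') = (G w - G w') - d * (w - w')" by (simp add: algebra_simps)
    have dn: "cmod (d * (w - w')) = 2 * c * cmod (w - w')" by (simp add: norm_mult c_def)
    show "c * cmod (w - w') \<le> cmod (G w - G w')"
      using err[OF that, unfolded eq] dn norm_triangle_ineq2[of "d * (w - w')" "G w - G w'"]
      by (simp add: norm_minus_commute)
    show "cmod (G w - G w') \<le> 3 * c * cmod (w - w')"
      using err[OF that, unfolded eq] dn norm_triangle_ineq2[of "G w - G w'" "d * (w - w')"] by simp
  qed
  have "open (G ` ball 0 s1)"
    by (rule open_mapping_thm3) (use hol inj s1 in \<open>auto elim!: holomorphic_on_subset inj_on_subset simp: subset_ball\<close>)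
  moreover have "p \<in> G ` ball 0 s1" using G0 s1 by force
  ultimately obtain \<delta> where \<delta>: "\<delta> > 0" "ball p \<delta> \<subseteq> G ` ball 0 s1"
    using openE by blast
  \<comment> \<open>A frontier point within \<open>c * \<bar>Im w\<bar>\<close> of
    \<open>G w\<close> is within \<open>c * cmod w + 3 * c * cmod w\<close> of \<open>p\<close>, so
    \<open>4 * c * s \<le> \<delta>\<close> puts it into the part of the plane that the chart
    covers.\<close>
  define s where "s = min s1 (\<delta> / (4 * c))"
  have s: "s > 0" "s \<le> s1" "s \<le> \<delta> / (4 * c)" using s1 \<delta> c by (auto simp: s_def)
  hence s4: "4 * c * s \<le> \<delta>" using c by (simp add: field_simps)
  have disj: "ball (G w) (c * \<bar>Im w\<bar>) \<inter> frontier U = {}" if w: "w \<in> ball 0 s" for w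
  proof (rule ccontr)
    assume "\<not> ?thesis"
    then obtain q where q: "q \<in> frontier U" "cmod (G w - q) < c * \<bar>Im w\<bar>" by (auto simp: dist_norm)
    have "cmod (q - p) \<le> cmod (G w - q) + cmod (G w - G 0)"
      using norm_triangle_ineq4[of "G w - G 0" "G w - q"] by (simp add: G0)
    also have "\<dots> \<le> c * \<bar>Im w\<bar> + 3 * c * cmod (w - 0)"
      using q upper[of w 0] w s s1 by (intro add_mono) auto
    also have "\<dots> \<le> 4 * c * cmod w" using abs_Im_le_cmod[of w] c by simp
    also have "\<dots> < 4 * c * s" using w c by simp
    finally have "q \<in> ball p \<delta>" using s4 by (simp add: dist_norm norm_minus_commute)
    then obtain t where t: "t \<in> ball 0 s1" "q = G t" using \<delta>(2) by blast
    hence "Im t = 0" using double_chart_frontier_iff(1)[OF U ch, of t] q s1 by auto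
    hence "\<bar>Im w\<bar> \<le> cmod (w - t)" using abs_Im_le_cmod[of "w - t"] by simp
    hence "c * \<bar>Im w\<bar> \<le> c * cmod (w - t)" using c by simp
    also have "\<dots> \<le> cmod (G w - q)" unfolding t using lower[of w t] t w s by auto
    finally show False using q by simp
  qed
  have "ball (G w) (c * Im w) \<subseteq> U \<and> ball (G (cnj w)) (c * Im w) \<inter> U = {} \<and> cmod (G w - G (cnj w)) \<le> 6 * c * Im w"
    if w: "w \<in> ball 0 s" "Im w > 0" for w
  proof (intro conjI)
    have wr: "w \<in> ball 0 r" "cnj w \<in> ball 0 r" "w \<in> ball 0 s1" "cnj w \<in> ball 0 s1" "cnj w \<in> ball 0 s" using w s s1 by auto
    have "G w \<in> U" "G (cnj w) \<notin> U"
      using double_chart_frontier_iff(2)[OF U ch wr(1)] double_chart_frontier_iff(2)[OF U ch wr(2)] w by auto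
    show "ball (G w) (c * Im w) \<subseteq> U"
      by (rule connected_disjoint_frontier[of _ _ "G w"]) (use disj[OF w(1)] w c \<open>G w \<in> U\<close> in auto)
    show "ball (G (cnj w)) (c * Im w) \<inter> U = {}"
    proof (rule ccontr)
      assume "\<not> ?thesis"
      then obtain z where "z \<in> ball (G (cnj w)) (c * Im w)" "z \<in> U" by blast
      hence "ball (G (cnj w)) (c * Im w) \<subseteq> U"
        using disj[OF wr(5)] w by (intro connected_disjoint_frontier[of _ _ z]) auto
      moreover have "G (cnj w) \<in> ball (G (cnj w)) (c * Im w)" using w c by simp
      ultimately show False using \<open>G (cnj w) \<notin> U\<close> by blast
    qed
    have "w - cnj w = \<i> * of_real (2 * Im w)" by (simp add: complex_eq_iff)
    hence "cmod (w - cnj w) = 2 * Im w" using w by (simp add: norm_mult)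
    thus "cmod (G w - G (cnj w)) \<le> 6 * c * Im w" using upper[OF wr(3,4)] by simp
  qed
  moreover have "s \<le> r" using s s1 by simp
  ultimately show ?thesis using s(1) c
    by (intro exI[of _ s] exI[of _ c] exI[of _ "6 * c"]) auto
qed

text \<open>The analytic parametrisation, moved to the parameter of \<open>p\<close>, is itself the
  chart. The rest of the curve is a compact arc \<open>T\<close> which misses \<open>p\<close> by
  simplicity, so it can be cut off by shrinking the chart later.\<close>

lemma analytic_jordan_curve_local:
  assumes ajc: "analytic_jordan_curve g" and p: "p \<in> path_image g"
  shows "\<exists>G \<rho> T. \<rho> > 0 \<and> G holomorphic_on ball 0 \<rho> \<and> inj_on G (ball 0 \<rho>) \<and> G 0 = p \<and>
    compact T \<and> p \<notin> T \<and> path_image g \<subseteq> T \<union> G ` {w \<in> ball 0 \<rho>. Im w = 0} \<and>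
    G ` {w \<in> ball 0 \<rho>. Im w = 0} \<subseteq> path_image g"
proof -
  obtain V Gh where per: "\<And>t. g (t + 1) = g t" and sp: "simple_path g"
    and V: "open V" "range complex_of_real \<subseteq> V" and hol: "Gh holomorphic_on V"
    and Gh: "\<And>t. Gh (complex_of_real t) = g t" "\<And>t. deriv Gh (complex_of_real t) \<noteq> 0"
    using ajc unfolding analytic_jordan_curve_def by blast
  obtain t0 where t0: "0 \<le> t0" "t0 \<le> 1" "g t0 = p" using p by (auto simp: path_image_def)
  have "complex_of_real t0 \<in> V" using V by auto
  then obtain \<rho>0 where \<rho>0: "\<rho>0 > 0" "ball (complex_of_real t0) \<rho>0 \<subseteq> V" "inj_on Gh (ball (complex_of_real t0) \<rho>0)"
    using has_complex_derivative_locally_injective[OF hol _ V(1) Gh(2)] by blast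
  \<comment> \<open>With \<open>\<rho> \<le> 1/2\<close> the parameter window
    \<open>t0 - \<rho> .. t0 + \<rho>\<close> is no longer than one period, and the interval that
    defines \<open>T\<close> is not empty.\<close>
  define \<rho> where "\<rho> = min \<rho>0 (1/2)"
  have \<rho>: "\<rho> > 0" "\<rho> \<le> \<rho>0" "\<rho> \<le> 1/2" using \<rho>0 by (auto simp: \<rho>_def)
  define G where "G w = Gh (complex_of_real t0 + w)" for w
  have sub: "(\<lambda>w. complex_of_real t0 + w) ` ball 0 \<rho> \<subseteq> ball (complex_of_real t0) \<rho>0"
    using \<rho> by (auto simp: dist_norm)
  have 1: "G holomorphic_on ball 0 \<rho>"
    unfolding G_def using sub \<rho>0(2)
    by (intro holomorphic_on_compose_gen[OF _ hol, unfolded o_def]) (auto intro!: holomorphic_intros)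
  have 2: "inj_on G (ball 0 \<rho>)"
  proof (rule inj_onI)
    fix w w' :: complex assume w: "w \<in> ball 0 \<rho>" "w' \<in> ball 0 \<rho>" "G w = G w'"
    have "complex_of_real t0 + w \<in> ball (complex_of_real t0) \<rho>0" "complex_of_real t0 + w' \<in> ball (complex_of_real t0) \<rho>0"
      using w \<rho> by (auto simp: dist_norm)
    thus "w = w'" using inj_onD[OF \<rho>0(3) w(3)[unfolded G_def]] by simp
  qed
  define T where "T = g ` {t0 + \<rho>..t0 + 1 - \<rho>}"
  have contg: "continuous_on UNIV g"
  proof -
    have "continuous_on UNIV (\<lambda>t. Gh (complex_of_real t))"
      by (rule continuous_on_compose2[OF holomorphic_on_imp_continuous_on[OF hol]]) (use V in \<open>auto intro!: continuous_intros\<close>)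
    thus ?thesis by (simp add: Gh)
  qed
  have 3: "compact T" unfolding T_def
    by (intro compact_continuous_image continuous_on_subset[OF contg]) auto
  have lf: "\<And>x y. x \<in> {0..1} \<Longrightarrow> y \<in> {0..1} \<Longrightarrow> g x = g y \<Longrightarrow> x = y \<or> x = 0 \<and> y = 1 \<or> x = 1 \<and> y = 0"
    using sp unfolding simple_path_def loop_free_def by blast
  have per': "g (t - 1) = g t" for t using per[of "t - 1"] by simp
  have 4: "p \<notin> T"
  proof
    assume "p \<in> T"
    then obtain t where t: "t0 + \<rho> \<le> t" "t \<le> t0 + 1 - \<rho>" "g t = g t0" using t0 by (auto simp: T_def)
    show False
    proof (cases "t \<le> 1")
      case True
      thus False using lf[of t t0] t t0 \<rho> by auto
    next
      case False
      thus False using lf[of "t - 1" t0] t t0 \<rho> per'[of t] by auto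
    qed
  qed
  have 5: "path_image g \<subseteq> T \<union> G ` {w \<in> ball 0 \<rho>. Im w = 0}"
  proof
    fix q assume "q \<in> path_image g"
    then obtain s where s: "0 \<le> s" "s \<le> 1" "q = g s" by (auto simp: path_image_def)
    \<comment> \<open>Every parameter is moved by a period into a half-open window of length 1. Its
      part below \<open>t0 + \<rho>\<close> is seen by the chart, the rest belongs to
      \<open>T\<close>.\<close>
    obtain u where u: "t0 - \<rho> < u" "u \<le> t0 + 1 - \<rho>" "g u = g s"
    proof -
      consider "s \<le> t0 - \<rho>" | "t0 - \<rho> < s" "s \<le> t0 + 1 - \<rho>" | "s > t0 + 1 - \<rho>" by linarith
      thus ?thesis
      proof cases
        case 1 thus ?thesis using that[of "s + 1"] s t0 \<rho> per[of s] by auto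
      next
        case 2 thus ?thesis using that[of s] by auto
      next
        case 3 thus ?thesis using that[of "s - 1"] s t0 \<rho> per'[of s] by auto
      qed
    qed
    show "q \<in> T \<union> G ` {w \<in> ball 0 \<rho>. Im w = 0}"
    proof (cases "u < t0 + \<rho>")
      case True
      have "q = G (complex_of_real (u - t0))" using u s by (simp add: G_def Gh)
      moreover have "complex_of_real (u - t0) \<in> {w \<in> ball 0 \<rho>. Im w = 0}"
        using u True by (auto simp del: of_real_diff)
      ultimately show ?thesis by blast
    next
      case False
      hence "g u \<in> T" using u unfolding T_def by (intro imageI) simp
      thus ?thesis using u s by simp
    qed
  qed
  have 6: "G ` {w \<in> ball 0 \<rho>. Im w = 0} \<subseteq> path_image g"
  proof safe
    fix w :: complex assume w: "w \<in> ball 0 \<rho>" "Im w = 0"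
    define u where "u = t0 + Re w"
    have "complex_of_real t0 + w = complex_of_real u" using w by (simp add: complex_eq_iff u_def)
    hence G: "G w = g u" by (simp add: G_def Gh)
    have u: "-1/2 < u" "u < 3/2" using abs_Re_le_cmod[of w] w t0 \<rho> by (auto simp: u_def)
    consider "u < 0" | "0 \<le> u" "u \<le> 1" | "u > 1" by linarith
    thus "G w \<in> path_image g"
    proof cases
      case 1 thus ?thesis using u per[of u] unfolding G path_image_def by (intro image_eqI[of _ _ "u + 1"]) auto
    next
      case 2 thus ?thesis unfolding G path_image_def by auto
    next
      case 3 thus ?thesis using u per'[of u] unfolding G path_image_def by (intro image_eqI[of _ _ "u - 1"]) auto
    qed
  qed
  show ?thesis
    using \<rho>(1) 1 2 3 4 5 6 t0(3) Gh(1) by (intro exI[of _ G] exI[of _ \<rho>] exI[of _ T]) (auto simp: G_def)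
qed

text \<open>Once the frontier near \<open>p\<close> is exactly the diameter, connectedness puts each
  open half-disc either into \<open>U\<close> or off its closure. At least one lies in
  \<open>U\<close> since \<open>p\<close> is in the closure of \<open>U\<close>, and the Jordan
  curve theorem excludes both. If it is the lower one, \<open>w\<close> is replaced by
  \<open>- w\<close>.\<close>

lemma analytic_boundary_double_chart:
  assumes U: "analytic_n_bordered U n" and p: "p \<in> frontier U"
  shows "\<exists>G r. double_chart U G r p"
proof -
  have oU: "open U" and cU: "connected U" using U by (simp_all add: analytic_n_bordered_def)
  obtain \<gamma> where \<gamma>: "\<forall>i<n. analytic_jordan_curve (\<gamma> i)"
     "\<forall>i<n. \<forall>j<n. i \<noteq> j \<longrightarrow> path_image (\<gamma> i) \<inter> path_image (\<gamma> j) = {}"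
     and fr: "frontier U = (\<Union>i<n. path_image (\<gamma> i))"
    using U unfolding analytic_n_bordered_def by (elim conjE exE)
  have ajc: "\<And>i. i < n \<Longrightarrow> analytic_jordan_curve (\<gamma> i)"
    and disj: "\<And>i j. i < n \<Longrightarrow> j < n \<Longrightarrow> i \<noteq> j \<Longrightarrow> path_image (\<gamma> i) \<inter> path_image (\<gamma> j) = {}"
    using \<gamma> by simp_all
  obtain i where i: "i < n" "p \<in> path_image (\<gamma> i)" using p fr by auto
  let ?\<Gamma> = "path_image (\<gamma> i)"
  have simple: "simple_path (\<gamma> j)" if "j < n" for j
    using ajc[OF that] by (simp add: analytic_jordan_curve_def)
  obtain G \<rho> T where \<rho>: "\<rho> > 0" and hol: "G holomorphic_on ball 0 \<rho>" and inj: "inj_on G (ball 0 \<rho>)"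
    and G0: "G 0 = p" and T: "compact T" "p \<notin> T" "?\<Gamma> \<subseteq> T \<union> G ` {w \<in> ball 0 \<rho>. Im w = 0}"
    and G\<Gamma>: "G ` {w \<in> ball 0 \<rho>. Im w = 0} \<subseteq> ?\<Gamma>"
    using analytic_jordan_curve_local[OF ajc[OF i(1)] i(2)] by blast
  \<comment> \<open>Staying in \<open>W\<close> excludes the other boundary curves and the remaining
    arc of this one.\<close>
  define W where "W = - (T \<union> (\<Union>j\<in>{..<n} - {i}. path_image (\<gamma> j)))"
  have "closed (T \<union> (\<Union>j\<in>{..<n} - {i}. path_image (\<gamma> j)))"
    using T(1) simple by (intro closed_Un closed_UN compact_imp_closed ballI closed_simple_path_image) auto
  hence oW: "open W" unfolding W_def by (rule open_Compl)
  have pW: "p \<in> W" using T(2) disj[OF i(1)] i unfolding W_def by blast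
  have "open (ball 0 \<rho> \<inter> G -` W)"
    by (rule continuous_open_preimage[OF holomorphic_on_imp_continuous_on[OF hol] _ oW]) auto
  moreover have "0 \<in> ball 0 \<rho> \<inter> G -` W" using pW G0 \<rho> by simp
  ultimately obtain r where r: "r > 0" "ball 0 r \<subseteq> ball 0 \<rho> \<inter> G -` W" using openE by blast
  have holr: "G holomorphic_on ball 0 r" and injr: "inj_on G (ball 0 r)"
    using r hol inj by (auto elim!: holomorphic_on_subset inj_on_subset)
  have frG: "G w \<in> frontier U \<longleftrightarrow> Im w = 0" if w: "w \<in> ball 0 r" for w
  proof
    assume "Im w = 0"
    hence "G w \<in> ?\<Gamma>" using G\<Gamma> w r by blast
    thus "G w \<in> frontier U" using fr i by auto
  next
    assume "G w \<in> frontier U"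
    moreover have "G w \<in> W" using w r by auto
    ultimately have "G w \<in> ?\<Gamma>" "G w \<notin> T" using fr by (auto simp: W_def)
    then obtain u where u: "u \<in> ball 0 \<rho>" "Im u = 0" "G w = G u" using T(3) by blast
    have "w \<in> ball 0 \<rho>" using w r by blast
    hence "w = u" using inj_onD[OF inj u(3) _ u(1)] by simp
    thus "Im w = 0" using u by simp
  qed
  let ?H1 = "ball 0 r \<inter> {w. Im w > 0}" and ?H2 = "ball 0 r \<inter> {w. Im w < 0}"
  have conv: "convex ?H1" "convex ?H2"
    by (auto intro!: convex_Int convex_halfspace_Im_gt convex_halfspace_Im_lt)
  have alt: "G ` H \<subseteq> U \<or> G ` H \<inter> closure U = {}" if H: "H = ?H1 \<or> H = ?H2" for H
  proof -
    have "connected (G ` H)"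
      using H conv holr by (intro connected_continuous_image holomorphic_on_imp_continuous_on)
        (auto intro: convex_connected elim!: holomorphic_on_subset)
    moreover have d: "G ` H \<inter> frontier U = {}" using H frG by auto
    ultimately have "G ` H \<subseteq> U \<or> G ` H \<inter> U = {}"
      using connected_disjoint_frontier by blast
    moreover have "closure U = U \<union> frontier U" by (rule closure_Un_frontier)
    ultimately show ?thesis using d by auto
  qed
  have oG: "open (G ` ball 0 r)" by (rule open_mapping_thm3[OF holr _ injr]) auto
  have pG: "p \<in> G ` ball 0 r" using G0 r by force
  have splitb: "w \<in> ?H1 \<or> w \<in> ?H2 \<or> Im w = 0" if "w \<in> ball 0 r" for w using that by auto
  have one: "G ` ?H1 \<subseteq> U \<or> G ` ?H2 \<subseteq> U"
  proof -
    have "p \<in> closure U" using p by (simp add: frontier_def)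
    then obtain z where z: "z \<in> G ` ball 0 r" "z \<in> U"
      using open_Int_closure_eq_empty[OF oG, of U] pG by blast
    then obtain w where w: "w \<in> ball 0 r" "z = G w" by blast
    have "z \<notin> frontier U" using z oU by (simp add: frontier_def interior_open)
    hence "w \<in> ?H1 \<or> w \<in> ?H2" using splitb frG w by blast
    thus ?thesis using alt[of ?H1] alt[of ?H2] z w closure_subset[of U] by blast
  qed
  \<comment> \<open>\<open>U\<close> is connected and avoids the curve, so one of the two Jordan
    components misses \<open>U\<close>. That component still accumulates at \<open>p\<close>, hence
    meets the chart, where every point would lie in \<open>U\<close> or on the curve.\<close>
  have not_both: "\<not> (G ` ?H1 \<subseteq> U \<and> G ` ?H2 \<subseteq> U)"
  proof
    assume both: "G ` ?H1 \<subseteq> U \<and> G ` ?H2 \<subseteq> U"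
    have "pathfinish (\<gamma> i) = pathstart (\<gamma> i)"
      using ajc[OF i(1)] unfolding analytic_jordan_curve_def pathfinish_def pathstart_def by (metis add_0)
    note J = Jordan_inside_outside[OF simple[OF i(1)] this]
    have U\<Gamma>: "U \<inter> ?\<Gamma> = {}" using fr i oU by (auto simp: frontier_def interior_open)
    hence "U \<subseteq> inside ?\<Gamma> \<union> outside ?\<Gamma>" using J by blast
    hence "inside ?\<Gamma> \<inter> U = {} \<or> outside ?\<Gamma> \<inter> U = {}"
      using connectedD[OF cU, of "inside ?\<Gamma>" "outside ?\<Gamma>"] J by blast
    then obtain X where X: "X \<inter> U = {}" "frontier X = ?\<Gamma>" "X \<inter> ?\<Gamma> = {}"
      using J inside_no_overlap[of ?\<Gamma>] outside_no_overlap[of ?\<Gamma>] by (elim disjE) blast+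
    have "p \<in> frontier X" using X(2) i by simp
    hence "p \<in> closure X" by (simp add: frontier_def)
    then obtain z where z: "z \<in> G ` ball 0 r" "z \<in> X"
      using open_Int_closure_eq_empty[OF oG, of X] pG by blast
    then obtain w where w: "w \<in> ball 0 r" "z = G w" by blast
    show False
    proof (cases "Im w = 0")
      case True
      hence "z \<in> ?\<Gamma>" using G\<Gamma> w r by blast
      thus False using X z by blast
    next
      case False
      hence "z \<in> U" using splitb[OF w(1)] both w by blast
      thus False using X z by blast
    qed
  qed
  show ?thesis
  proof (cases "G ` ?H1 \<subseteq> U")
    case True
    hence "G ` ?H2 \<inter> closure U = {}" using not_both alt[of ?H2] by blast
    with True have "double_chart U G r p"
      unfolding double_chart_def using r holr injr G0 frG by blast
    thus ?thesis by blast
  next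
    case False
    hence 2: "G ` ?H2 \<subseteq> U" "G ` ?H1 \<inter> closure U = {}" using one alt[of ?H1] by auto
    have "double_chart U (\<lambda>w. G (- w)) r p"
      unfolding double_chart_def
    proof (intro conjI ballI impI)
      show "(\<lambda>w. G (- w)) holomorphic_on ball 0 r"
        by (rule holomorphic_on_compose_gen[OF _ holr, unfolded o_def]) (auto intro!: holomorphic_intros)
      show "inj_on (\<lambda>w. G (- w)) (ball 0 r)"
      proof (rule inj_onI)
        fix w w' :: complex assume "w \<in> ball 0 r" "w' \<in> ball 0 r" "G (- w) = G (- w')"
        thus "w = w'" using inj_onD[OF injr, of "- w" "- w'"] by simp
      qed
      fix w :: complex assume w: "w \<in> ball 0 r"
      hence mw: "- w \<in> ball 0 r" by simp
      show "G (- w) \<in> U" if "Im w > 0" using 2 mw that by auto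
      show "G (- w) \<notin> closure U" if "Im w < 0"
      proof -
        have "- w \<in> ?H1" using mw that by simp
        thus ?thesis using 2(2) by blast
      qed
      show "G (- w) \<in> frontier U" if "Im w = 0" using frG[OF mw] that by simp
    qed (use r G0 in auto)
    thus ?thesis by blast
  qed
qed

subsection \<open>Pulling back the quadrature identity\<close>

text \<open>The point is that the coefficients \<open>A i\<close> do not depend on
  \<open>\<zeta>\<close>: evaluated at a node, each derivative in the quadrature formula is a
  polynomial in \<open>1 / (f z - \<zeta>)\<close>, so it is rational in \<open>\<zeta>\<close> with
  its only pole at the image of the node.\<close>

lemma higher_deriv_cauchy_kernel:
  assumes S: "open S" and f: "f holomorphic_on S"
  shows "\<exists>A. (\<forall>i. A i holomorphic_on S) \<and> (\<forall>\<zeta> z. \<zeta> \<notin> f ` S \<longrightarrow> z \<in> S \<longrightarrow>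
    (deriv ^^ k) (\<lambda>z. deriv f z / (f z - \<zeta>)) z = (\<Sum>i\<le>k. A i z * inverse (f z - \<zeta>) ^ Suc i))"
proof (induction k)
  case 0
  show ?case using f S by (intro exI[of _ "\<lambda>_. deriv f"]) (auto simp: divide_inverse intro: holomorphic_deriv)
next
  case (Suc k)
  then obtain A where A: "\<And>i. A i holomorphic_on S" and eq: "\<And>\<zeta> z. \<zeta> \<notin> f ` S \<Longrightarrow> z \<in> S \<Longrightarrow>
    (deriv ^^ k) (\<lambda>z. deriv f z / (f z - \<zeta>)) z = (\<Sum>i\<le>k. A i z * inverse (f z - \<zeta>) ^ Suc i)" by blast
  \<comment> \<open>Differentiating \<open>A i * u ^ Suc i\<close>, where
    \<open>u = inverse (f z - \<zeta>)\<close>, keeps the power of \<open>u\<close> in one term and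
    raises it in the other. The two conditionals are the ends of the index shift.\<close>
  define B where "B i z = (if i \<le> k then deriv (A i) z else 0) - (if i = 0 then 0 else of_nat i * A (i - 1) z * deriv f z)" for i z
  have "B i holomorphic_on S" for i
    unfolding B_def by (cases "i \<le> k"; cases "i = 0") (auto intro!: holomorphic_intros A f S holomorphic_deriv)
  moreover have "(deriv ^^ Suc k) (\<lambda>z. deriv f z / (f z - \<zeta>)) z = (\<Sum>i\<le>Suc k. B i z * inverse (f z - \<zeta>) ^ Suc i)"
    if \<zeta>: "\<zeta> \<notin> f ` S" and z: "z \<in> S" for \<zeta> z
  proof -
    define u where "u = inverse (f z - \<zeta>)"
    have nz: "f z - \<zeta> \<noteq> 0" using \<zeta> z by auto
    have dA: "(A i has_field_derivative deriv (A i) z) (at z)" for i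
      using A S z by (intro holomorphic_derivI) auto
    have df: "(f has_field_derivative deriv f z) (at z)" using f S z by (intro holomorphic_derivI) auto
    have du: "((\<lambda>z. inverse (f z - \<zeta>)) has_field_derivative - (deriv f z * u\<^sup>2)) (at z)"
      using nz by (auto intro!: derivative_eq_intros df simp: u_def power2_eq_square)
    have "((\<lambda>z. \<Sum>i\<le>k. A i z * inverse (f z - \<zeta>) ^ Suc i) has_field_derivative
        (\<Sum>i\<le>k. deriv (A i) z * u ^ Suc i - of_nat (Suc i) * A i z * deriv f z * u ^ Suc (Suc i))) (at z)"
    proof (rule DERIV_sum)
      fix i
      show "((\<lambda>z. A i z * inverse (f z - \<zeta>) ^ Suc i) has_field_derivative
        deriv (A i) z * u ^ Suc i - of_nat (Suc i) * A i z * deriv f z * u ^ Suc (Suc i)) (at z)"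
        by (rule DERIV_cong[OF DERIV_mult[OF dA DERIV_power[OF du]]])
          (simp only: u_def[symmetric], simp add: algebra_simps power2_eq_square)
    qed
    hence "((deriv ^^ k) (\<lambda>z. deriv f z / (f z - \<zeta>)) has_field_derivative
        (\<Sum>i\<le>k. deriv (A i) z * u ^ Suc i - of_nat (Suc i) * A i z * deriv f z * u ^ Suc (Suc i))) (at z)"
      by (rule has_field_derivative_transform_within_open[OF _ S z]) (simp add: eq[OF \<zeta>])
    hence "(deriv ^^ Suc k) (\<lambda>z. deriv f z / (f z - \<zeta>)) z =
        (\<Sum>i\<le>k. deriv (A i) z * u ^ Suc i) - (\<Sum>i\<le>k. of_nat (Suc i) * A i z * deriv f z * u ^ Suc (Suc i))"
      by (simp add: DERIV_imp_deriv sum_subtractf)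
    also have "(\<Sum>i\<le>k. deriv (A i) z * u ^ Suc i) = (\<Sum>i\<le>Suc k. (if i \<le> k then deriv (A i) z else 0) * u ^ Suc i)"
      by simp
    also have "(\<Sum>i\<le>k. of_nat (Suc i) * A i z * deriv f z * u ^ Suc (Suc i)) =
        (\<Sum>i\<le>Suc k. (if i = 0 then 0 else of_nat i * A (i - 1) z * deriv f z) * u ^ Suc i)"
      by (subst sum.atMost_Suc_shift) simp
    finally show ?thesis
      unfolding sum_subtractf[symmetric] left_diff_distrib[symmetric] B_def u_def .
  qed
  ultimately show ?case by blast
qed

text \<open>The test function on \<open>\<Omega>\<close> is
  \<open>\<Phi>' / (\<Phi> - \<zeta>)\<close>. Under the change of variables by
  \<open>\<phi>\<close> it gains the factor \<open>|\<phi>'|^2\<close>, and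
  \<open>\<Phi>' (\<phi> u) * \<phi>' u = 1\<close> leaves only
  \<open>cnj (\<phi>' u) / (u - \<zeta>)\<close>. The square of \<open>g\<close> integrates to the
  area of \<open>\<Omega>\<close>; integrability of \<open>g\<close> follows because
  \<open>U\<close> is bounded.\<close>

lemma quadrature_domain_pullback:
  assumes qd: "quadrature_domain \<Omega>" and area: "emeasure lborel \<Omega> < \<infinity>"
    and \<Phi>: "\<Phi> holomorphic_on \<Omega>" "inj_on \<Phi> \<Omega>" and U: "\<Phi> ` \<Omega> = U" "bounded U"
    and \<phi>: "\<phi> holomorphic_on U" "\<And>z. z \<in> \<Omega> \<Longrightarrow> \<phi> (\<Phi> z) = z"
  defines "g \<equiv> \<lambda>z. if z \<in> U then deriv \<phi> z else 0"
  shows "integrable lborel g" "integrable lborel (\<lambda>z. (cmod (g z))\<^sup>2)"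
    and "\<exists>R P. finite P \<and> P \<subseteq> U \<and> R meromorphic_on UNIV \<and> R holomorphic_on - P \<and>
      (\<forall>\<zeta>. \<zeta> \<notin> closure U \<longrightarrow> (LINT z|lborel. cnj (g z) * (1 / (z - \<zeta>))) = R \<zeta>)"
proof -
  have o\<Omega>: "open \<Omega>" using qd by (simp add: quadrature_domain_def)
  have oU: "open U" using open_mapping_thm3[OF \<Phi>(1) o\<Omega> \<Phi>(2)] U by simp
  have \<phi>U: "\<phi> ` U = \<Omega>" using \<phi>(2) U by (auto simp: image_iff)
  have \<Phi>\<phi>: "\<Phi> (\<phi> u) = u" if "u \<in> U" for u using that U \<phi>(2) by auto
  have \<phi>in: "\<phi> u \<in> \<Omega>" if "u \<in> U" for u using that \<phi>U by auto
  have inj\<phi>: "inj_on \<phi> U" by (rule inj_on_inverseI[of _ \<Phi>]) (rule \<Phi>\<phi>)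
  have dd: "deriv \<Phi> (\<phi> u) * deriv \<phi> u = 1" if u: "u \<in> U" for u
  proof -
    have "((\<Phi> \<circ> \<phi>) has_field_derivative deriv \<Phi> (\<phi> u) * deriv \<phi> u) (at u)"
      by (rule DERIV_chain; rule holomorphic_derivI) (use \<Phi>(1) o\<Omega> \<phi>in[OF u] \<phi>(1) oU u in auto)
    hence "((\<lambda>u. u) has_field_derivative deriv \<Phi> (\<phi> u) * deriv \<phi> u) (at u)"
      by (rule has_field_derivative_transform_within_open[OF _ oU u]) (simp add: \<Phi>\<phi>)
    thus ?thesis using DERIV_unique DERIV_ident by blast
  qed
  have gm: "g \<in> borel_measurable borel"
    unfolding g_def using \<phi>(1) oU by (intro borel_measurable_if_holomorphic holomorphic_deriv)
  have Ufin: "emeasure lborel U < \<infinity>"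
    using \<open>bounded U\<close> emeasure_bounded_finite by blast
  show g2: "integrable lborel (\<lambda>z. (cmod (g z))\<^sup>2)"
  proof -
    have "set_integrable lborel (\<phi> ` U) (\<lambda>_. 1 :: real)"
      unfolding set_integrable_def using area o\<Omega> \<phi>U by simp
    hence "set_integrable lborel U (\<lambda>z. (cmod (deriv \<phi> z))\<^sup>2 *\<^sub>R (1 :: real))"
      using set_integrable_holomorphic_image_iff[OF \<phi>(1) oU inj\<phi>, of "\<lambda>_. 1 :: real"] o\<Omega> \<phi>U by auto
    thus ?thesis
      unfolding set_integrable_def
      by (rule Bochner_Integration.integrable_cong[THEN iffD1, rotated -1]) (auto simp: g_def indicator_def)
  qed
  show g1: "integrable lborel g"
  proof (rule Bochner_Integration.integrable_bound)
    show "integrable lborel (\<lambda>z. indicator U z + (cmod (g z))\<^sup>2)"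
      using Ufin oU g2 by (intro Bochner_Integration.integrable_add) auto
    have "cmod (g z) \<le> indicator U z + (cmod (g z))\<^sup>2" for z
    proof -
      have "2 * cmod (g z) \<le> 1 + (cmod (g z))\<^sup>2"
        using zero_le_power2[of "cmod (g z) - 1"] by (simp add: power2_diff)
      moreover have "0 \<le> (cmod (g z))\<^sup>2" by simp
      ultimately show ?thesis by (auto simp: g_def indicator_def) (smt (verit) norm_ge_zero)
    qed
    thus "AE z in lborel. norm (g z) \<le> norm (indicator U z + (cmod (g z))\<^sup>2)"
      by (intro AE_I2) (auto intro: order_trans)
  qed (use gm in simp)
  obtain N w m c where w': "\<forall>j<N. w j \<in> \<Omega>"
    and quad': "\<forall>f. f holomorphic_on \<Omega> \<and> set_integrable lborel \<Omega> (\<lambda>z. (cmod (f z))\<^sup>2) \<longrightarrow>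
       (LINT z:\<Omega>|lborel. f z) = (\<Sum>j<(N::nat). \<Sum>k\<le>m j. c j k * (deriv ^^ k) f (w j))"
    using qd unfolding quadrature_domain_def by (elim conjE exE)
  have w: "w j \<in> \<Omega>" if "j < N" for j using w' that by simp
  have quad: "(LINT z:\<Omega>|lborel. f z) = (\<Sum>j<N. \<Sum>k\<le>m j. c j k * (deriv ^^ k) f (w j))"
    if "f holomorphic_on \<Omega>" "set_integrable lborel \<Omega> (\<lambda>z. (cmod (f z))\<^sup>2)" for f
    using quad' that by simp
  obtain A where A: "\<And>k \<zeta> z. \<zeta> \<notin> \<Phi> ` \<Omega> \<Longrightarrow> z \<in> \<Omega> \<Longrightarrow>
    (deriv ^^ k) (\<lambda>z. deriv \<Phi> z / (\<Phi> z - \<zeta>)) z = (\<Sum>i\<le>k. A k i z * inverse (\<Phi> z - \<zeta>) ^ Suc i)"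
    using higher_deriv_cauchy_kernel[OF o\<Omega> \<Phi>(1)] by metis
  define R where "R \<zeta> = (\<Sum>j<N. \<Sum>k\<le>m j. c j k * (\<Sum>i\<le>k. A k i (w j) * inverse (\<Phi> (w j) - \<zeta>) ^ Suc i))" for \<zeta>
  define P where "P = (\<lambda>j. \<Phi> (w j)) ` {..<N}"
  have "finite P" "P \<subseteq> U" using w U by (auto simp: P_def)
  moreover have "R meromorphic_on UNIV"
    unfolding R_def by (intro meromorphic_intros)
  moreover have "R holomorphic_on - P"
    unfolding R_def by (intro holomorphic_intros) (auto simp: P_def)
  moreover have "(LINT z|lborel. cnj (g z) * (1 / (z - \<zeta>))) = R \<zeta>" if \<zeta>: "\<zeta> \<notin> closure U" for \<zeta>
  proof -
    have "\<zeta> \<notin> U" using \<zeta> closure_subset[of U] by blast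
    hence \<zeta>U: "\<zeta> \<notin> \<Phi> ` \<Omega>" "\<zeta> \<notin> U" by (simp_all only: U(1) not_False_eq_True)
    let ?h = "\<lambda>z. deriv \<Phi> z / (\<Phi> z - \<zeta>)"
    have holh: "?h holomorphic_on \<Omega>"
      using \<zeta>U by (intro holomorphic_intros \<Phi>(1) holomorphic_deriv o\<Omega>) auto
    \<comment> \<open>The gap between \<open>\<zeta>\<close> and \<open>U\<close> bounds
      \<open>1 / (u - \<zeta>)\<close> on \<open>U\<close>. By the change of variables under
      \<open>\<Phi>\<close>, this makes the test function square integrable on
      \<open>\<Omega>\<close>.\<close>
    obtain \<delta> where \<delta>: "\<delta> > 0" "\<And>u. u \<in> U \<Longrightarrow> \<delta> \<le> dist \<zeta> u"
    proof -
      have "open (- closure U)" "\<zeta> \<in> - closure U" using \<zeta> by auto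
      then obtain e where e: "e > 0" "ball \<zeta> e \<subseteq> - closure U" using openE by blast
      have "e \<le> dist \<zeta> u" if "u \<in> U" for u
      proof (rule ccontr)
        assume "\<not> e \<le> dist \<zeta> u"
        hence "u \<in> ball \<zeta> e" by simp
        hence "u \<in> - closure U" using e(2) by blast
        thus False using that closure_subset[of U] by blast
      qed
      thus ?thesis using that e(1) by blast
    qed
    have [measurable]: "U \<in> sets borel" using oU by simp
    have mH: "(\<lambda>u. indicator U u *\<^sub>R (cmod (1 / (u - \<zeta>)))\<^sup>2) \<in> borel_measurable borel"
      by measurable
    have intH: "set_integrable lborel (\<Phi> ` \<Omega>) (\<lambda>u. (cmod (1 / (u - \<zeta>)))\<^sup>2)"
      unfolding set_integrable_def U(1)
    proof (rule Bochner_Integration.integrable_bound)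
      show "integrable lborel (\<lambda>u. (1 / \<delta>\<^sup>2) * indicator U u)" using Ufin oU by simp
      show "AE u in lborel. norm (indicator U u *\<^sub>R (cmod (1 / (u - \<zeta>)))\<^sup>2) \<le> norm (1 / \<delta>\<^sup>2 * indicator U u)"
      proof (rule AE_I2)
        fix u
        have "(cmod (1 / (u - \<zeta>)))\<^sup>2 \<le> 1 / \<delta>\<^sup>2" if "u \<in> U"
        proof -
          have "\<delta> \<le> cmod (u - \<zeta>)" using \<delta>(2)[OF that] by (simp add: dist_norm norm_minus_commute)
          thus ?thesis using \<delta>(1) by (auto simp: norm_divide power_divide intro!: divide_left_mono power_mono mult_pos_pos)
        qed
        thus "norm (indicator U u *\<^sub>R (cmod (1 / (u - \<zeta>)))\<^sup>2) \<le> norm (1 / \<delta>\<^sup>2 * indicator U u)"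
          by (auto simp: indicator_def)
      qed
    qed (use mH in simp)
    hence "set_integrable lborel \<Omega> (\<lambda>z. (cmod (deriv \<Phi> z))\<^sup>2 *\<^sub>R (cmod (1 / (\<Phi> z - \<zeta>)))\<^sup>2)"
      using set_integrable_holomorphic_image_iff[OF \<Phi>(1) o\<Omega> \<Phi>(2), of "\<lambda>u. (cmod (1 / (u - \<zeta>)))\<^sup>2"] mH U by simp
    hence "set_integrable lborel \<Omega> (\<lambda>z. (cmod (?h z))\<^sup>2)"
      by (simp add: norm_divide power_divide)
    from quad[OF holh this] have "(LINT z:\<Omega>|lborel. ?h z) = R \<zeta>"
      unfolding R_def using w \<zeta>U by (auto intro!: sum.cong simp: A)
    moreover have "(LINT z:\<Omega>|lborel. ?h z) = (LINT u:U|lborel. (cmod (deriv \<phi> u))\<^sup>2 *\<^sub>R ?h (\<phi> u))"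
    proof -
      have "(\<lambda>z. indicator \<Omega> z *\<^sub>R ?h z) \<in> borel_measurable borel"
        using borel_measurable_if_holomorphic[OF holh o\<Omega>]
        by (rule measurable_cong[THEN iffD1, rotated]) (auto simp: indicator_def)
      thus ?thesis
        using set_integral_holomorphic_image[OF \<phi>(1) oU inj\<phi>, of ?h] \<phi>U by simp
    qed
    moreover have "(LINT u:U|lborel. (cmod (deriv \<phi> u))\<^sup>2 *\<^sub>R ?h (\<phi> u)) = (LINT z|lborel. cnj (g z) * (1 / (z - \<zeta>)))"
      unfolding set_lebesgue_integral_def
    proof (rule Bochner_Integration.integral_cong)
      fix u
      have "(cmod (deriv \<phi> u))\<^sup>2 *\<^sub>R ?h (\<phi> u) = cnj (deriv \<phi> u) * (1 / (u - \<zeta>))" if "u \<in> U"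
      proof -
        have "(cmod (deriv \<phi> u))\<^sup>2 *\<^sub>R ?h (\<phi> u) = (deriv \<phi> u * cnj (deriv \<phi> u)) * (deriv \<Phi> (\<phi> u) / (u - \<zeta>))"
          using \<Phi>\<phi>[OF that] by (simp add: scaleR_conv_of_real complex_mult_cnj cmod_power2)
        also have "\<dots> = cnj (deriv \<phi> u) * ((deriv \<Phi> (\<phi> u) * deriv \<phi> u) / (u - \<zeta>))"
          by simp
        finally show ?thesis unfolding dd[OF that] .
      qed
      thus "indicator U u *\<^sub>R ((cmod (deriv \<phi> u))\<^sup>2 *\<^sub>R ?h (\<phi> u)) = cnj (g u) * (1 / (u - \<zeta>))"
        by (simp add: g_def)
    qed simp
    ultimately show ?thesis by simp
  qed
  ultimately show "\<exists>R P. finite P \<and> P \<subseteq> U \<and> R meromorphic_on UNIV \<and> R holomorphic_on - P \<and>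
      (\<forall>\<zeta>. \<zeta> \<notin> closure U \<longrightarrow> (LINT z|lborel. cnj (g z) * (1 / (z - \<zeta>))) = R \<zeta>)"
    by blast
qed

subsection \<open>The Schwarz function\<close>

text \<open>Here \<open>a\<close> is a point at height \<open>y\<close> and \<open>b\<close> its
  mirror point. If \<open>z\<close> is within \<open>c * y / 2\<close> of \<open>a\<close>, both
  kernels are at most of order \<open>1 / y\<close>, the order of the right-hand side there; this
  gives the first constant. Otherwise the difference is
  \<open>(a - b) / ((z - a) * (z - b))\<close>, the two distances satisfy
  \<open>|z - a| \<le> (1 + L / c) * |z - b|\<close>, and \<open>y\<close> is at most
  \<open>2 / c * |z - a|\<close>; this gives the second.\<close>

lemma cutoff_kernel_reflection_bound:
  assumes y: "y > 0" and c: "c > 0" and L: "L > 0"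
    and far: "c * y \<le> cmod (z - b)" and ab: "cmod (a - b) \<le> L * y"
  shows "cmod (cutoff_kernel (c * y / 2) (z - a) - 1 / (z - b)) \<le>
     (3 * (1 + c\<^sup>2) / c + L * (1 + L / c) * (1 + 4 / c\<^sup>2)) * (y / (y\<^sup>2 + (cmod (z - a))\<^sup>2))"
proof -
  let ?r = "c * y / 2" and ?d = "cmod (z - a)" and ?e = "cmod (z - b)"
  let ?K1 = "3 * (1 + c\<^sup>2) / c" and ?K2 = "L * (1 + L / c) * (1 + 4 / c\<^sup>2)"
  have r: "?r > 0" using y c by simp
  have e: "?e > 0" using far y c by (smt (verit) mult_pos_pos)
  have K: "?K1 \<ge> 0" "?K2 \<ge> 0" using c L by auto
  have p: "y\<^sup>2 + ?d\<^sup>2 > 0" using y by (simp add: add_pos_nonneg)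
  have k: "y / (y\<^sup>2 + ?d\<^sup>2) \<ge> 0" using y p by simp
  show ?thesis
  proof (cases "?d < ?r")
    case True
    have "cmod (cutoff_kernel ?r (z - a) - 1 / (z - b)) \<le> 1 / ?r + 1 / ?e"
      using cmod_cutoff_kernel_le[OF r, of "z - a"] norm_triangle_ineq4[of "cutoff_kernel ?r (z - a)" "1 / (z - b)"] by (simp add: norm_divide)
    also have "\<dots> \<le> 1 / ?r + 1 / (c * y)"
      using far y c e by (intro add_left_mono divide_left_mono mult_pos_pos) auto
    also have "1 / ?r + 1 / (c * y) = 3 / (c * y)" using y c by (simp add: field_simps)
    also have "3 / (c * y) = ?K1 * (y / (y\<^sup>2 * (1 + c\<^sup>2)))"
    proof -
      have "1 + c\<^sup>2 > 0" by (simp add: add_pos_nonneg)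
      moreover have "3 / (c * y) = 3 * q / c * (y / (y\<^sup>2 * q))" if "q > 0" for q
        using that y c by (simp add: field_simps power2_eq_square)
      ultimately show ?thesis by blast
    qed
    also have "\<dots> \<le> ?K1 * (y / (y\<^sup>2 + ?d\<^sup>2))"
    proof (intro mult_left_mono divide_left_mono K)
      have "?d\<^sup>2 \<le> (c * y)\<^sup>2" using True r by (intro power_mono) auto
      thus "y\<^sup>2 + ?d\<^sup>2 \<le> y\<^sup>2 * (1 + c\<^sup>2)" by (simp add: algebra_simps power_mult_distrib)
      show "0 < y\<^sup>2 * (1 + c\<^sup>2) * (y\<^sup>2 + ?d\<^sup>2)" using y p by (intro mult_pos_pos) (auto simp: add_pos_nonneg)
    qed (use y in auto)
    also have "\<dots> \<le> (?K1 + ?K2) * (y / (y\<^sup>2 + ?d\<^sup>2))" using K k by (intro mult_right_mono) auto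
    finally show ?thesis .
  next
    case False
    hence d: "?r \<le> ?d" "?d > 0" using r by auto
    have nz: "z - a \<noteq> 0" "z - b \<noteq> 0" using d e by auto
    have "?d \<le> ?e + cmod (a - b)" using norm_triangle_ineq4[of "z - b" "a - b"] by simp
    also have "\<dots> \<le> ?e + L / c * ?e"
    proof -
      have "L * y = L / c * (c * y)" using c by simp
      also have "\<dots> \<le> L / c * ?e" using far L c by (intro mult_left_mono) auto
      finally show ?thesis using ab by simp
    qed
    finally have de: "?d \<le> (1 + L / c) * ?e" by (simp add: algebra_simps)
    have "cutoff_kernel ?r (z - a) - 1 / (z - b) = (a - b) / ((z - a) * (z - b))"
      using nz by (simp add: cutoff_kernel_outside[OF r d(1)] field_simps)
    hence "cmod (cutoff_kernel ?r (z - a) - 1 / (z - b)) = cmod (a - b) / (?d * ?e)"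
      by (simp add: norm_divide norm_mult)
    also have "\<dots> \<le> L * y / (?d * ?e)" using ab d e by (intro divide_right_mono) auto
    also have "\<dots> = L * y * (?d / ?e) / ?d\<^sup>2" using d e by (simp add: power2_eq_square)
    also have "\<dots> \<le> L * y * (1 + L / c) / ?d\<^sup>2"
    proof -
      have "?d / ?e \<le> 1 + L / c" using de e by (simp add: divide_le_eq)
      thus ?thesis using L y by (intro divide_right_mono mult_left_mono) auto
    qed
    also have "\<dots> = L * (1 + L / c) * (y / ?d\<^sup>2)" by simp
    also have "y / ?d\<^sup>2 \<le> (1 + 4 / c\<^sup>2) * (y / (y\<^sup>2 + ?d\<^sup>2))"
    proof -
      have "(c * y / 2)\<^sup>2 \<le> ?d\<^sup>2" using d r by (intro power_mono) auto
      hence "y\<^sup>2 \<le> 4 / c\<^sup>2 * ?d\<^sup>2" using c by (simp add: power_mult_distrib power_divide field_simps)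
      hence "y\<^sup>2 + ?d\<^sup>2 \<le> (1 + 4 / c\<^sup>2) * ?d\<^sup>2" by (simp add: algebra_simps)
      hence "y * (y\<^sup>2 + ?d\<^sup>2) \<le> y * ((1 + 4 / c\<^sup>2) * ?d\<^sup>2)" using y by (intro mult_left_mono) auto
      thus ?thesis using p d by (simp add: divide_le_eq le_divide_eq mult_ac)
    qed
    hence "L * (1 + L / c) * (y / ?d\<^sup>2) \<le> L * (1 + L / c) * ((1 + 4 / c\<^sup>2) * (y / (y\<^sup>2 + ?d\<^sup>2)))"
      using L c by (intro mult_left_mono) auto
    also have "\<dots> = ?K2 * (y / (y\<^sup>2 + ?d\<^sup>2))" by simp
    also have "\<dots> \<le> (?K1 + ?K2) * (y / (y\<^sup>2 + ?d\<^sup>2))" using K k by (intro mult_right_mono) auto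
    finally show ?thesis .
  qed
qed

text \<open>Integrating \<open>K / Im w\<close> downwards would give a logarithm. The weaker
  \<open>1 / sqrt (Im w)\<close> is all that the reflection argument asks for, and it comes from a
  simpler majorant. The starting values, at height \<open>s / 2\<close>, are bounded by
  compactness.\<close>

lemma growth_from_derivative:
  fixes F :: "complex \<Rightarrow> complex"
  assumes s: "s > 0" and der: "\<And>w. w \<in> ball 0 s \<Longrightarrow> Im w > 0 \<Longrightarrow> (F has_field_derivative F' w) (at w)"
    and K: "\<And>w. w \<in> ball 0 s \<Longrightarrow> Im w > 0 \<Longrightarrow> cmod (F' w) \<le> K / Im w"
  shows "\<exists>C. \<forall>w. w \<in> ball 0 (s / 4) \<longrightarrow> Im w > 0 \<longrightarrow> cmod (F w) \<le> C / sqrt (Im w)"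
proof -
  have K0: "K \<ge> 0"
  proof -
    have "0 \<le> K / (s / 2)"
      using order_trans[OF norm_ge_zero K[of "\<i> * of_real (s / 2)"]] s by (simp add: norm_mult)
    thus ?thesis using s by (simp add: zero_le_divide_iff)
  qed
  let ?top = "\<lambda>x::real. of_real x + \<i> * of_real (s / 2)"
  have inb: "of_real x + \<i> * of_real t \<in> ball 0 s" if "\<bar>x\<bar> \<le> s / 4" "0 < t" "t \<le> s / 2" for x t
  proof -
    have "cmod (of_real x + \<i> * of_real t) \<le> \<bar>x\<bar> + t"
      using norm_triangle_ineq[of "of_real x" "\<i> * of_real t"] that by (simp add: norm_mult)
    thus ?thesis using that s by simp
  qed
  have "continuous_on {- s / 4..s / 4} (\<lambda>x. F (?top x))"
  proof (rule continuous_at_imp_continuous_on, rule ballI)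
    fix x assume "x \<in> {- s / 4..s / 4}"
    hence "?top x \<in> ball 0 s" using s by (intro inb) auto
    hence "isCont F (?top x)" using s by (intro DERIV_isCont[OF der]) auto
    moreover have "isCont ?top x" by (intro continuous_intros)
    ultimately show "isCont (\<lambda>x. F (?top x)) x" by (rule isCont_o2[rotated])
  qed
  hence "compact ((\<lambda>x. F (?top x)) ` {- s / 4..s / 4})" by (intro compact_continuous_image) auto
  hence "bounded ((\<lambda>x. F (?top x)) ` {- s / 4..s / 4})" by (rule compact_imp_bounded)
  then obtain B where "\<forall>y\<in>(\<lambda>x. F (?top x)) ` {- s / 4..s / 4}. cmod y \<le> B"
    unfolding bounded_iff by (elim exE)
  hence B: "cmod (F (?top x)) \<le> B" if "x \<in> {- s / 4..s / 4}" for x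
    using that by (rule bspec[OF _ imageI])
  define C where "C = \<bar>B\<bar> * sqrt s + 2 * K * sqrt s"
  have "cmod (F w) \<le> C / sqrt (Im w)" if w: "w \<in> ball 0 (s / 4)" "Im w > 0" for w
  proof -
    define x y where "x = Re w" and "y = Im w"
    have xy: "\<bar>x\<bar> \<le> s / 4" "0 < y" "y < s / 2" "w = of_real x + \<i> * of_real y"
      using w abs_Re_le_cmod[of w] abs_Im_le_cmod[of w] by (auto simp: x_def y_def complex_eq_iff)
    \<comment> \<open>The derivative bound \<open>K / t\<close> is enlarged to
      \<open>K * sqrt s / (t * sqrt t)\<close>, using \<open>t < s\<close>; its primitive is
      \<open>- 2 * K * sqrt s / sqrt t\<close>.\<close>
    have "cmod (F (of_real x + \<i> * of_real (s / 2)) - F (of_real x + \<i> * of_real y)) \<le>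
        - 2 * K * sqrt s / sqrt (s / 2) - - 2 * K * sqrt s / sqrt y"
    proof (rule differentiable_bound_general[OF xy(3), where f'="\<lambda>t. \<i> * F' (of_real x + \<i> * of_real t)"
          and \<phi>'="\<lambda>t. K * sqrt s / (t * sqrt t)" and \<phi>="\<lambda>t. - 2 * K * sqrt s / sqrt t" and f="\<lambda>t. F (of_real x + \<i> * of_real t)"])
      have d: "((\<lambda>t. F (of_real x + \<i> * of_real t)) has_vector_derivative \<i> * F' (of_real x + \<i> * of_real t)) (at t)"
        if "y \<le> t" "t \<le> s / 2" for t
      proof -
        have "((\<lambda>t. of_real x + \<i> * of_real t) has_vector_derivative \<i>) (at t)"
          by (auto intro!: derivative_eq_intros)
        from field_vector_diff_chain_at[OF this der[OF inb[OF xy(1)]]] show ?thesis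
          using that xy by (auto simp: o_def)
      qed
      show "continuous_on {y..s / 2} (\<lambda>t. F (of_real x + \<i> * of_real t))"
        by (rule continuous_on_vector_derivative, rule has_vector_derivative_at_within, rule d) auto
      show "continuous_on {y..s / 2} (\<lambda>t. - 2 * K * sqrt s / sqrt t)"
        using xy by (intro continuous_intros) auto
      fix t assume t: "y < t" "t < s / 2"
      show "((\<lambda>t. F (of_real x + \<i> * of_real t)) has_vector_derivative \<i> * F' (of_real x + \<i> * of_real t)) (at t)"
        using d t by simp
      have t0: "t > 0" using t xy by simp
      have sq: "sqrt t * sqrt t = t" using t0 by simp
      have "((\<lambda>t. - 2 * K * sqrt s / sqrt t) has_real_derivative
         (- (- 2 * K * sqrt s * (inverse (sqrt t) / 2)) / (sqrt t * sqrt t))) (at t)"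
        using t0 by (auto intro!: derivative_eq_intros)
      moreover have "(- (- 2 * K * sqrt s * (inverse (sqrt t) / 2)) / (sqrt t * sqrt t)) = K * sqrt s / (t * sqrt t)"
        unfolding sq using t0 by (simp add: field_simps)
      ultimately show "((\<lambda>t. - 2 * K * sqrt s / sqrt t) has_vector_derivative K * sqrt s / (t * sqrt t)) (at t)"
        by (simp add: has_real_derivative_iff_has_vector_derivative)
      have "cmod (\<i> * F' (of_real x + \<i> * of_real t)) \<le> K / t"
        using K[OF inb[OF xy(1), of t]] t t0 by (simp add: norm_mult)
      also have "\<dots> = K * sqrt t / (t * sqrt t)" using t0 by simp
      also have "\<dots> \<le> K * sqrt s / (t * sqrt t)"
        using t t0 K0 s by (intro divide_right_mono mult_left_mono) auto
      finally show "cmod (\<i> * F' (of_real x + \<i> * of_real t)) \<le> K * sqrt s / (t * sqrt t)" .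
    qed
    also have "\<dots> \<le> 2 * K * sqrt s / sqrt y" using K0 s by simp
    finally have "cmod (F w) \<le> cmod (F (?top x)) + 2 * K * sqrt s / sqrt y"
      using norm_triangle_ineq2[of "F w" "F (?top x)"] by (simp add: xy(4) norm_minus_commute)
    also have "cmod (F (?top x)) \<le> \<bar>B\<bar> * sqrt s / sqrt y"
    proof -
      have "x \<in> {- s / 4..s / 4}" unfolding atLeastAtMost_iff using xy(1) by linarith
      from B[OF this] have "cmod (F (?top x)) \<le> \<bar>B\<bar> * 1" by linarith
      also have "\<dots> \<le> \<bar>B\<bar> * (sqrt s / sqrt y)" using xy s by (intro mult_left_mono) auto
      finally show ?thesis by simp
    qed
    finally show ?thesis by (simp add: C_def y_def add_divide_distrib)
  qed
  thus ?thesis by blast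
qed

lemma chart_filterlim:
  assumes U: "open U" and ch: "double_chart U G r p" and t: "t \<in> ball 0 r" "Im t = 0"
  shows "filterlim G (at (G t) within U) (at t within {w. Im w > 0})"
proof -
  have "G holomorphic_on ball 0 r" using ch by (simp add: double_chart_def)
  hence "isCont G t"
    using t holomorphic_on_imp_continuous_on continuous_on_eq_continuous_at[of "ball 0 r" G] by blast
  hence "(G \<longlongrightarrow> G t) (at t within {w. Im w > 0})"
    unfolding isCont_def by (rule tendsto_within_subset) simp
  moreover have "\<forall>\<^sub>F w in at t within {w. Im w > 0}. w \<in> ball 0 r \<and> Im w > 0"
    unfolding eventually_at_topological using t by (intro exI[of _ "ball 0 r"]) auto
  hence "\<forall>\<^sub>F w in at t within {w. Im w > 0}. G w \<in> U \<and> G w \<noteq> G t"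
  proof eventually_elim
    case (elim w)
    thus ?case using double_chart_frontier_iff(2)[OF U ch, of w] double_chart_frontier_iff(2)[OF U ch t(1)] t by auto
  qed
  ultimately show ?thesis by (simp add: filterlim_at eventually_conj_iff)
qed

text \<open>\<open>M\<close> has the boundary values of \<open>cnj \<phi>\<close>, read in charts that avoid its poles \<open>P\<close>; the growth bound on \<open>\<phi>\<close> makes
  primitives continuous up to the real line, so that reflection applies although \<open>\<phi>\<close> itself is not known
  to be continuous there.\<close>

definition conjugate_boundary_values ::
  "complex set \<Rightarrow> complex set \<Rightarrow> (complex \<Rightarrow> complex) \<Rightarrow> (complex \<Rightarrow> complex) \<Rightarrow> bool" where
  "conjugate_boundary_values U P \<phi> M \<longleftrightarrow>
    (\<forall>G r p. double_chart U G r p \<longrightarrow> (\<exists>s K. 0 < s \<and> s \<le> r \<and> G ` ball 0 s \<inter> P = {} \<and>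
       (\<forall>w\<in>ball 0 s. Im w > 0 \<longrightarrow> cmod (\<phi> (G w)) \<le> K / sqrt (Im w)) \<and>
       (\<forall>t\<in>ball 0 s. Im t = 0 \<longrightarrow>
          ((\<lambda>w. cnj (\<phi> (G w)) - M (G w)) \<longlongrightarrow> 0) (at t within {w. Im w > 0}))))"

text \<open>\<open>M\<close> is the Schwarz function of \<open>\<Omega>\<close> transplanted to
  \<open>U\<close>: the meromorphic function that agrees with the conjugate coordinate along the
  boundary. Its poles lie in \<open>P\<close> and come from \<open>R\<close>, hence from the nodes
  of the quadrature formula.\<close>

lemma schwarz_function_exists:
  assumes oU: "open U" and \<phi>: "\<phi> holomorphic_on U"
    and g_def: "g = (\<lambda>z. if z \<in> U then deriv \<phi> z else 0)"
    and g1: "integrable lborel g" and g2: "integrable lborel (\<lambda>z. (cmod (g z))\<^sup>2)"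
    and P: "finite P" "P \<subseteq> U" and R: "R meromorphic_on UNIV" "R holomorphic_on - P"
    and RC: "\<And>\<zeta>. \<zeta> \<notin> closure U \<Longrightarrow> (LINT z|lborel. cnj (g z) * (1 / (z - \<zeta>))) = R \<zeta>"
  shows "\<exists>M. M holomorphic_on U - P \<and> M meromorphic_on U \<and>
    conjugate_boundary_values U P \<phi> M"
proof -
  have holg: "g holomorphic_on U"
    using holomorphic_deriv[OF \<phi> oU] by (rule holomorphic_transform) (simp add: g_def)
  \<comment> \<open>Any radius that fits inside \<open>U\<close> gives the same value, so an
    arbitrary choice defines \<open>C\<close>, and \<open>C_eq\<close> lets each later estimate use
    the radius it needs. The factor 2 leaves the margin that independence of the radius
    requires.\<close>
  define rr where "rr \<zeta> = (SOME r. r > 0 \<and> ball \<zeta> (2 * r) \<subseteq> U)" for \<zeta>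
  have rr: "rr \<zeta> > 0" "ball \<zeta> (2 * rr \<zeta>) \<subseteq> U" if \<zeta>: "\<zeta> \<in> U" for \<zeta>
  proof -
    obtain e where "e > 0" "ball \<zeta> e \<subseteq> U" using \<zeta> oU openE by blast
    hence "\<exists>r. r > 0 \<and> ball \<zeta> (2 * r) \<subseteq> U" by (intro exI[of _ "e / 2"]) auto
    from someI_ex[OF this] show "rr \<zeta> > 0" "ball \<zeta> (2 * rr \<zeta>) \<subseteq> U" by (auto simp: rr_def)
  qed
  define C where "C \<zeta> = cutoff_transform g (rr \<zeta>) \<zeta>" for \<zeta>
  have C_eq: "C \<zeta> = cutoff_transform g r \<zeta>" if "0 < r" "r < R'" "ball \<zeta> R' \<subseteq> U" for \<zeta> r R'
  proof -
    have "\<zeta> \<in> ball \<zeta> R'" using that by simp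
    hence "\<zeta> \<in> U" using that(3) by blast
    note q = rr[OF this]
    have "ball \<zeta> (max R' (2 * rr \<zeta>)) \<subseteq> U" using q that by (auto simp: max_def)
    hence "g holomorphic_on ball \<zeta> (max R' (2 * rr \<zeta>))" using holg holomorphic_on_subset by blast
    thus ?thesis
      unfolding C_def by (rule cutoff_transform_independent_radius[OF _ g1]) (use q that in auto)
  qed
  have holC: "(\<lambda>u. C u + pi * cnj (\<phi> u)) holomorphic_on U"
  proof (rule holomorphic_onI)
    fix \<zeta> assume "\<zeta> \<in> U"
    then obtain e where e: "e > 0" "ball \<zeta> e \<subseteq> U" using oU openE by blast
    \<comment> \<open>Differentiability is proved for a fixed radius; with \<open>e / 4\<close> the
      same \<open>r\<close> is admissible at all points of \<open>ball \<zeta> r\<close>.\<close>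
    define r where "r = e / 4"
    have r: "r > 0" "4 * r = e" using e by (auto simp: r_def)
    have sub: "ball u (2 * r) \<subseteq> U" if "u \<in> ball \<zeta> r" for u
    proof -
      have "ball u (2 * r) \<subseteq> ball \<zeta> e"
        using that r by (intro ball_subset_ball_iff[THEN iffD2] disjI1) (auto simp: dist_commute)
      thus ?thesis using e by blast
    qed
    have "(\<lambda>u. cutoff_transform g r u + pi * cnj (\<phi> u)) field_differentiable at \<zeta>"
    proof (rule cutoff_transform_plus_primitive_differentiable[of g \<zeta> "2 * r"])
      show "g holomorphic_on ball \<zeta> (2 * r)" using holg sub[of \<zeta>] r holomorphic_on_subset by auto
      show "(\<phi> has_field_derivative g \<zeta>) (at \<zeta>)"
        using holomorphic_derivI[OF \<phi> oU \<open>\<zeta> \<in> U\<close>] \<open>\<zeta> \<in> U\<close> by (simp add: g_def)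
    qed (use g1 r in auto)
    then obtain D where "((\<lambda>u. cutoff_transform g r u + pi * cnj (\<phi> u)) has_field_derivative D) (at \<zeta>)"
      unfolding field_differentiable_def by blast
    hence "((\<lambda>u. C u + pi * cnj (\<phi> u)) has_field_derivative D) (at \<zeta>)"
      by (rule has_field_derivative_transform_within_open[of _ _ _ "ball \<zeta> r"])
        (use r in \<open>auto simp: C_eq[OF _ _ sub]\<close>)
    thus "(\<lambda>u. C u + pi * cnj (\<phi> u)) field_differentiable at \<zeta> within U"
      unfolding field_differentiable_def using has_field_derivative_at_within by blast
  qed
  define M where "M u = (C u + pi * cnj (\<phi> u) - R u) / pi" for u
  have "M holomorphic_on U - P"
    unfolding M_def by (intro holomorphic_intros holomorphic_on_subset[OF holC] holomorphic_on_subset[OF R(2)]) auto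
  moreover have "M meromorphic_on U"
    unfolding M_def
    by (intro meromorphic_intros meromorphic_on_subset[OF R(1)] analytic_on_imp_meromorphic_on)
      (use holC oU in \<open>auto simp: analytic_on_open\<close>)
  moreover have "\<exists>s K. 0 < s \<and> s \<le> r \<and> G ` ball 0 s \<inter> P = {} \<and>
       (\<forall>w\<in>ball 0 s. Im w > 0 \<longrightarrow> cmod (\<phi> (G w)) \<le> K / sqrt (Im w)) \<and>
       (\<forall>t\<in>ball 0 s. Im t = 0 \<longrightarrow> ((\<lambda>w. cnj (\<phi> (G w)) - M (G w)) \<longlongrightarrow> 0) (at t within {w. Im w > 0}))"
    if ch: "double_chart U G r p" for G r p
  proof -
    obtain s0 c L where s0: "0 < s0" "s0 \<le> r" and c: "0 < c" and L: "0 < L"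
      and geo: "\<And>w. w \<in> ball 0 s0 \<Longrightarrow> Im w > 0 \<Longrightarrow> ball (G w) (c * Im w) \<subseteq> U"
        "\<And>w. w \<in> ball 0 s0 \<Longrightarrow> Im w > 0 \<Longrightarrow> ball (G (cnj w)) (c * Im w) \<inter> U = {}"
        "\<And>w. w \<in> ball 0 s0 \<Longrightarrow> Im w > 0 \<Longrightarrow> cmod (G w - G (cnj w)) \<le> L * Im w"
      using double_chart_geometry[OF oU ch] by (elim exE conjE) simp
    have G: "G holomorphic_on ball 0 r" "G 0 = p" using ch by (auto simp: double_chart_def)
    have Gc: "isCont G t" if "t \<in> ball 0 r" for t
      using that G holomorphic_on_imp_continuous_on continuous_on_eq_continuous_at[of "ball 0 r" G] by blast
    have pP: "p \<notin> P"
      using double_chart_frontier_iff(2)[OF oU ch, of 0] s0 P G by auto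
    have "open (ball 0 r \<inter> G -` (- P))"
      by (rule continuous_open_preimage[OF holomorphic_on_imp_continuous_on[OF G(1)]])
        (use P in \<open>auto simp: finite_imp_closed open_Compl\<close>)
    moreover have "0 \<in> ball 0 r \<inter> G -` (- P)" using pP G s0 by auto
    ultimately obtain e where e: "e > 0" "ball 0 e \<subseteq> ball 0 r \<inter> G -` (- P)" using openE by blast
    define s1 where "s1 = min s0 e"
    have s1: "0 < s1" "s1 \<le> s0" "s1 \<le> e" using s0 e by (auto simp: s1_def)
    obtain B where B: "\<And>w. w \<in> cball 0 (s1 / 2) \<Longrightarrow> cmod (deriv G w) \<le> B"
    proof -
      have sub: "cball 0 (s1 / 2) \<subseteq> ball (0::complex) r"
      proof
        fix w :: complex assume "w \<in> cball 0 (s1 / 2)"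
        hence "cmod w \<le> s1 / 2" by simp
        thus "w \<in> ball 0 r" using s1 s0 by simp
      qed
      have "continuous_on (cball 0 (s1 / 2)) (deriv G)"
        by (rule holomorphic_on_imp_continuous_on[OF holomorphic_on_subset[OF holomorphic_deriv[OF G(1) open_ball] sub]])
      hence "compact (deriv G ` cball 0 (s1 / 2))" by (intro compact_continuous_image) auto
      hence "bounded (deriv G ` cball 0 (s1 / 2))" by (rule compact_imp_bounded)
      then obtain B where "\<forall>y\<in>deriv G ` cball 0 (s1 / 2). cmod y \<le> B" unfolding bounded_iff by (elim exE)
      thus ?thesis using that by blast
    qed
    define A where "A = sqrt ((LINT z|lborel. (cmod (g z))\<^sup>2) / pi)"
    \<comment> \<open>\<open>G w\<close> is the centre of a disc of radius \<open>c * Im w\<close>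
      inside \<open>U\<close>, so the L2 mean value estimate bounds the derivative of
      \<open>\<phi>\<close> by a multiple of \<open>1 / Im w\<close>.\<close>
    have gb: "cmod (g (G w)) \<le> 2 * A / (c * Im w)" if w: "w \<in> ball 0 s0" "Im w > 0" for w
    proof -
      have cw: "c * Im w > 0" using c w by simp
      have "(cmod (g (G w)))\<^sup>2 * (pi * (c * Im w / 2)\<^sup>2) \<le> (LINT z|lborel. (cmod (g z))\<^sup>2)"
        by (rule cmod_le_L2_ball[OF holomorphic_on_subset[OF holg geo(1)[OF w]] cw g2])
      hence "(cmod (g (G w)) * (c * Im w / 2))\<^sup>2 \<le> (LINT z|lborel. (cmod (g z))\<^sup>2) / pi"
        by (simp add: power_mult_distrib field_simps)
      hence "cmod (g (G w)) * (c * Im w / 2) \<le> A"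
        unfolding A_def by (rule real_le_rsqrt)
      thus ?thesis using cw by (simp add: field_simps)
    qed
    have "\<exists>K. \<forall>w. w \<in> ball 0 (s1 / 2 / 4) \<longrightarrow> Im w > 0 \<longrightarrow> cmod (\<phi> (G w)) \<le> K / sqrt (Im w)"
    proof (rule growth_from_derivative)
      show "s1 / 2 > 0" using s1 by simp
      fix w :: complex assume w: "w \<in> ball 0 (s1 / 2)" "Im w > 0"
      have w0: "w \<in> ball 0 s0" "w \<in> ball 0 r" using w s1 s0 by auto
      have Gw: "G w \<in> U" using double_chart_frontier_iff(2)[OF oU ch w0(2)] w by simp
      have "((\<phi> \<circ> G) has_field_derivative deriv \<phi> (G w) * deriv G w) (at w)"
        by (rule DERIV_chain[OF holomorphic_derivI[OF \<phi> oU Gw] holomorphic_derivI[OF G(1) open_ball w0(2)]])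
      thus "((\<lambda>w. \<phi> (G w)) has_field_derivative g (G w) * deriv G w) (at w)"
        using Gw by (simp add: o_def g_def)
      have "cmod (g (G w) * deriv G w) \<le> 2 * A / (c * Im w) * B"
        unfolding norm_mult using w s1 by (intro mult_mono gb w0 B order_trans[OF norm_ge_zero gb[OF w0(1) w(2)]]) auto
      thus "cmod (g (G w) * deriv G w) \<le> (2 * A * B / c) / Im w" by simp
    qed
    then obtain K where K: "\<And>w. w \<in> ball 0 (s1 / 2 / 4) \<Longrightarrow> Im w > 0 \<Longrightarrow> cmod (\<phi> (G w)) \<le> K / sqrt (Im w)" by blast
    define s where "s = s1 / 2 / 4"
    have s: "0 < s" "s \<le> s1" "s \<le> s0" "s \<le> r" "s \<le> e" using s1 s0 by (auto simp: s_def)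
    have lim: "((\<lambda>w. cnj (\<phi> (G w)) - M (G w)) \<longlongrightarrow> 0) (at t within {w. Im w > 0})"
      if t: "t \<in> ball 0 s" "Im t = 0" for t
    proof -
      have tr: "t \<in> ball 0 r" "cnj t = t" using t s by (auto simp: complex_eq_iff)
      have Rc: "isCont R (G t)"
      proof -
        have "t \<in> ball 0 e" using t s by simp
        hence "G t \<in> - P" using e(2) by blast
        moreover have "open (- P)" using P by (simp add: finite_imp_closed open_Compl)
        ultimately show ?thesis
          using holomorphic_on_imp_continuous_on[OF R(2)] continuous_on_eq_continuous_at by blast
      qed
      have Gl: "(G \<longlongrightarrow> G t) (at t within {w. Im w > 0})"
        using Gc[OF tr(1)] unfolding isCont_def by (rule tendsto_within_subset) simp
      have cl: "(cnj \<longlongrightarrow> t) (at t within {w. Im w > 0})"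
        using tendsto_cnj[OF tendsto_ident_at[of t]] tr by simp
      have Gcl: "((\<lambda>w. G (cnj w)) \<longlongrightarrow> G t) (at t within {w. Im w > 0})"
        by (rule isCont_tendsto_compose[OF Gc[OF tr(1)] cl])
      have "((\<lambda>w. R (G w) - R (G (cnj w))) \<longlongrightarrow> R (G t) - R (G t)) (at t within {w. Im w > 0})"
        by (intro tendsto_diff isCont_tendsto_compose[OF Rc] Gl Gcl)
      hence Rl: "((\<lambda>w. R (G w) - R (G (cnj w))) \<longlongrightarrow> 0) (at t within {w. Im w > 0})" by simp
      have evin: "\<forall>\<^sub>F w in at t within {w. Im w > 0}. w \<in> ball 0 s \<and> Im w > 0"
        unfolding eventually_at_topological using t by (intro exI[of _ "ball 0 s"]) auto
      \<comment> \<open>The inner point \<open>a = G w\<close> is compared with its mirror point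
        \<open>b\<close>, where \<open>R\<close> equals the Cauchy integral. The cutoff radius
        \<open>c * y / 2\<close> follows the distance to the boundary, so the difference of the
        kernels is bounded by a fixed multiple of the decaying kernel.\<close>
      have Cl: "((\<lambda>w. C (G w) - R (G (cnj w))) \<longlongrightarrow> 0) (at t within {w. Im w > 0})"
      proof (rule tendstoI)
        fix \<epsilon> :: real assume \<epsilon>: "\<epsilon> > 0"
        define K' where "K' = 3 * (1 + c\<^sup>2) / c + L * (1 + L / c) * (1 + 4 / c\<^sup>2)"
        have K': "K' > 0" unfolding K'_def using c L by (intro add_pos_pos mult_pos_pos divide_pos_pos) (auto simp: add_pos_nonneg)
        obtain \<delta> where \<delta>: "\<delta> > 0" "\<And>\<zeta> y. cmod (\<zeta> - G t) < \<delta> \<Longrightarrow> 0 < y \<Longrightarrow> y < \<delta> \<Longrightarrow>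
           integrable lborel (\<lambda>z. cmod (g z) * (y / (y\<^sup>2 + (cmod (z - \<zeta>))\<^sup>2)))"
           "\<And>\<zeta> y. cmod (\<zeta> - G t) < \<delta> \<Longrightarrow> 0 < y \<Longrightarrow> y < \<delta> \<Longrightarrow>
           (LINT z|lborel. cmod (g z) * (y / (y\<^sup>2 + (cmod (z - \<zeta>))\<^sup>2))) < \<epsilon> / K'"
        proof -
          have "\<epsilon> / K' > 0" using \<epsilon> K' by simp
          from Cauchy_kernel_integral_decay[OF g1 g2 this, of "G t"] show ?thesis using that by blast
        qed
        have "\<forall>\<^sub>F w in at t within {w. Im w > 0}. dist (G w) (G t) < \<delta>"
          using Gl \<delta>(1) by (rule tendstoD)
        moreover have "\<forall>\<^sub>F w in at t within {w. Im w > 0}. dist w t < \<delta>"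
          using tendsto_ident_at \<delta>(1) by (rule tendstoD)
        ultimately show "\<forall>\<^sub>F w in at t within {w. Im w > 0}. dist (C (G w) - R (G (cnj w))) 0 < \<epsilon>"
          using evin
        proof eventually_elim
          case (elim w)
          define y a b where "y = Im w" and "a = G w" and "b = G (cnj w)"
          have w0: "w \<in> ball 0 s0" "Im w > 0" using elim s by auto
          have y: "0 < y" "y < \<delta>"
            using elim abs_Im_le_cmod[of "w - t"] t by (auto simp: y_def dist_norm)
          have a: "cmod (a - G t) < \<delta>" using elim by (simp add: a_def dist_norm)
          have cy: "0 < c * y" using c y by simp
          have balla: "ball a (c * y) \<subseteq> U" and ballb: "ball b (c * y) \<inter> U = {}" and ab: "cmod (a - b) \<le> L * y"
            using geo[OF w0] by (auto simp: a_def b_def y_def)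
          have "b \<in> ball b (c * y)" using cy by simp
          hence "b \<notin> closure U"
            using open_Int_closure_eq_empty[of "ball b (c * y)" U] ballb by blast
          hence Rb: "R b = (LINT z|lborel. cnj (g z) * (1 / (z - b)))" by (rule RC[symmetric])
          have Ca: "C a = (LINT z|lborel. cnj (g z) * cutoff_kernel (c * y / 2) (z - a))"
            using C_eq[OF _ _ balla, of "c * y / 2"] cy by (simp add: cutoff_transform_def)
          have bound: "cmod (cnj (g z) * cutoff_kernel (c * y / 2) (z - a) - cnj (g z) * (1 / (z - b)))
             \<le> K' * (cmod (g z) * (y / (y\<^sup>2 + (cmod (z - a))\<^sup>2)))" for z
          proof (cases "z \<in> U")
            case True
            hence "z \<notin> ball b (c * y)" using ballb by blast
            hence "c * y \<le> cmod (z - b)" by (simp add: dist_norm norm_minus_commute)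
            from cutoff_kernel_reflection_bound[OF y(1) c L this ab]
            have "cmod (cutoff_kernel (c * y / 2) (z - a) - 1 / (z - b)) \<le> K' * (y / (y\<^sup>2 + (cmod (z - a))\<^sup>2))"
              by (simp add: K'_def)
            hence "cmod (g z) * cmod (cutoff_kernel (c * y / 2) (z - a) - 1 / (z - b)) \<le> cmod (g z) * (K' * (y / (y\<^sup>2 + (cmod (z - a))\<^sup>2)))"
              by (intro mult_left_mono) auto
            moreover have "cnj (g z) * cutoff_kernel (c * y / 2) (z - a) - cnj (g z) * (1 / (z - b)) = cnj (g z) * (cutoff_kernel (c * y / 2) (z - a) - 1 / (z - b))"
              by (simp add: algebra_simps)
            ultimately show ?thesis by (simp add: norm_mult mult.left_commute)
          qed (simp add: g_def)
          have i1: "integrable lborel (\<lambda>z. cnj (g z) * cutoff_kernel (c * y / 2) (z - a))"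
            using integrable_cutoff_transform[OF g1] cy by simp
          have i2: "integrable lborel (\<lambda>z. cnj (g z) * (1 / (z - b)))"
          proof -
            have "integrable lborel (\<lambda>z. cnj (g z) * (if z \<in> U then 1 / (z - b) else 0))"
            proof (rule integrable_mult_bounded)
              show "integrable lborel (\<lambda>z. cnj (g z))" using g1 by simp
              show "(\<lambda>z. if z \<in> U then 1 / (z - b) else 0) \<in> borel_measurable borel"
                using oU by (intro measurable_If_set) auto
              show "cmod (if z \<in> U then 1 / (z - b) else 0) \<le> 1 / (c * y)" for z
              proof (cases "z \<in> U")
                case True
                hence "z \<notin> ball b (c * y)" using ballb by blast
                hence "c * y \<le> cmod (z - b)" by (simp add: dist_norm norm_minus_commute)
                thus ?thesis using cy True by (auto simp: norm_divide intro!: divide_left_mono mult_pos_pos)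
              qed (use cy in auto)
            qed
            moreover have "(\<lambda>z. cnj (g z) * (if z \<in> U then 1 / (z - b) else 0)) = (\<lambda>z. cnj (g z) * (1 / (z - b)))"
              by (auto simp: g_def)
            ultimately show ?thesis by simp
          qed
          have "C a - R b = (LINT z|lborel. cnj (g z) * cutoff_kernel (c * y / 2) (z - a) - cnj (g z) * (1 / (z - b)))"
            unfolding Ca Rb by (rule Bochner_Integration.integral_diff[OF i1 i2, symmetric])
          also have "cmod \<dots> \<le> (LINT z|lborel. K' * (cmod (g z) * (y / (y\<^sup>2 + (cmod (z - a))\<^sup>2))))"
            by (intro order_trans[OF integral_norm_bound] integral_mono
                Bochner_Integration.integrable_diff i1 i2 integrable_norm integrable_mult_right \<delta>(2)[OF a y] bound)
          also have "\<dots> = K' * (LINT z|lborel. cmod (g z) * (y / (y\<^sup>2 + (cmod (z - a))\<^sup>2)))"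
            by (rule integral_mult_right_zero)
          also have "\<dots> < K' * (\<epsilon> / K')"
            using \<delta>(3)[OF a y] K' by (intro mult_strict_left_mono)
          finally show ?case using K' by (simp add: a_def b_def)
        qed
      qed
      have "((\<lambda>w. ((R (G w) - R (G (cnj w))) - (C (G w) - R (G (cnj w)))) / complex_of_real pi) \<longlongrightarrow> (0 - 0) / complex_of_real pi) (at t within {w. Im w > 0})"
        by (intro tendsto_intros Rl Cl) auto
      thus ?thesis by (simp add: M_def diff_divide_distrib add_divide_distrib)
    qed
    show ?thesis
    proof (rule exI[of _ s], rule exI[of _ K], intro conjI ballI impI)
      have "ball 0 s \<subseteq> ball (0::complex) e" using s by (simp add: subset_ball)
      thus "G ` ball 0 s \<inter> P = {}" using e(2) by blast
    qed (use s K lim in \<open>auto simp: s_def\<close>)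
  qed
  ultimately show ?thesis unfolding conjugate_boundary_values_def by blast
qed

subsection \<open>Extension to the double\<close>

lemma meromorphic_on_cnj_cnj:
  assumes f: "f meromorphic_on S" and S: "open S"
  shows "(\<lambda>w. cnj (f (cnj w))) meromorphic_on cnj ` S"
  unfolding meromorphic_on_altdef
proof
  fix w assume "w \<in> cnj ` S"
  hence z: "cnj w \<in> S" by auto
  have "filterlim cnj (at (cnj w)) (at w)"
  proof -
    have "(cnj \<longlongrightarrow> cnj w) (at w)" by (intro tendsto_intros)
    moreover have "\<forall>\<^sub>F x in at w. cnj x \<noteq> cnj w"
      by (simp add: eventually_at_filter)
    ultimately show ?thesis by (simp add: filterlim_at)
  qed
  note cf = this
  from f z have sing: "isolated_singularity_at f (cnj w)" "not_essential f (cnj w)"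
    by (auto simp: meromorphic_on_altdef)
  then obtain r where r: "r > 0" "f analytic_on ball (cnj w) r - {cnj w}"
    by (auto simp: isolated_singularity_at_def)
  have eq: "cnj ` (ball w r - {w}) = ball (cnj w) r - {cnj w}"
  proof -
    have d: "dist (cnj a) (cnj b) = dist a b" for a b
      by (simp add: dist_norm flip: complex_cnj_diff)
    show ?thesis
    proof (intro equalityI subsetI)
      fix x assume "x \<in> ball (cnj w) r - {cnj w}"
      hence "cnj x \<in> ball w r - {w}" using d[of w "cnj x"] by auto
      thus "x \<in> cnj ` (ball w r - {w})" by (intro image_eqI[of _ _ "cnj x"]) auto
    qed (auto simp: d)
  qed
  have "f holomorphic_on cnj ` (ball w r - {w})"
    unfolding eq using r(2) by (rule analytic_imp_holomorphic)
  hence "cnj \<circ> f \<circ> cnj holomorphic_on ball w r - {w}"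
    by (rule holomorphic_on_compose_cnj_cnj) auto
  hence "(\<lambda>w. cnj (f (cnj w))) analytic_on ball w r - {w}"
    by (simp add: analytic_on_open open_delete o_def)
  hence 1: "isolated_singularity_at (\<lambda>w. cnj (f (cnj w))) w"
    using r(1) unfolding isolated_singularity_at_def by blast
  have 2: "not_essential (\<lambda>w. cnj (f (cnj w))) w"
    using sing(2) unfolding not_essential_def
  proof (elim exE disjE)
    fix l assume "f \<midarrow>cnj w\<rightarrow> l"
    from filterlim_compose[OF this cf] have "(\<lambda>w. cnj (f (cnj w))) \<midarrow>w\<rightarrow> cnj l"
      by (rule tendsto_cnj)
    thus "\<exists>x. (\<lambda>w. cnj (f (cnj w))) \<midarrow>w\<rightarrow> x \<or> is_pole (\<lambda>w. cnj (f (cnj w))) w" by blast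
  next
    assume "is_pole f (cnj w)"
    hence "filterlim (\<lambda>x. norm (f x)) at_top (at (cnj w))"
      unfolding is_pole_def by (rule filterlim_at_infinity_imp_norm_at_top)
    from filterlim_compose[OF this cf] have "filterlim (\<lambda>x. norm (cnj (f (cnj x)))) at_top (at w)"
      by simp
    hence "is_pole (\<lambda>w. cnj (f (cnj w))) w"
      unfolding is_pole_def by (rule filterlim_norm_at_top_imp_at_infinity)
    thus "\<exists>x. (\<lambda>w. cnj (f (cnj w))) \<midarrow>w\<rightarrow> x \<or> is_pole (\<lambda>w. cnj (f (cnj w))) w" by blast
  qed
  show "isolated_singularity_at (\<lambda>w. cnj (f (cnj w))) w \<and> not_essential (\<lambda>w. cnj (f (cnj w))) w"
    using 1 2 ..
qed

lemma deriv_cnj_cnj_chain: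
  assumes "(h has_field_derivative h') (at (G (cnj w)))" "(G has_field_derivative G') (at (cnj w))"
  shows "((\<lambda>w. cnj (h (G (cnj w)))) has_field_derivative cnj (h' * G')) (at w)"
proof -
  have "((h \<circ> G) has_field_derivative h' * G') (at (cnj w))"
    by (rule DERIV_chain[OF assms])
  thus ?thesis
    using has_field_derivative_cnj_cnj[of "h \<circ> G" "h' * G'" w] by (simp add: o_def)
qed

text \<open>Properness makes the set where \<open>|f| \<le> 1 - e\<close> compact. Its image under
  \<open>\<Phi>\<close> is then closed and avoids \<open>q\<close>, so near \<open>q\<close> the
  modulus lies between \<open>1 - e\<close> and 1.\<close>

lemma proper_disc_map_boundary_limit:
  assumes pr: "proper_holo_onto_disc \<Omega> f" and \<Phi>: "\<Phi> holomorphic_on \<Omega>" "\<Phi> ` \<Omega> = U"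
    and \<phi>: "\<And>z. z \<in> \<Omega> \<Longrightarrow> \<phi> (\<Phi> z) = z" and q: "q \<notin> U"
  shows "((\<lambda>z. cmod (f (\<phi> z))) \<longlongrightarrow> 1) (at q within U)"
proof (rule tendstoI)
  fix e :: real assume e: "e > 0"
  let ?C = "\<Omega> \<inter> f -` cball 0 (1 - e)"
  have "compact ?C"
    using pr e unfolding proper_holo_onto_disc_def by (auto simp: subset_iff)
  hence "compact (\<Phi> ` ?C)"
    by (rule compact_continuous_image[OF continuous_on_subset[OF holomorphic_on_imp_continuous_on[OF \<Phi>(1)]], rotated]) auto
  hence "open (- (\<Phi> ` ?C))" by (intro open_Compl compact_imp_closed)
  moreover have "q \<in> - (\<Phi> ` ?C)" using q \<Phi>(2) by auto
  ultimately have "\<forall>\<^sub>F z in at q within U. z \<in> - (\<Phi> ` ?C) \<and> z \<in> U"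
    unfolding eventually_at_topological by blast
  thus "\<forall>\<^sub>F z in at q within U. dist (cmod (f (\<phi> z))) 1 < e"
  proof eventually_elim
    case (elim z)
    then obtain u where u: "u \<in> \<Omega>" "z = \<Phi> u" using \<Phi>(2) by auto
    have "u \<notin> ?C" using elim u by auto
    hence "cmod (f u) > 1 - e" using u by auto
    moreover have "f u \<in> ball 0 1" using pr u unfolding proper_holo_onto_disc_def by blast
    ultimately show ?case using u \<phi> by (simp add: dist_real_def)
  qed
qed

text \<open>In a chart both \<open>\<phi>\<close> and \<open>F\<close> are continued
  holomorphically, to \<open>E1\<close> and \<open>E2\<close>, and the extension of \<open>h\<close>
  is \<open>deriv E2 / deriv E1\<close>. The factor \<open>deriv G\<close> cancels in the quotient,
  so on the reflected copy it agrees with \<open>cnj k\<close> in every chart, and the local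
  extensions come from a single function.\<close>

lemma meromorphic_extension_to_double:
  assumes oU: "open U"
    and charts: "\<And>p. p \<in> frontier U \<Longrightarrow> \<exists>G r. double_chart U G r p"
    and \<phi>: "\<phi> holomorphic_on U" "inj_on \<phi> U" "\<phi> ` U = \<Omega>" and o\<Omega>: "open \<Omega>" and f: "f holomorphic_on \<Omega>"
    and M: "M holomorphic_on U - P" "M meromorphic_on U" and P: "finite P"
    and bd: "conjugate_boundary_values U P \<phi> M"
    and F1: "\<And>z. z \<in> U \<Longrightarrow> cmod (f (\<phi> z)) < 1"
    and Flim: "\<And>q. q \<in> frontier U \<Longrightarrow> ((\<lambda>z. cmod (f (\<phi> z))) \<longlongrightarrow> 1) (at q within U)"
    and h: "\<And>z. z \<in> U \<Longrightarrow> h z = deriv f (\<phi> z)"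
  shows "extends_meromorphically_to_double U h"
proof -
  define F where "F = (\<lambda>z. f (\<phi> z))"
  have F: "F holomorphic_on U"
    unfolding F_def using holomorphic_on_compose_gen[OF \<phi>(1) f] \<phi>(3) by (simp add: o_def)
  have d\<phi>: "(\<phi> has_field_derivative deriv \<phi> z) (at z)" "deriv \<phi> z \<noteq> 0" if "z \<in> U" for z
    using holomorphic_derivI[OF \<phi>(1) oU that] holomorphic_injective_imp_regular[OF \<phi>(1) oU \<phi>(2) that] by auto
  have dF: "(F has_field_derivative h z * deriv \<phi> z) (at z)" if "z \<in> U" for z
  proof -
    have "\<phi> z \<in> \<Omega>" using that \<phi>(3) by auto
    from DERIV_chain[OF holomorphic_derivI[OF f o\<Omega> this] d\<phi>(1)[OF that]] show ?thesis
      using h[OF that] by (simp add: F_def o_def)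
  qed
  have mh: "h meromorphic_on U"
  proof -
    have "(\<lambda>z. deriv f (\<phi> z)) holomorphic_on U"
      using holomorphic_on_compose_gen[OF \<phi>(1) holomorphic_deriv[OF f o\<Omega>]] \<phi>(3) by (simp add: o_def)
    hence "h holomorphic_on U" by (rule holomorphic_transform) (simp add: h)
    thus ?thesis using oU by (intro analytic_on_imp_meromorphic_on) (simp add: analytic_on_open)
  qed
  define k where "k z = deriv (\<lambda>v. inverse (F v)) z / deriv M z" for z
  \<comment> \<open>Meromorphy tolerates wrong values only at isolated points, and the glued
    function reads \<open>H2\<close> along the whole diameter. Boundary values must therefore be
    right and independent of the chart; the limit of \<open>h\<close> from inside \<open>U\<close>
    is both.\<close>
  define H2 where "H2 z = (if z \<in> U then cnj (k z) else Lim (at z within U) h)" for z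
  have "k meromorphic_on U"
    unfolding k_def using F oU
    by (intro meromorphic_intros M analytic_on_imp_meromorphic_on) (simp add: analytic_on_open)
  hence "(\<lambda>w. cnj (k (cnj w))) meromorphic_on cnj ` U"
    using oU by (rule meromorphic_on_cnj_cnj)
  also have "?this \<longleftrightarrow> (\<lambda>w. H2 (cnj w)) meromorphic_on cnj ` U"
  proof (rule meromorphic_on_cong[OF _ refl])
    fix z assume z: "z \<in> cnj ` U"
    have "open (cnj ` U)"
      unfolding image_cnj_conv_vimage_cnj using oU by (intro open_vimage) auto
    hence "\<forall>\<^sub>F w in at z. w \<in> cnj ` U" using z by (intro eventually_at_in_open') auto
    thus "\<forall>\<^sub>F w in at z. cnj (k (cnj w)) = H2 (cnj w)"
      by eventually_elim (auto simp: H2_def)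
  qed
  finally have mH2: "(\<lambda>w. H2 (cnj w)) meromorphic_on cnj ` U" .
  have "\<exists>G r. double_chart U G r p \<and>
           (\<lambda>w. if Im w > 0 then h (G w) else H2 (G (cnj w))) meromorphic_on ball 0 r"
    if p: "p \<in> frontier U" for p
  proof -
    obtain G r0 where ch0: "double_chart U G r0 p" using charts[OF p] by blast
    obtain r1 K where r1: "0 < r1" "r1 \<le> r0" "G ` ball 0 r1 \<inter> P = {}"
      and K': "\<forall>w\<in>ball 0 r1. Im w > 0 \<longrightarrow> cmod (\<phi> (G w)) \<le> K / sqrt (Im w)"
      and Mlim': "\<forall>t\<in>ball 0 r1. Im t = 0 \<longrightarrow> ((\<lambda>w. cnj (\<phi> (G w)) - M (G w)) \<longlongrightarrow> 0) (at t within {w. Im w > 0})"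
      using bd[unfolded conjugate_boundary_values_def, THEN spec, THEN spec, THEN spec, THEN mp, OF ch0]
      by (elim exE conjE)
    have K: "cmod (\<phi> (G w)) \<le> K / sqrt (Im w)" if "w \<in> ball 0 r1" "Im w > 0" for w
      using K' that by blast
    have Mlim: "((\<lambda>w. cnj (\<phi> (G w)) - M (G w)) \<longlongrightarrow> 0) (at t within {w. Im w > 0})"
      if "t \<in> ball 0 r1" "Im t = 0" for t
      using Mlim' that by blast
    have ch1: "double_chart U G r1 p" using double_chart_shrink[OF ch0 r1(1,2)] .
    have Flim': "((\<lambda>w. cmod (F (G w))) \<longlongrightarrow> 1) (at t within {w. Im w > 0})"
      if t: "t \<in> ball 0 r1" "Im t = 0" for t
    proof -
      have "G t \<in> frontier U" using double_chart_frontier_iff(1)[OF oU ch1 t(1)] t by simp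
      from filterlim_compose[OF Flim[OF this] chart_filterlim[OF oU ch1 t]] show ?thesis
        by (simp add: F_def)
    qed
    \<comment> \<open>Keeping \<open>|F|\<close> above \<open>1 / 2\<close> makes
      \<open>1 / F\<close> holomorphic on the chart, so the reflected branch of \<open>F\<close> has
      no poles there.\<close>
    obtain r where r: "0 < r" "r \<le> r1" and Fhalf: "\<And>w. w \<in> ball 0 r \<Longrightarrow> Im w > 0 \<Longrightarrow> cmod (F (G w)) > 1 / 2"
    proof -
      have "\<forall>\<^sub>F w in at 0 within {w. Im w > 0}. cmod (F (G w)) > 1 / 2"
        using Flim'[of 0] r1 by (intro order_tendstoD(1)[of _ 1]) auto
      then obtain d where "d > 0" "\<forall>w\<in>{w. Im w > 0}. w \<noteq> 0 \<and> dist w 0 < d \<longrightarrow> cmod (F (G w)) > 1 / 2"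
        unfolding eventually_at by blast
      thus ?thesis using r1 by (intro that[of "min d r1"]) auto
    qed
    have ch: "double_chart U G r p" using double_chart_shrink[OF ch1 r] .
    have holG: "G holomorphic_on ball 0 r" and injG: "inj_on G (ball 0 r)" using ch by (auto simp: double_chart_def)
    have GU: "G w \<in> U \<longleftrightarrow> Im w > 0" and Gfr: "G w \<in> frontier U \<longleftrightarrow> Im w = 0" if "w \<in> ball 0 r" for w
      using double_chart_frontier_iff[OF oU ch that] by auto
    have GP: "G w \<notin> P" if "w \<in> ball 0 r" for w
    proof -
      have "w \<in> ball 0 r1" using that r by simp
      thus ?thesis using r1(3) by blast
    qed
    have dG: "(G has_field_derivative deriv G w) (at w)" "deriv G w \<noteq> 0" if "w \<in> ball 0 r" for w
      using holomorphic_derivI[OF holG open_ball that] holomorphic_injective_imp_regular[OF holG open_ball injG that] by auto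
    let ?Dp = "ball 0 r \<inter> {w. Im w > 0}" and ?Dm = "ball 0 r \<inter> {w. Im w < 0}"
    have d1: "((\<lambda>w. \<phi> (G w)) has_field_derivative deriv \<phi> (G w) * deriv G w) (at w)"
      and d2: "((\<lambda>w. F (G w)) has_field_derivative h (G w) * deriv \<phi> (G w) * deriv G w) (at w)"
      if "w \<in> ?Dp" for w
    proof -
      have w: "w \<in> ball 0 r" "G w \<in> U" using that GU by auto
      show "((\<lambda>w. \<phi> (G w)) has_field_derivative deriv \<phi> (G w) * deriv G w) (at w)"
        using DERIV_chain[OF d\<phi>(1)[OF w(2)] dG(1)[OF w(1)]] by (simp add: o_def)
      show "((\<lambda>w. F (G w)) has_field_derivative h (G w) * deriv \<phi> (G w) * deriv G w) (at w)"
        using DERIV_chain[OF dF[OF w(2)] dG(1)[OF w(1)]] by (simp add: o_def)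
    qed
    have d3: "((\<lambda>w. cnj (M (G (cnj w)))) has_field_derivative cnj (deriv M (G (cnj w)) * deriv G (cnj w))) (at w)"
      and d4: "((\<lambda>w. cnj (inverse (F (G (cnj w))))) has_field_derivative
          cnj (deriv (\<lambda>v. inverse (F v)) (G (cnj w)) * deriv G (cnj w))) (at w)"
      if "w \<in> ?Dm" for w
    proof -
      have w: "cnj w \<in> ball 0 r" "G (cnj w) \<in> U - P" "G (cnj w) \<in> U" using that GU GP by auto
      have "open (U - P)" using oU P by (simp add: finite_imp_closed open_Diff)
      from deriv_cnj_cnj_chain[OF holomorphic_derivI[OF M(1) this w(2)] dG(1)[OF w(1)]]
      show "((\<lambda>w. cnj (M (G (cnj w)))) has_field_derivative cnj (deriv M (G (cnj w)) * deriv G (cnj w))) (at w)" .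
      have "F (G (cnj w)) \<noteq> 0" using Fhalf[OF w(1)] that by auto
      hence "((\<lambda>v. inverse (F v)) has_field_derivative
         - (inverse (F (G (cnj w))) * (h (G (cnj w)) * deriv \<phi> (G (cnj w))) * inverse (F (G (cnj w))))) (at (G (cnj w)))"
        by (intro DERIV_inverse' dF w(3))
      hence "((\<lambda>v. inverse (F v)) has_field_derivative deriv (\<lambda>v. inverse (F v)) (G (cnj w))) (at (G (cnj w)))"
        by (simp add: DERIV_imp_deriv)
      from deriv_cnj_cnj_chain[OF this dG(1)[OF w(1)]]
      show "((\<lambda>w. cnj (inverse (F (G (cnj w))))) has_field_derivative
          cnj (deriv (\<lambda>v. inverse (F v)) (G (cnj w)) * deriv G (cnj w))) (at w)" .
    qed
    have holI: "q holomorphic_on S" if "\<And>w. w \<in> S \<Longrightarrow> \<exists>D. (q has_field_derivative D) (at w)" for q :: "complex \<Rightarrow> complex" and S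
      using that by (auto simp: holomorphic_on_def field_differentiable_def intro: has_field_derivative_at_within) 
    have "\<exists>E s. 0 < s \<and> s \<le> r \<and> E holomorphic_on ball 0 s \<and>
      (\<forall>w\<in>ball 0 s. Im w > 0 \<longrightarrow> E w = \<phi> (G w)) \<and> (\<forall>w\<in>ball 0 s. Im w < 0 \<longrightarrow> E w = cnj (M (G (cnj w))))"
    proof (rule holomorphic_glue_across_real_line[OF r(1)])
      show "(\<lambda>w. \<phi> (G w)) holomorphic_on ?Dp" by (rule holI) (use d1 in blast)
      show "(\<lambda>w. cnj (M (G (cnj w)))) holomorphic_on ?Dm" by (rule holI) (use d3 in blast)
      show "cmod (\<phi> (G w)) \<le> K / sqrt (Im w)" if "w \<in> ball 0 r" "Im w > 0" for w
        using that r by (intro K) auto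
      fix t :: complex assume t: "t \<in> ball 0 r" "Im t = 0"
      hence "((\<lambda>w. cnj (cnj (\<phi> (G w)) - M (G w))) \<longlongrightarrow> cnj 0) (at t within {w. Im w > 0})"
        using r by (intro tendsto_cnj Mlim) auto
      thus "((\<lambda>w. \<phi> (G w) - cnj (M (G (cnj (cnj w))))) \<longlongrightarrow> 0) (at t within {w. Im w > 0})" by simp
    qed
    then obtain E1 s1 where E1: "0 < s1" "s1 \<le> r" "E1 holomorphic_on ball 0 s1"
      "\<And>w. w \<in> ball 0 s1 \<Longrightarrow> Im w > 0 \<Longrightarrow> E1 w = \<phi> (G w)"
      "\<And>w. w \<in> ball 0 s1 \<Longrightarrow> Im w < 0 \<Longrightarrow> E1 w = cnj (M (G (cnj w)))" by blast
    have "\<exists>E s. 0 < s \<and> s \<le> r \<and> E holomorphic_on ball 0 s \<and>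
      (\<forall>w\<in>ball 0 s. Im w > 0 \<longrightarrow> E w = F (G w)) \<and> (\<forall>w\<in>ball 0 s. Im w < 0 \<longrightarrow> E w = cnj (inverse (F (G (cnj w)))))"
    proof (rule holomorphic_glue_across_real_line[OF r(1)])
      show "(\<lambda>w. F (G w)) holomorphic_on ?Dp" by (rule holI) (use d2 in blast)
      show "(\<lambda>w. cnj (inverse (F (G (cnj w))))) holomorphic_on ?Dm" by (rule holI) (use d4 in blast)
      show "cmod (F (G w)) \<le> sqrt r / sqrt (Im w)" if w: "w \<in> ball 0 r" "Im w > 0" for w
      proof -
        have "cmod (F (G w)) \<le> 1" using F1[of "G w"] GU w by (simp add: F_def)
        also have "1 \<le> sqrt r / sqrt (Im w)" using w abs_Im_le_cmod[of w] by simp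
        finally show ?thesis .
      qed
      fix t :: complex assume t: "t \<in> ball 0 r" "Im t = 0"
      have Fl: "((\<lambda>w. cmod (F (G w))) \<longlongrightarrow> 1) (at t within {w. Im w > 0})"
        using t r by (intro Flim') auto
      \<comment> \<open>The two branches differ by
        \<open>F - 1 / cnj F = (|F|^2 - 1) / cnj F\<close>, so convergence of the modulus suffices
        and the argument of \<open>F\<close> need not converge.\<close>
      have "((\<lambda>w. ((cmod (F (G w)))\<^sup>2 - 1) / cmod (F (G w))) \<longlongrightarrow> (1\<^sup>2 - 1) / 1) (at t within {w. Im w > 0})"
        by (intro tendsto_intros Fl) auto
      hence "((\<lambda>w. ((cmod (F (G w)))\<^sup>2 - 1) / cmod (F (G w))) \<longlongrightarrow> 0) (at t within {w. Im w > 0})" by simp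
      hence *: "((\<lambda>w. \<bar>((cmod (F (G w)))\<^sup>2 - 1) / cmod (F (G w))\<bar>) \<longlongrightarrow> 0) (at t within {w. Im w > 0})"
        by (rule tendsto_rabs_zero)
      have "\<forall>\<^sub>F w in at t within {w. Im w > 0}. w \<in> ball 0 r \<and> Im w > 0"
        unfolding eventually_at_topological using t by (intro exI[of _ "ball 0 r"]) auto
      hence "\<forall>\<^sub>F w in at t within {w. Im w > 0}.
        \<bar>((cmod (F (G w)))\<^sup>2 - 1) / cmod (F (G w))\<bar> = cmod (F (G w) - cnj (inverse (F (G (cnj (cnj w))))))"
      proof eventually_elim
        case (elim w)
        have nz: "F (G w) \<noteq> 0" using Fhalf[of w] elim by auto
        have "F (G w) - cnj (inverse (F (G w))) = of_real ((cmod (F (G w)))\<^sup>2 - 1) / cnj (F (G w))"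
          using nz by (simp add: field_simps complex_norm_square[unfolded of_real_power])
        hence "cmod (F (G w) - cnj (inverse (F (G w)))) = \<bar>(cmod (F (G w)))\<^sup>2 - 1\<bar> / cmod (F (G w))"
          by (simp only: norm_divide norm_of_real complex_mod_cnj)
        thus ?case by simp
      qed
      from Lim_transform_eventually[OF * this]
      have "((\<lambda>w. cmod (F (G w) - cnj (inverse (F (G (cnj (cnj w))))))) \<longlongrightarrow> 0) (at t within {w. Im w > 0})" .
      thus "((\<lambda>w. F (G w) - cnj (inverse (F (G (cnj (cnj w)))))) \<longlongrightarrow> 0) (at t within {w. Im w > 0})"
        by (simp only: tendsto_norm_zero_iff)
    qed
    then obtain E2 s2 where E2: "0 < s2" "s2 \<le> r" "E2 holomorphic_on ball 0 s2"
      "\<And>w. w \<in> ball 0 s2 \<Longrightarrow> Im w > 0 \<Longrightarrow> E2 w = F (G w)"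
      "\<And>w. w \<in> ball 0 s2 \<Longrightarrow> Im w < 0 \<Longrightarrow> E2 w = cnj (inverse (F (G (cnj w))))" by blast
    define s where "s = min s1 s2"
    have s: "0 < s" "s \<le> s1" "s \<le> s2" "s \<le> r" using E1 E2 by (auto simp: s_def)
    have chs: "double_chart U G s p" using double_chart_shrink[OF ch s(1,4)] .
    have holE: "deriv E1 holomorphic_on ball 0 s" "deriv E2 holomorphic_on ball 0 s"
      using E1(3) E2(3) s by (auto intro!: holomorphic_deriv elim!: holomorphic_on_subset)
    define E where "E w = deriv E2 w / deriv E1 w" for w
    have up: "deriv E1 w = deriv \<phi> (G w) * deriv G w" "deriv E2 w = h (G w) * deriv \<phi> (G w) * deriv G w"
      if w: "w \<in> ball 0 s" "Im w > 0" for w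
    proof -
      have o: "open (ball 0 s \<inter> {w. Im w > 0})" "w \<in> ball 0 s \<inter> {w. Im w > 0}" "w \<in> ?Dp"
        using w s by (auto intro!: open_Int open_halfspace_Im_gt)
      show "deriv E1 w = deriv \<phi> (G w) * deriv G w"
        by (rule DERIV_imp_deriv, rule has_field_derivative_transform_within_open[OF d1[OF o(3)] o(1,2)])
          (use E1(4) s in auto)
      show "deriv E2 w = h (G w) * deriv \<phi> (G w) * deriv G w"
        by (rule DERIV_imp_deriv, rule has_field_derivative_transform_within_open[OF d2[OF o(3)] o(1,2)])
          (use E2(4) s in auto)
    qed
    have up_nz: "deriv E1 w \<noteq> 0" and up_E: "E w = h (G w)" if w: "w \<in> ball 0 s" "Im w > 0" for w
    proof -
      have wr: "w \<in> ball 0 r" using w s by simp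
      have "deriv \<phi> (G w) \<noteq> 0" "deriv G w \<noteq> 0" using d\<phi>(2) dG(2) GU wr w by auto
      thus "deriv E1 w \<noteq> 0" "E w = h (G w)" by (simp_all add: E_def up[OF w])
    qed
    have low_E: "E w = cnj (k (G (cnj w)))" if w: "w \<in> ball 0 s" "Im w < 0" for w
    proof -
      have o: "open (ball 0 s \<inter> {w. Im w < 0})" "w \<in> ball 0 s \<inter> {w. Im w < 0}" "w \<in> ?Dm"
        using w s by (auto intro!: open_Int open_halfspace_Im_lt)
      have "deriv E1 w = cnj (deriv M (G (cnj w)) * deriv G (cnj w))"
        by (rule DERIV_imp_deriv, rule has_field_derivative_transform_within_open[OF d3[OF o(3)] o(1,2)])
          (use E1(5) s in auto)
      moreover have "deriv E2 w = cnj (deriv (\<lambda>v. inverse (F v)) (G (cnj w)) * deriv G (cnj w))"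
        by (rule DERIV_imp_deriv, rule has_field_derivative_transform_within_open[OF d4[OF o(3)] o(1,2)])
          (use E2(5) s in auto)
      moreover have "deriv G (cnj w) \<noteq> 0" using w s by (intro dG(2)) auto
      ultimately show ?thesis by (simp add: E_def k_def)
    qed
    \<comment> \<open>Where \<open>deriv E1\<close> does not vanish, \<open>E\<close> is continuous,
      so its value on the diameter is the limit of \<open>h\<close> through \<open>U\<close>, as in
      the definition of \<open>H2\<close>.\<close>
    have mid_E: "E w = Lim (at (G w) within U) h" if w: "w \<in> ball 0 s" "Im w = 0" "deriv E1 w \<noteq> 0" for w
    proof -
      have wr: "w \<in> ball 0 r" using w s by simp
      have "isCont (deriv E1) w" "isCont (deriv E2) w"
        using holE w holomorphic_on_imp_continuous_on continuous_on_eq_continuous_at[of "ball 0 s"] by blast+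
      hence Ec: "isCont E w" unfolding E_def[abs_def] using w by (intro isCont_divide)
      have holGs: "G holomorphic_on ball 0 s" and injGs: "inj_on G (ball 0 s)"
        using chs by (auto simp: double_chart_def)
      obtain Gi where Gi: "Gi holomorphic_on G ` ball 0 s" "\<And>w. w \<in> ball 0 s \<Longrightarrow> Gi (G w) = w"
        using holomorphic_has_inverse[OF holGs open_ball injGs] by metis
      have oG: "open (G ` ball 0 s)" by (rule open_mapping_thm3[OF holGs open_ball injGs])
      have "isCont Gi (G w)"
        using holomorphic_on_imp_continuous_on[OF Gi(1)] oG w continuous_on_eq_continuous_at by blast
      hence "(Gi \<longlongrightarrow> Gi (G w)) (at (G w) within U)"
        unfolding isCont_def by (rule tendsto_within_subset) simp
      hence "(Gi \<longlongrightarrow> w) (at (G w) within U)" by (simp only: Gi(2)[OF w(1)])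
      hence "((\<lambda>z. E (Gi z)) \<longlongrightarrow> E w) (at (G w) within U)"
        by (rule isCont_tendsto_compose[OF Ec])
      moreover have "\<forall>\<^sub>F z in at (G w) within U. z \<in> G ` ball 0 s \<and> z \<in> U"
        unfolding eventually_at_topological using oG w by (intro exI[of _ "G ` ball 0 s"]) auto
      hence "\<forall>\<^sub>F z in at (G w) within U. E (Gi z) = h z"
      proof eventually_elim
        case (elim z)
        then obtain v where v: "v \<in> ball 0 s" "z = G v" by blast
        hence "Im v > 0" using elim GU[of v] s by auto
        thus ?case using v up_E[of v] Gi(2) by simp
      qed
      ultimately have "(h \<longlongrightarrow> E w) (at (G w) within U)" by (rule Lim_transform_eventually)
      moreover have "\<not> trivial_limit (at (G w) within U)"
      proof -
        have "G w \<in> frontier U" "G w \<notin> U" using Gfr[OF wr] GU[OF wr] w by auto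
        hence "G w islimpt U" by (simp add: frontier_def closure_def)
        thus ?thesis by (simp add: trivial_limit_within)
      qed
      ultimately show ?thesis by (intro tendsto_Lim[symmetric])
    qed
    have "E meromorphic_on ball 0 s"
      unfolding E_def using holE by (intro meromorphic_intros analytic_on_imp_meromorphic_on) (auto simp: analytic_on_open)
    also have "?this \<longleftrightarrow> (\<lambda>w. if Im w > 0 then h (G w) else H2 (G (cnj w))) meromorphic_on ball 0 s"
    proof (rule meromorphic_on_cong[OF _ refl])
      fix z :: complex assume z: "z \<in> ball 0 s"
      have i: "\<i> * of_real (s / 2) \<in> ball 0 s" "Im (\<i> * of_real (s / 2)) > 0"
        using s by (auto simp: norm_mult)
      \<comment> \<open>\<open>deriv E1\<close> is non-zero at a point of the upper half-disc, so
        its zeros are isolated, and agreement with \<open>E\<close> in punctured neighbourhoods is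
        enough.\<close>
      have "\<forall>\<^sub>F w in at z. deriv E1 w \<noteq> 0 \<and> w \<in> ball 0 s"
        by (rule non_zero_neighbour_alt[OF holE(1) open_ball _ z i(1) up_nz[OF i]]) auto
      thus "\<forall>\<^sub>F w in at z. E w = (if Im w > 0 then h (G w) else H2 (G (cnj w)))"
      proof eventually_elim
        case (elim w)
        consider "Im w > 0" | "Im w < 0" | "Im w = 0" by linarith
        thus ?case
        proof cases
          case 1 thus ?thesis using up_E[of w] elim by simp
        next
          case 2
          have "cnj w \<in> ball 0 r" using elim s by simp
          hence "G (cnj w) \<in> U" using GU[of "cnj w"] 2 by simp
          thus ?thesis using low_E[of w] elim 2 by (simp add: H2_def)
        next
          case 3
          have "cnj w = w" using 3 by (simp add: complex_eq_iff)
          moreover have "G w \<notin> U" using GU[of w] 3 elim s by simp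
          ultimately show ?thesis using mid_E[of w] elim 3 by (simp add: H2_def)
        qed
      qed
    qed
    finally show ?thesis using chs by blast
  qed
  with mh mH2 show ?thesis unfolding extends_meromorphically_to_double_def by blast
qed

theorem theorem1p3:
  fixes \<Omega> :: "complex set" and n :: nat and f :: "complex \<Rightarrow> complex"
  assumes "quadrature_domain \<Omega>"
    and "emeasure lborel \<Omega> < \<infinity>"
    and "n_connected_nondegenerate \<Omega> n"
    and "proper_holo_onto_disc \<Omega> f"
  shows "\<forall>\<Phi> U. \<Phi> holomorphic_on \<Omega> \<and> inj_on \<Phi> \<Omega> \<and> \<Phi> ` \<Omega> = U \<and> analytic_n_bordered U n
           \<longrightarrow> extends_meromorphically_to_double U (\<lambda>z. deriv f (inv_into \<Omega> \<Phi> z))"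
proof (intro allI impI, elim conjE)
  fix \<Phi> U
  assume \<Phi>: "\<Phi> holomorphic_on \<Omega>" "inj_on \<Phi> \<Omega>" and U: "\<Phi> ` \<Omega> = U" and bU: "analytic_n_bordered U n"
  define \<phi> where "\<phi> = inv_into \<Omega> \<Phi>"
  have o\<Omega>: "open \<Omega>" using assms(1) by (simp add: quadrature_domain_def)
  have oU: "open U" "bounded U" using bU by (simp_all add: analytic_n_bordered_def)
  have \<phi>\<Phi>: "\<phi> (\<Phi> z) = z" if "z \<in> \<Omega>" for z
    using that \<Phi>(2) by (simp add: \<phi>_def)
  have \<phi>U: "\<phi> ` U = \<Omega>" using \<phi>\<Phi> U by (auto simp: image_iff)
  have inj: "inj_on \<phi> U"
    using U unfolding \<phi>_def by (metis inj_on_inv_into order_refl)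
  have hol: "\<phi> holomorphic_on U"
  proof -
    obtain \<psi> where \<psi>: "\<psi> holomorphic_on \<Phi> ` \<Omega>" "\<And>z. z \<in> \<Omega> \<Longrightarrow> \<psi> (\<Phi> z) = z"
      using holomorphic_has_inverse[OF \<Phi>(1) o\<Omega> \<Phi>(2)] by metis
    show ?thesis unfolding U[symmetric] by (rule holomorphic_transform[OF \<psi>(1)]) (auto simp: \<phi>\<Phi> \<psi>(2))
  qed
  define g where "g = (\<lambda>z. if z \<in> U then deriv \<phi> z else 0)"
  have Q: "integrable lborel g" "integrable lborel (\<lambda>z. (cmod (g z))\<^sup>2)"
    "\<exists>R P. finite P \<and> P \<subseteq> U \<and> R meromorphic_on UNIV \<and> R holomorphic_on - P \<and>
      (\<forall>\<zeta>. \<zeta> \<notin> closure U \<longrightarrow> (LINT z|lborel. cnj (g z) * (1 / (z - \<zeta>))) = R \<zeta>)"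
    unfolding g_def by (rule quadrature_domain_pullback[OF assms(1,2) \<Phi> U oU(2) hol \<phi>\<Phi>]; assumption)+
  obtain R P where R: "finite P" "P \<subseteq> U" "R meromorphic_on UNIV" "R holomorphic_on - P"
    and RC: "\<forall>\<zeta>. \<zeta> \<notin> closure U \<longrightarrow> (LINT z|lborel. cnj (g z) * (1 / (z - \<zeta>))) = R \<zeta>"
    using Q(3) by (elim exE conjE)
  have "\<exists>M. M holomorphic_on U - P \<and> M meromorphic_on U \<and> conjugate_boundary_values U P \<phi> M"
    using RC by (intro schwarz_function_exists[OF oU(1) hol g_def Q(1,2) R]) simp
  then obtain M where M: "M holomorphic_on U - P" "M meromorphic_on U" "conjugate_boundary_values U P \<phi> M"
    by (elim exE conjE)
  have f: "f holomorphic_on \<Omega>" "f ` \<Omega> = ball 0 1"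
    using assms(4) by (simp_all add: proper_holo_onto_disc_def)
  have "extends_meromorphically_to_double U (\<lambda>z. deriv f (\<phi> z))"
  proof (rule meromorphic_extension_to_double[OF oU(1) _ hol inj \<phi>U o\<Omega> f(1) M(1,2) R(1) M(3)])
    show "\<exists>G r. double_chart U G r p" if "p \<in> frontier U" for p
      using analytic_boundary_double_chart[OF bU that] .
    show "cmod (f (\<phi> z)) < 1" if "z \<in> U" for z
      using that \<phi>U f(2) by force
    show "((\<lambda>z. cmod (f (\<phi> z))) \<longlongrightarrow> 1) (at q within U)" if "q \<in> frontier U" for q
      using that oU(1) by (intro proper_disc_map_boundary_limit[OF assms(4) \<Phi>(1) U \<phi>\<Phi>])
        (auto simp: frontier_def interior_open)
  qed auto
  thus "extends_meromorphically_to_double U (\<lambda>z. deriv f (inv_into \<Omega> \<Phi> z))"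
    by (simp add: \<phi>_def)
qed

end
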